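(* Let $\mu$ be the Gaussian measure on $\mathbb{R}^n$ or the exponential measure on $\mathbb{R}^n_+$ (see context), with moments $y_\alpha=\int \mathbf{x}^\alpha\,d\mu$. Let $\Omega=\{\mathbf{x}\in\mathbb{R}^n: g_j(\mathbf{x})\ge 0,\ j=1,\dots,m\}$ with $g_j\in\mathbb{R}[\mathbf{x}]$; when $\mu$ is the exponential measure it is assumed that the constraints $x_i\ge 0$, $i=1,\dots,n$, are among the constraints $g_j\ge0$ (so $\Omega\subseteq\mathbb{R}^n_+$). Assume that both $\Omega$ and $\operatorname{supp}\mu\setminus\Omega$ have nonempty interior, and let $f\in\mathbb{R}[\mathbf{x}]$ be strictly positive almost everywhere on $\Omega$. Put $d_j=\lceil \deg(g_j)/2\rceil$, $d_0=\max_j d_j$. For $d\ge d_0$ with $2d\ge\deg f$ consider the semidefinite program $$\overline{o}_d=\sup_{\mathbf{u},\mathbf{v}}\Big\{L_{\mathbf{u}}(f):\ u_\alpha+v_\alpha=y_\alpha\ \ \forall \alpha\in\mathbb{N}^n_{2d};\ \mathbf{M}_d(\mathbf{u})\succeq0,\ \mathbf{M}_d(\mathbf{v})\succeq0;\ \mathbf{M}_{d-d_j}(g_j\,\mathbf{u})\succeq0,\ j=1,\dots,m\Big\}\quad (P_d)$$ over $\mathbf{u}=(u_\alpha)_{\alpha\in\mathbb{N}^n_{2d}}$, $\mathbf{v}=(v_\alpha)_{\alpha\in\mathbb{N}^n_{2d}}$, and its dual $$\overline{o}_d^*=\inf_{p\in\mathbb{R}[\mathbf{x}]_{2d}}\Big\{\int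 p\,d\mu:\ p-f\in Q_d(g_1,\dots,g_m),\ p\in\Sigma[\mathbf{x}]_d\Big\}.\quad (D_d)$$ Then: (a) For every such $d$, both $(P_d)$ and $(D_d)$ have an optimal solution and $\overline{o}_d=\overline{o}_d^*$. (b) The sequence $(\overline{o}_d)$ is monotone non-increasing and $\overline{o}_d\to\int_\Omega f\,d\mu$ as $d\to\infty$. In addition, if $(\mathbf{u}^d,\mathbf{v}^d)$ is an optimal solution of $(P_d)$ for each $d$, then $u^d_0\to\mu(\Omega)$ as $d\to\infty$. (c) If $f=1$ then $(\overline{o}_d)$ is monotone non-increasing and $\overline{o}_d\to\mu(\Omega)$ as $d\to\infty$.
   Context: Measures: the Gaussian measure is $\mu(B)=(2\pi)^{-n/2}\int_B\exp(-\|\mathbf{x}\|^2/2)\,d\mathbf{x}$ for Borel $B\subseteq\mathbb{R}^n$ (support $\mathbb{R}^n$); the exponential measure is $\mu(B)=(2\pi)^{-n/2}\int_B\exp(-\sum_{i=1}^n x_i)\,d\mathbf{x}$ for Borel $B\subseteq\mathbb{R}^n_+$, viewed as a measure on $\mathbb{R}^n$ with support $\mathbb{R}^n_+=\{\mathbf{x}:\mathbf{x}\ge0\}$. Notation: $\mathbb{R}[\mathbf{x}]$ is the ring of real polynomials in $\mathbf{x}=(x_1,\dots,x_n)$, $\mathbb{R}[\mathbf{x}]_k$ those of degree at most $k$; $\mathbb{N}^n_k=\{\alpha\in\mathbb{N}^n:\sum_i\alpha_i\le k\}$; $\Sigma[\mathbf{x}]_k\subset\mathbb{R}[\mathbf{x}]_{2k}$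 is the set of sums of squares of polynomials of degree at most $2k$. For a (truncated) sequence $\mathbf{z}=(z_\alpha)$, $L_{\mathbf{z}}(\sum_\alpha f_\alpha\mathbf{x}^\alpha)=\sum_\alpha f_\alpha z_\alpha$. The moment matrix $\mathbf{M}_k(\mathbf{z})$ has rows and columns indexed by $\mathbb{N}^n_k$ and $(\alpha,\beta)$ entry $z_{\alpha+\beta}$; for $g=\sum_\gamma g_\gamma\mathbf{x}^\gamma$ the localizing matrix $\mathbf{M}_k(g\,\mathbf{z})$ has rows and columns indexed by $\mathbb{N}^n_k$ and $(\alpha,\beta)$ entry $\sum_\gamma g_\gamma z_{\alpha+\beta+\gamma}$. $\mathbf{A}\succeq0$ means the real symmetric matrix $\mathbf{A}$ is positive semidefinite. With $g_0=1$, $d_0^{(g_0)}=0$ (the half-degree of $g_0$), the truncated quadratic module is $Q_d(g_1,\dots,g_m)=\{\sigma_0+\sum_{j=1}^m\sigma_jg_j:\ \sigma_0\in\Sigma[\mathbf{x}]_d,\ \sigma_j\in\Sigma[\mathbf{x}]_{d-d_j}\}$. *)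

theory Defs
  imports "HOL-Analysis.Analysis" "HOL-Library.Poly_Mapping"
begin

text \<open>
  Exponents live in \<open>nat ^ 'n\<close>; a real polynomial in the variables indexed by \<open>'n\<close> is a finitely
  supported coefficient function on exponents, with the convolution product of
  \<^theory>\<open>HOL-Library.Poly_Mapping\<close>.
\<close>

type_synonym 'n mpoly = "(nat ^ 'n) \<Rightarrow>\<^sub>0 real"

definition var :: "'n::finite \<Rightarrow> 'n mpoly" where
  "var i = Poly_Mapping.single (axis i 1) 1"

definition monom_eval :: "nat ^ 'n::finite \<Rightarrow> real ^ 'n \<Rightarrow> real" where
  "monom_eval \<alpha> x = (\<Prod>i\<in>UNIV. (x $ i) ^ (\<alpha> $ i))"

definition mpoly_eval :: "'n::finite mpoly \<Rightarrow> real ^ 'n \<Rightarrow> real" where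
  "mpoly_eval p x = (\<Sum>\<alpha>\<in>Poly_Mapping.keys p. Poly_Mapping.lookup p \<alpha> * monom_eval \<alpha> x)"

definition exp_deg :: "nat ^ 'n::finite \<Rightarrow> nat" where
  "exp_deg \<alpha> = (\<Sum>i\<in>UNIV. \<alpha> $ i)"

text \<open>The zero polynomial has degree 0.\<close>

definition mdegree :: "'n::finite mpoly \<Rightarrow> nat" where
  "mdegree p = Max (insert 0 (exp_deg ` Poly_Mapping.keys p))"

definition half_deg :: "'n::finite mpoly \<Rightarrow> nat" where
  "half_deg p = nat \<lceil>real (mdegree p) / 2\<rceil>"

definition exps_le :: "nat \<Rightarrow> (nat ^ 'n::finite) set" where
  "exps_le k = {\<alpha>. exp_deg \<alpha> \<le> k}"

definition mpolys_le :: "nat \<Rightarrow> 'n::finite mpoly set" where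
  "mpolys_le k = {p. mdegree p \<le> k}"

definition SOS :: "nat \<Rightarrow> 'n::finite mpoly set" where
  "SOS k = {s \<in> mpolys_le (2 * k). \<exists>qs. s = (\<Sum>q\<leftarrow>qs. q ^ 2)}"

definition quadratic_module :: "nat \<Rightarrow> nat \<Rightarrow> (nat \<Rightarrow> 'n::finite mpoly) \<Rightarrow> 'n mpoly set" where
  "quadratic_module d m g =
    {\<sigma> 0 + (\<Sum>j=1..m. \<sigma> j * g j) | \<sigma>.
      \<sigma> 0 \<in> SOS d \<and> (\<forall>j\<in>{1..m}. \<sigma> j \<in> SOS (d - half_deg (g j)))}"

definition riesz :: "(nat ^ 'n::finite \<Rightarrow> real) \<Rightarrow> 'n mpoly \<Rightarrow> real" where
  "riesz z p = (\<Sum>\<alpha>\<in>Poly_Mapping.keys p. Poly_Mapping.lookup p \<alpha> * z \<alpha>)"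

text \<open>
  Matrices with rows and columns indexed by a finite set \<open>I\<close> are functions of two arguments, of which
  only the values on \<open>I \<times> I\<close> matter.
\<close>

definition psd_on :: "'i set \<Rightarrow> ('i \<Rightarrow> 'i \<Rightarrow> real) \<Rightarrow> bool" where
  "psd_on I A \<longleftrightarrow>
    (\<forall>a\<in>I. \<forall>b\<in>I. A a b = A b a) \<and>
    (\<forall>c. 0 \<le> (\<Sum>a\<in>I. \<Sum>b\<in>I. c a * A a b * c b))"

definition moment_matrix :: "(nat ^ 'n::finite \<Rightarrow> real) \<Rightarrow> nat ^ 'n \<Rightarrow> nat ^ 'n \<Rightarrow> real" where
  "moment_matrix z \<alpha> \<beta> = z (\<alpha> + \<beta>)"

definition localizing_matrix ::
  "'n::finite mpoly \<Rightarrow> (nat ^ 'n \<Rightarrow> real) \<Rightarrow> nat ^ 'n \<Rightarrow> nat ^ 'n \<Rightarrow> real" where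
  "localizing_matrix g z \<alpha> \<beta> =
    (\<Sum>\<gamma>\<in>Poly_Mapping.keys g. Poly_Mapping.lookup g \<gamma> * z (\<alpha> + \<beta> + \<gamma>))"

definition gaussian_measure :: "(real ^ 'n::finite) measure" where
  "gaussian_measure = density lborel
    (\<lambda>x. ennreal ((2 * pi) powr (- real CARD('n) / 2) * exp (- (norm x)\<^sup>2 / 2)))"

definition nonneg_orthant :: "(real ^ 'n::finite) set" where
  "nonneg_orthant = {x. \<forall>i. 0 \<le> x $ i}"

definition exponential_measure :: "(real ^ 'n::finite) measure" where
  "exponential_measure = density lborel
    (\<lambda>x. ennreal ((2 * pi) powr (- real CARD('n) / 2) * exp (- (\<Sum>i\<in>UNIV. x $ i))
            * indicator nonneg_orthant x))"

definition measure_support :: "'a::topological_space measure \<Rightarrow> 'a set" where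
  "measure_support M = {x. \<forall>U. open U \<longrightarrow> x \<in> U \<longrightarrow> emeasure M U > 0}"

definition moment :: "(real ^ 'n::finite) measure \<Rightarrow> nat ^ 'n \<Rightarrow> real" where
  "moment M \<alpha> = (LINT x|M. monom_eval \<alpha> x)"

definition semialg_set :: "nat \<Rightarrow> (nat \<Rightarrow> 'n::finite mpoly) \<Rightarrow> (real ^ 'n) set" where
  "semialg_set m g = {x. \<forall>j\<in>{1..m}. 0 \<le> mpoly_eval (g j) x}"

text \<open>
  Truncated sequences indexed by \<open>exps_le (2 * d)\<close> are represented by total functions. Whenever
  \<open>half_deg (g j) \<le> d\<close> for all \<open>j\<close> and \<open>mdegree f \<le> 2 * d\<close>, feasibility and the objective
  only depend on the values on \<open>exps_le (2 * d)\<close>.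
\<close>

definition primal_feasible ::
  "(real ^ 'n::finite) measure \<Rightarrow> nat \<Rightarrow> (nat \<Rightarrow> 'n mpoly) \<Rightarrow> nat \<Rightarrow>
    (nat ^ 'n \<Rightarrow> real) \<times> (nat ^ 'n \<Rightarrow> real) \<Rightarrow> bool" where
  "primal_feasible M m g d = (\<lambda>(u, v).
    (\<forall>\<alpha>\<in>exps_le (2 * d). u \<alpha> + v \<alpha> = moment M \<alpha>) \<and>
    psd_on (exps_le d) (moment_matrix u) \<and>
    psd_on (exps_le d) (moment_matrix v) \<and>
    (\<forall>j\<in>{1..m}. psd_on (exps_le (d - half_deg (g j))) (localizing_matrix (g j) u)))"

definition primal_objective ::
  "'n::finite mpoly \<Rightarrow> (nat ^ 'n \<Rightarrow> real) \<times> (nat ^ 'n \<Rightarrow> real) \<Rightarrow> real" where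
  "primal_objective f = (\<lambda>(u, v). riesz u f)"

definition primal_value ::
  "(real ^ 'n::finite) measure \<Rightarrow> nat \<Rightarrow> (nat \<Rightarrow> 'n mpoly) \<Rightarrow> 'n mpoly \<Rightarrow> nat \<Rightarrow> ereal" where
  "primal_value M m g f d =
    (SUP w\<in>Collect (primal_feasible M m g d). ereal (primal_objective f w))"

definition primal_optimal ::
  "(real ^ 'n::finite) measure \<Rightarrow> nat \<Rightarrow> (nat \<Rightarrow> 'n mpoly) \<Rightarrow> 'n mpoly \<Rightarrow> nat \<Rightarrow>
    (nat ^ 'n \<Rightarrow> real) \<times> (nat ^ 'n \<Rightarrow> real) \<Rightarrow> bool" where
  "primal_optimal M m g f d = is_arg_max (primal_objective f) (primal_feasible M m g d)"

definition dual_feasible ::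
  "nat \<Rightarrow> (nat \<Rightarrow> 'n::finite mpoly) \<Rightarrow> 'n mpoly \<Rightarrow> nat \<Rightarrow> 'n mpoly \<Rightarrow> bool" where
  "dual_feasible m g f d p \<longleftrightarrow>
    p \<in> mpolys_le (2 * d) \<and> p - f \<in> quadratic_module d m g \<and> p \<in> SOS d"

definition dual_objective :: "(real ^ 'n::finite) measure \<Rightarrow> 'n mpoly \<Rightarrow> real" where
  "dual_objective M p = (LINT x|M. mpoly_eval p x)"

definition dual_value ::
  "(real ^ 'n::finite) measure \<Rightarrow> nat \<Rightarrow> (nat \<Rightarrow> 'n mpoly) \<Rightarrow> 'n mpoly \<Rightarrow> nat \<Rightarrow> ereal" where
  "dual_value M m g f d =
    (INF p\<in>Collect (dual_feasible m g f d). ereal (dual_objective M p))"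

definition dual_optimal ::
  "(real ^ 'n::finite) measure \<Rightarrow> nat \<Rightarrow> (nat \<Rightarrow> 'n mpoly) \<Rightarrow> 'n mpoly \<Rightarrow> nat \<Rightarrow> 'n mpoly \<Rightarrow> bool" where
  "dual_optimal M m g f d = is_arg_min (dual_objective M) (dual_feasible m g f d)"

definition orders :: "nat \<Rightarrow> (nat \<Rightarrow> 'n::finite mpoly) \<Rightarrow> 'n mpoly \<Rightarrow> nat set" where
  "orders m g f = {d. Max ((\<lambda>j. half_deg (g j)) ` {1..m}) \<le> d \<and> mdegree f \<le> 2 * d}"

lemma emeasure_density_pos:
  fixes h :: "real ^ 'n::finite \<Rightarrow> real"
  assumes "h \<in> borel_measurable borel" "open U" "U \<noteq> {}" "\<And>x. x \<in> U \<Longrightarrow> 0 < h x"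
  shows "0 < emeasure (density lborel (\<lambda>x. ennreal (h x))) U"
proof -
  have m: "U \<in> sets lborel" using assms(2) by simp
  have "\<not> (AE x in lborel. x \<in> U \<longrightarrow> ennreal (h x) = 0)"
  proof
    assume "AE x in lborel. x \<in> U \<longrightarrow> ennreal (h x) = 0"
    then have "AE x in lborel. x \<notin> U"
      by eventually_elim (use assms(4) in \<open>force simp: ennreal_eq_0_iff\<close>)
    then have "U \<in> null_sets lborel"
      using m by (simp add: AE_iff_null_sets)
    then have "U \<in> null_sets lebesgue"
      using null_sets_completionI by blast
    then show False
      using assms(2,3) by (simp add: negligible_iff_null_sets[symmetric] open_not_negligible)
  qed
  then have "U \<notin> null_sets (density lborel (\<lambda>x. ennreal (h x)))"
    using assms(1) m by (subst null_sets_density_iff) simp_all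
  then have "emeasure (density lborel (\<lambda>x. ennreal (h x))) U \<noteq> 0"
    using m by (simp add: null_sets_def)
  then show ?thesis by (simp add: zero_less_iff_neq_zero)
qed

lemma closed_nonneg_orthant: "closed (nonneg_orthant :: (real ^ 'n::finite) set)"
  unfolding nonneg_orthant_def
  by (intro closed_Collect_all closed_Collect_le continuous_intros)

lemma measure_support_gaussian:
  "measure_support (gaussian_measure :: (real ^ 'n::finite) measure) = UNIV"
  unfolding measure_support_def gaussian_measure_def
  by (auto intro!: emeasure_density_pos)

lemma measure_support_exponential:
  "measure_support (exponential_measure :: (real ^ 'n::finite) measure) = nonneg_orthant"
proof -
  let ?c = "\<lambda>x::real^'n. (2 * pi) powr (- real CARD('n) / 2) * exp (- (\<Sum>i\<in>UNIV. x $ i))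
              * indicator nonneg_orthant x"
  have mO: "(nonneg_orthant :: (real^'n) set) \<in> sets borel"
    using closed_nonneg_orthant by (rule borel_closed)
  have meas: "?c \<in> borel_measurable borel"
    using mO by (intro borel_measurable_times borel_measurable_indicator
        borel_measurable_continuous_onI continuous_intros)
  have "0 < emeasure exponential_measure U"
    if oU: "open U" and xU: "x \<in> U" and xO: "x \<in> nonneg_orthant" for U and x :: "real^'n"
  proof -
    let ?P = "{y::real^'n. \<forall>i. 0 < y $ i}"
    have "open (\<Inter>i. {y::real^'n. 0 < y $ i})"
      by (intro open_INT finite ballI open_Collect_less continuous_intros)
    moreover have "(\<Inter>i. {y::real^'n. 0 < y $ i}) = ?P" by auto
    ultimately have oP: "open ?P" by simp
    obtain e where e: "e > 0" "ball x e \<subseteq> U"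
      using oU xU by (rule openE)
    obtain n :: real where n: "n > 0" "norm (n *\<^sub>R (1 :: real^'n)) < e"
    proof -
      define w where "w = norm (1 :: real^'n)"
      have "w \<ge> 0" by (simp add: w_def)
      then have "e / (w + 1) > 0" "e / (w + 1) * w < e" using e(1) by (auto simp: field_simps)
      then show thesis using that[of "e / (w + 1)"] \<open>w \<ge> 0\<close> e(1) by (simp add: w_def)
    qed
    let ?y = "x + n *\<^sub>R 1"
    have "?y \<in> ball x e" using n(2) by (simp add: dist_norm)
    then have "?y \<in> U" using e(2) by blast
    moreover have "?y \<in> ?P" using n xO by (auto simp: nonneg_orthant_def add_nonneg_pos)
    ultimately have ne: "U \<inter> ?P \<noteq> {}" by blast
    have "0 < emeasure exponential_measure (U \<inter> ?P)"
      unfolding exponential_measure_def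
      using meas ne oP oU
      by (intro emeasure_density_pos open_Int)
        (simp_all add: nonneg_orthant_def less_imp_le)
    also have "\<dots> \<le> emeasure exponential_measure U"
      using oU by (intro emeasure_mono) (auto simp: exponential_measure_def)
    finally show ?thesis .
  qed
  moreover have "emeasure exponential_measure (- nonneg_orthant :: (real^'n) set) = 0"
  proof -
    have m1: "(\<lambda>x. ennreal (?c x)) \<in> borel_measurable lborel"
      unfolding measurable_lborel2 using meas by (rule measurable_compose) (rule measurable_ennreal)
    have m2: "- nonneg_orthant \<in> sets (lborel :: (real^'n) measure)"
      using mO by (simp add: borel_comp)
    have "(\<integral>\<^sup>+ x. ennreal (?c x) * indicator (- nonneg_orthant) x \<partial>lborel)
        = (\<integral>\<^sup>+ x. 0 \<partial>(lborel :: (real^'n) measure))"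
      by (intro nn_integral_cong) (simp add: indicator_def)
    then show ?thesis
      unfolding exponential_measure_def emeasure_density[OF m1 m2] by simp
  qed
  moreover have "open (- nonneg_orthant :: (real^'n) set)"
    using closed_nonneg_orthant by (rule open_Compl)
  ultimately have "x \<in> measure_support exponential_measure \<longleftrightarrow> x \<in> nonneg_orthant"
    for x :: "real^'n"
    unfolding measure_support_def mem_Collect_eq by (metis ComplI less_irrefl)
  then show ?thesis by blast
qed

end

theory Submission
  imports Defs "HOL-Complex_Analysis.Great_Picard"
begin

text \<open>
  The moments \<open>z\<close> of \<open>\<mu>\<close> restricted to \<open>\<Omega>\<close> form a feasible point of the primal problem that is strictly
  positive on the nonzero generators of the quadratic module. Strict positivity makes the sublevel
  sets of the truncated cones compact; hence both problems are attained, and if no dual feasible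
  point has value at most \<open>c\<close>, projecting onto the compact set of sums of squares of value at most
  \<open>c\<close> produces a primal feasible point with value greater than \<open>c\<close>.

  For the convergence, moment sequences of feasible points at increasing orders are bounded in each
  coordinate. A limit \<open>u\<close> satisfies \<open>0 \<le> u(h\<^sup>2) \<le> \<integral> h\<^sup>2 d\<mu>\<close> and \<open>u(h\<^sup>2 g\<^sub>j) \<ge> 0\<close> for all polynomials
  \<open>h\<close>, so it is represented by some \<open>\<phi> \<in> L\<^sup>2(\<mu>)\<close>. As \<open>\<mu>\<close> has exponential moments, polynomials are
  dense in the relevant weighted \<open>L\<^sup>2\<close> spaces, and testing against squares yields \<open>0 \<le> \<phi> \<le> 1\<close> and
  \<open>\<phi> g\<^sub>j \<ge> 0\<close> almost everywhere. Thus \<open>\<phi>\<close> vanishes outside \<open>\<Omega>\<close>, and \<open>\<integral> \<phi> f d\<mu> \<ge> \<integral>\<^sub>\<Omega> f d\<mu>\<close> forces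
  \<open>\<phi>\<close> to be the indicator of \<open>\<Omega>\<close>.
\<close>


section \<open>Polynomials and linear functionals\<close>

text \<open>\<open>\<Omega>\<close> need not be compact, so no Positivstellensatz for compact sets
  drives the convergence. What replaces it is the block \<open>v = y - u\<close>: its positivity on
  squares makes every feasible \<open>u\<close> dominated by the moments of \<mu>, so that a limit
  is a function in L^2(\<mu>) and not merely a moment sequence. Signs of that function are read off
  from squares of polynomials. The integrand under test is \<phi> g, a product of an L^2 function
  with a polynomial, so the density that is needed lives in the space weighted by |\<phi> g|;
  splitting this product by squares doubles the exponential rate, which is why a small rate such as
  1/4 is used. At a fixed order the obstacle is closedness of the cones. A sum of squares has a
  degree bound on the sum only, and the number of squares is arbitrary, so both the degrees and the
  number have to be controlled before a compactness argument on coefficients can start.\<close>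

abbreviation lookup :: "('a \<Rightarrow>\<^sub>0 'b::zero) \<Rightarrow> 'a \<Rightarrow> 'b" where "lookup \<equiv> Poly_Mapping.lookup"
abbreviation keys :: "('a \<Rightarrow>\<^sub>0 'b::zero) \<Rightarrow> 'a set" where "keys \<equiv> Poly_Mapping.keys"
abbreviation const :: "real \<Rightarrow> 'n::finite mpoly" where "const c \<equiv> Poly_Mapping.single 0 c"

section \<open>Exponents and their degrees\<close>

lemma exp_deg_add: "exp_deg (\<alpha> + \<beta>) = exp_deg \<alpha> + exp_deg \<beta>"
  by (simp add: exp_deg_def sum.distrib)

lemma exp_deg_0 [simp]: "exp_deg 0 = 0"
  by (simp add: exp_deg_def)

lemma zero_in_exps_le [simp]: "0 \<in> exps_le k"
  by (simp add: exps_le_def)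

lemma exps_le_mono: "j \<le> k \<Longrightarrow> exps_le j \<subseteq> exps_le k"
  by (auto simp: exps_le_def)

lemma exps_le_add: "\<alpha> \<in> exps_le j \<Longrightarrow> \<beta> \<in> exps_le k \<Longrightarrow> \<alpha> + \<beta> \<in> exps_le (j + k)"
  by (simp add: exps_le_def exp_deg_add)

lemma finite_exps_le [simp]: "finite (exps_le k :: (nat ^ 'n::finite) set)"
proof -
  have "(exps_le k :: (nat ^ 'n) set) \<subseteq> vec_lambda ` (PiE UNIV (\<lambda>_. {..k}))"
  proof
    fix \<alpha> :: "nat ^ 'n" assume "\<alpha> \<in> exps_le k"
    then have "\<alpha> $ i \<le> k" for i
      using member_le_sum[of i UNIV "\<lambda>i. \<alpha> $ i"] by (simp add: exps_le_def exp_deg_def)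
    then have "vec_nth \<alpha> \<in> PiE UNIV (\<lambda>_. {..k})" by (auto simp: PiE_def)
    then show "\<alpha> \<in> vec_lambda ` (PiE UNIV (\<lambda>_. {..k}))"
      by (metis image_eqI vec_nth_inverse)
  qed
  then show ?thesis
    by (rule finite_subset) (intro finite_imageI finite_PiE, auto)
qed

lemma exists_exponent_below:
  assumes "t \<le> exp_deg (\<alpha> :: nat ^ 'n::finite)"
  shows "\<exists>\<beta> \<gamma>. \<alpha> = \<beta> + \<gamma> \<and> exp_deg \<beta> = t"
  using assms
proof (induction t)
  case 0
  show ?case by (rule exI[of _ 0]) simp
next
  case (Suc t)
  then obtain \<beta> \<gamma> where bg: "\<alpha> = \<beta> + \<gamma>" "exp_deg \<beta> = t" by auto
  have "exp_deg \<gamma> \<noteq> 0" using bg Suc.prems by (simp add: exp_deg_add)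
  then obtain i where i: "\<gamma> $ i \<noteq> 0" by (auto simp: exp_deg_def)
  have "exp_deg (axis i 1 :: nat ^ 'n) = 1"
    by (simp add: exp_deg_def axis_def)
  moreover have "\<gamma> = axis i 1 + (\<gamma> - axis i 1)"
    using i by (auto simp: vec_eq_iff axis_def)
  ultimately show ?case
    using bg by (intro exI[of _ "\<beta> + axis i 1"] exI[of _ "\<gamma> - axis i 1"])
      (simp add: exp_deg_add add.assoc)
qed

text \<open>Makes every moment of order up to \<open>2 * d\<close> an entry of the moment matrix of
  order \<open>d\<close>, so that bounds on the quadratic form bound all moments.\<close>

lemma exps_le_double:
  assumes "\<alpha> \<in> exps_le (2 * d)"
  obtains \<beta> \<gamma> where "\<alpha> = \<beta> + \<gamma>" "\<beta> \<in> exps_le d" "\<gamma> \<in> exps_le d"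
proof -
  \<comment> \<open>Taking as much degree as possible, up to \<open>d\<close>, leaves at most
    \<open>d\<close> for the rest.\<close>
  obtain \<beta> \<gamma> where *: "\<alpha> = \<beta> + \<gamma>" "exp_deg \<beta> = min d (exp_deg \<alpha>)"
    using exists_exponent_below[of "min d (exp_deg \<alpha>)" \<alpha>] by auto
  then have "exp_deg \<gamma> \<le> d"
    using assms by (auto simp: exps_le_def exp_deg_add min_def split: if_splits)
  then show thesis using * that[of \<beta> \<gamma>] by (simp add: exps_le_def)
qed

section \<open>Polynomials of bounded degree\<close>

lemma mpolys_le_iff: "p \<in> mpolys_le k \<longleftrightarrow> keys p \<subseteq> exps_le k"
  by (auto simp: mpolys_le_def mdegree_def exps_le_def)

lemma mpolys_le_lookup: "p \<in> mpolys_le k \<Longrightarrow> \<alpha> \<notin> exps_le k \<Longrightarrow> lookup p \<alpha> = 0"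
  using in_keys_iff[of \<alpha> p] by (auto simp: mpolys_le_iff)

lemma mpolys_leI: "(\<And>\<alpha>. \<alpha> \<notin> exps_le k \<Longrightarrow> lookup p \<alpha> = 0) \<Longrightarrow> p \<in> mpolys_le k"
  unfolding mpolys_le_iff using in_keys_iff[of _ p] by blast

lemma mpolys_le_mono: "p \<in> mpolys_le j \<Longrightarrow> j \<le> k \<Longrightarrow> p \<in> mpolys_le k"
  by (auto simp: mpolys_le_def)

lemma mpolys_le_0 [simp]: "0 \<in> mpolys_le k"
  by (simp add: mpolys_le_iff)

lemma mpolys_le_const [simp]: "const c \<in> mpolys_le k"
  by (auto simp: mpolys_le_iff)

lemma mpolys_le_1 [simp]: "1 \<in> mpolys_le k"
  by (auto simp: mpolys_le_iff)

lemma mpolys_le_single: "\<alpha> \<in> exps_le k \<Longrightarrow> Poly_Mapping.single \<alpha> c \<in> mpolys_le k"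
  by (auto simp: mpolys_le_iff)

lemma mpolys_le_add: "p \<in> mpolys_le k \<Longrightarrow> q \<in> mpolys_le k \<Longrightarrow> p + q \<in> mpolys_le k"
  by (rule mpolys_leI) (simp add: lookup_add mpolys_le_lookup)

lemma mpolys_le_diff: "p \<in> mpolys_le k \<Longrightarrow> q \<in> mpolys_le k \<Longrightarrow> p - q \<in> mpolys_le k"
  by (rule mpolys_leI) (simp add: lookup_minus mpolys_le_lookup)

lemma mpolys_le_sum: "(\<And>i. i \<in> I \<Longrightarrow> p i \<in> mpolys_le k) \<Longrightarrow> sum p I \<in> mpolys_le k"
  by (rule mpolys_leI) (auto simp: lookup_sum intro!: sum.neutral mpolys_le_lookup)

lemma mpolys_le_mult:
  assumes "p \<in> mpolys_le j" "q \<in> mpolys_le k"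
  shows "p * q \<in> mpolys_le (j + k)"
  using keys_mult[of p q] assms exps_le_add unfolding mpolys_le_iff by blast

lemma mpolys_le_const_mult: "p \<in> mpolys_le k \<Longrightarrow> const c * p \<in> mpolys_le k"
  using mpolys_le_mult[of "const c" 0 p k] by simp

lemma sum_single_lookup:
  assumes "finite S" "keys p \<subseteq> S"
  shows "(\<Sum>\<alpha>\<in>S. Poly_Mapping.single \<alpha> (lookup p \<alpha>)) = p"
proof (rule poly_mapping_eqI)
  fix \<beta>
  have "lookup (\<Sum>\<alpha>\<in>S. Poly_Mapping.single \<alpha> (lookup p \<alpha>)) \<beta>
      = (\<Sum>\<alpha>\<in>S. if \<alpha> = \<beta> then lookup p \<alpha> else 0)"
    unfolding lookup_sum by (intro sum.cong refl) (simp add: lookup_single when_def)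
  also have "\<dots> = lookup p \<beta>"
    using assms in_keys_iff[of \<beta> p] by (auto simp: sum.delta)
  finally show "lookup (\<Sum>\<alpha>\<in>S. Poly_Mapping.single \<alpha> (lookup p \<alpha>)) \<beta> = lookup p \<beta>" .
qed

section \<open>The Riesz functional of a sequence\<close>

lemma riesz_superset:
  assumes "finite S" "keys p \<subseteq> S"
  shows "riesz z p = (\<Sum>\<alpha>\<in>S. lookup p \<alpha> * z \<alpha>)"
  unfolding riesz_def
  using assms by (intro sum.mono_neutral_left) (auto simp: in_keys_iff)

lemma riesz_mpolys_le:
  "p \<in> mpolys_le k \<Longrightarrow> riesz z p = (\<Sum>\<alpha>\<in>exps_le k. lookup p \<alpha> * z \<alpha>)"
  by (intro riesz_superset) (simp_all add: mpolys_le_iff)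

lemma riesz_0 [simp]: "riesz z 0 = 0"
  by (simp add: riesz_def)

lemma riesz_single [simp]: "riesz z (Poly_Mapping.single \<alpha> c) = c * z \<alpha>"
  by (simp add: riesz_superset[of "{\<alpha>}"])

lemma riesz_add: "riesz z (p + q) = riesz z p + riesz z q"
proof -
  have "keys (p + q) \<subseteq> keys p \<union> keys q" by (rule keys_add)
  then show ?thesis
    by (simp add: riesz_superset[of "keys p \<union> keys q"] lookup_add algebra_simps sum.distrib)
qed

lemma riesz_diff: "riesz z (p - q) = riesz z p - riesz z q"
  using riesz_add[of z "p - q" q] by simp

lemma riesz_sum: "riesz z (sum p I) = (\<Sum>i\<in>I. riesz z (p i))"
  by (induction I rule: infinite_finite_induct) (auto simp: riesz_add)

lemma riesz_mult:
  assumes "finite S" "keys p \<subseteq> S" "finite T" "keys q \<subseteq> T"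
  shows "riesz z (p * q) = (\<Sum>\<alpha>\<in>S. \<Sum>\<beta>\<in>T. lookup p \<alpha> * lookup q \<beta> * z (\<alpha> + \<beta>))"
proof -
  have "p * q = (\<Sum>\<alpha>\<in>S. Poly_Mapping.single \<alpha> (lookup p \<alpha>)) * (\<Sum>\<beta>\<in>T. Poly_Mapping.single \<beta> (lookup q \<beta>))"
    using assms by (simp add: sum_single_lookup)
  also have "\<dots> = (\<Sum>\<alpha>\<in>S. \<Sum>\<beta>\<in>T. Poly_Mapping.single (\<alpha> + \<beta>) (lookup p \<alpha> * lookup q \<beta>))"
    by (simp add: sum_product mult_single)
  finally show ?thesis by (simp add: riesz_sum)
qed

lemma riesz_const_mult: "riesz z (const c * p) = c * riesz z p"
  by (subst riesz_mult[of "{0}" _ "keys p"]) (auto simp: riesz_def sum_distrib_left mult.assoc)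

text \<open>A coefficient is itself a Riesz functional, so the product and scaling rules for
  \<open>riesz\<close> carry over to \<open>lookup\<close>.\<close>

lemma riesz_delta: "riesz (\<lambda>\<beta>. if \<beta> = \<alpha> then 1 else 0) p = lookup p \<alpha>"
proof -
  have "riesz (\<lambda>\<beta>. if \<beta> = \<alpha> then 1 else 0) p = (\<Sum>\<beta>\<in>insert \<alpha> (keys p). if \<beta> = \<alpha> then lookup p \<beta> else 0)"
    unfolding riesz_superset[of "insert \<alpha> (keys p)" p, OF _ subset_insertI, simplified]
    by (intro sum.cong) auto
  then show ?thesis by (simp add: sum.delta)
qed

lemma lookup_const_mult: "lookup (const c * p) \<alpha> = c * lookup p \<alpha>"
  by (simp flip: riesz_delta add: riesz_const_mult)

lemma lookup_mult_expand:
  assumes "p \<in> mpolys_le j" "q \<in> mpolys_le k"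
  shows "lookup (p * q) \<alpha> = (\<Sum>\<beta>\<in>exps_le j. \<Sum>\<gamma>\<in>exps_le k.
    lookup p \<beta> * lookup q \<gamma> * (if \<beta> + \<gamma> = \<alpha> then 1 else 0))"
  using assms unfolding riesz_delta[of \<alpha> "p * q", symmetric]
  by (intro riesz_mult) (simp_all add: mpolys_le_iff)

lemma riesz_diff_fun: "riesz (\<lambda>\<alpha>. y \<alpha> - z \<alpha>) p = riesz y p - riesz z p"
  by (simp add: riesz_def algebra_simps sum_subtractf)

lemma riesz_scale_fun: "riesz (\<lambda>\<alpha>. c * z \<alpha>) p = c * riesz z p"
  by (simp add: riesz_def algebra_simps sum_distrib_left)

section \<open>Evaluation of polynomials\<close>

lemma monom_eval_add: "monom_eval (\<alpha> + \<beta>) x = monom_eval \<alpha> x * monom_eval \<beta> x"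
  by (simp add: monom_eval_def power_add prod.distrib)

text \<open>Evaluation is the Riesz functional of the moment sequence of a point mass, so it
  inherits linearity and the product expansion.\<close>

lemma mpoly_eval_riesz: "mpoly_eval p x = riesz (\<lambda>\<alpha>. monom_eval \<alpha> x) p"
  by (simp add: mpoly_eval_def riesz_def)

lemma mpoly_eval_add: "mpoly_eval (p + q) x = mpoly_eval p x + mpoly_eval q x"
  by (simp add: mpoly_eval_riesz riesz_add)

lemma mpoly_eval_diff: "mpoly_eval (p - q) x = mpoly_eval p x - mpoly_eval q x"
  by (simp add: mpoly_eval_riesz riesz_diff)

lemma mpoly_eval_sum: "mpoly_eval (sum p I) x = (\<Sum>i\<in>I. mpoly_eval (p i) x)"
  by (simp add: mpoly_eval_riesz riesz_sum)

lemma mpoly_eval_0 [simp]: "mpoly_eval 0 x = 0"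
  by (simp add: mpoly_eval_riesz)

lemma mpoly_eval_const [simp]: "mpoly_eval (const c) x = c"
  by (simp add: mpoly_eval_riesz monom_eval_def)

lemma mpoly_eval_1 [simp]: "mpoly_eval 1 x = 1"
  using mpoly_eval_const[of 1 x] by simp

lemma mpoly_eval_mult: "mpoly_eval (p * q) x = mpoly_eval p x * mpoly_eval q x"
proof -
  have "mpoly_eval (p * q) x = (\<Sum>\<alpha>\<in>keys p. \<Sum>\<beta>\<in>keys q. lookup p \<alpha> * lookup q \<beta> * monom_eval (\<alpha> + \<beta>) x)"
    unfolding mpoly_eval_riesz by (rule riesz_mult) auto
  also have "\<dots> = mpoly_eval p x * mpoly_eval q x"
    by (simp add: mpoly_eval_def sum_product monom_eval_add mult_ac)
  finally show ?thesis .
qed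

lemma mpoly_eval_var [simp]: "mpoly_eval (var i) x = x $ i"
proof -
  have "(\<Prod>j\<in>UNIV. (x $ j) ^ (axis i (1::nat) $ j)) = (\<Prod>j\<in>UNIV. if j = i then x $ j else 1)"
    by (intro prod.cong) (auto simp: axis_def)
  then show ?thesis
    by (simp add: var_def mpoly_eval_riesz monom_eval_def prod.delta)
qed

lemma continuous_on_monom_eval [continuous_intros]: "continuous_on S (monom_eval \<alpha>)"
  unfolding monom_eval_def by (intro continuous_intros)

lemma continuous_on_mpoly_eval [continuous_intros]: "continuous_on S (mpoly_eval p)"
  unfolding mpoly_eval_def by (intro continuous_intros)

lemma borel_measurable_mpoly_eval [measurable]: "mpoly_eval p \<in> borel_measurable borel"
  by (intro borel_measurable_continuous_onI continuous_intros)

lemma borel_measurable_monom_eval [measurable]: "monom_eval \<alpha> \<in> borel_measurable borel"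
  by (intro borel_measurable_continuous_onI continuous_intros)

section \<open>Moment and localizing matrices as quadratic forms\<close>

lemma mult_expand:
  assumes "h \<in> mpolys_le k"
  shows "h * q = (\<Sum>\<alpha>\<in>exps_le k. const (lookup h \<alpha>) * (Poly_Mapping.single \<alpha> 1 * q))"
proof -
  have "h * q = (\<Sum>\<alpha>\<in>exps_le k. Poly_Mapping.single \<alpha> (lookup h \<alpha>)) * q"
    using assms by (simp add: sum_single_lookup mpolys_le_iff)
  also have "\<dots> = (\<Sum>\<alpha>\<in>exps_le k. const (lookup h \<alpha>) * (Poly_Mapping.single \<alpha> 1 * q))"
    by (simp add: sum_distrib_right mult.assoc[symmetric] mult_single)
  finally show ?thesis .
qed

lemma riesz_square_localizing:
  assumes "h \<in> mpolys_le k"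
  shows "riesz z (h * h * g)
    = (\<Sum>\<alpha>\<in>exps_le k. \<Sum>\<beta>\<in>exps_le k. lookup h \<alpha> * localizing_matrix g z \<alpha> \<beta> * lookup h \<beta>)"
proof -
  have "riesz z (h * h * g) = riesz z (h * (h * g))" by (simp add: mult.assoc)
  also have "\<dots> = (\<Sum>\<alpha>\<in>exps_le k. lookup h \<alpha> * riesz z (Poly_Mapping.single \<alpha> 1 * (h * g)))"
    by (subst mult_expand[OF assms]) (simp add: riesz_sum riesz_const_mult)
  also have "\<dots> = (\<Sum>\<alpha>\<in>exps_le k. \<Sum>\<beta>\<in>exps_le k. lookup h \<alpha> * localizing_matrix g z \<alpha> \<beta> * lookup h \<beta>)"
  proof (intro sum.cong refl)
    fix \<alpha> :: "nat ^ 'a"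
    have "Poly_Mapping.single \<alpha> 1 * (h * g)
        = (\<Sum>\<beta>\<in>exps_le k. const (lookup h \<beta>) * (Poly_Mapping.single (\<alpha> + \<beta>) 1 * g))"
      by (subst mult_expand[OF assms])
        (simp add: sum_distrib_left mult.left_commute mult.assoc[symmetric] mult_single)
    moreover have "riesz z (Poly_Mapping.single (\<alpha> + \<beta>) 1 * g) = localizing_matrix g z \<alpha> \<beta>" for \<beta>
      by (subst riesz_mult[of "{\<alpha> + \<beta>}" _ "keys g"]) (auto simp: localizing_matrix_def)
    ultimately show "lookup h \<alpha> * riesz z (Poly_Mapping.single \<alpha> 1 * (h * g))
        = (\<Sum>\<beta>\<in>exps_le k. lookup h \<alpha> * localizing_matrix g z \<alpha> \<beta> * lookup h \<beta>)"
      by (simp add: riesz_sum riesz_const_mult sum_distrib_left) (simp add: mult_ac)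
  qed
  finally show ?thesis .
qed

text \<open>The localizing matrix is the matrix of \<open>h \<mapsto> riesz z (h * h * g)\<close> in
  the monomial basis. From here on, semidefinite constraints are handled as positivity on
  squares.\<close>

lemma psd_localizing_iff:
  "psd_on (exps_le k) (localizing_matrix g z) \<longleftrightarrow> (\<forall>h\<in>mpolys_le k. 0 \<le> riesz z (h * h * g))"
proof -
  have "\<forall>h\<in>mpolys_le k. 0 \<le> riesz z (h * h * g) \<Longrightarrow>
    0 \<le> (\<Sum>\<alpha>\<in>exps_le k. \<Sum>\<beta>\<in>exps_le k. c \<alpha> * localizing_matrix g z \<alpha> \<beta> * c \<beta>)" for c
  proof -
    assume *: "\<forall>h\<in>mpolys_le k. 0 \<le> riesz z (h * h * g)"
    define h where "h = (\<Sum>\<alpha>\<in>exps_le k. Poly_Mapping.single \<alpha> (c \<alpha>))"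
    have h: "h \<in> mpolys_le k" unfolding h_def by (intro mpolys_le_sum mpolys_le_single)
    have "lookup h \<alpha> = c \<alpha>" if "\<alpha> \<in> exps_le k" for \<alpha>
    proof -
      have "lookup h \<alpha> = (\<Sum>\<beta>\<in>exps_le k. if \<beta> = \<alpha> then c \<beta> else 0)"
        unfolding h_def lookup_sum by (intro sum.cong refl) (simp add: lookup_single when_def)
      then show ?thesis using that by (simp add: sum.delta)
    qed
    then have "(\<Sum>\<alpha>\<in>exps_le k. \<Sum>\<beta>\<in>exps_le k. c \<alpha> * localizing_matrix g z \<alpha> \<beta> * c \<beta>) = riesz z (h * h * g)"
      unfolding riesz_square_localizing[OF h] by (intro sum.cong refl) simp
    then show ?thesis using * h by simp
  qed
  moreover have "localizing_matrix g z a b = localizing_matrix g z b a" for a b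
    by (simp add: localizing_matrix_def add.commute)
  ultimately show ?thesis
    unfolding psd_on_def by (auto simp: riesz_square_localizing)
qed

lemma localizing_matrix_1: "localizing_matrix 1 z = moment_matrix z"
  by (simp add: fun_eq_iff localizing_matrix_def moment_matrix_def)

lemma psd_moment_iff:
  "psd_on (exps_le k) (moment_matrix z) \<longleftrightarrow> (\<forall>h\<in>mpolys_le k. 0 \<le> riesz z (h * h))"
  using psd_localizing_iff[of k 1 z] by (simp add: localizing_matrix_1)


section \<open>Sums of squares\<close>

lemma pointwise_convergent_subsequence:
  fixes f :: "nat \<Rightarrow> 'a::countable \<Rightarrow> real"
  assumes "\<And>x. Bseq (\<lambda>n. f n x)"
  obtains r l where "strict_mono (r :: nat \<Rightarrow> nat)" "\<And>x. (\<lambda>n. f (r n) x) \<longlonglongrightarrow> l x"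
proof -
  have "\<exists>M>0. \<forall>n. norm (f n x) \<le> M" for x
    using assms[of x] by (auto simp: Bseq_def)
  then obtain M where M: "\<And>x. M x > 0" "\<And>x n. norm (f n x) \<le> M x" by metis
  \<comment> \<open>Rescaling by \<open>M x\<close> gives all coordinates the common bound 1, as the
    diagonal argument requires.\<close>
  have "norm (f n x / M x) \<le> 1" for n x
    using M(1)[of x] M(2)[of n x] by simp
  then obtain r where r: "strict_mono (r :: nat \<Rightarrow> nat)"
    "\<And>x. \<exists>l. (\<lambda>n. f (r n) x / M x) \<longlonglongrightarrow> l"
    using function_convergent_subsequence[of "UNIV :: 'a set" "\<lambda>n x. f n x / M x" 1] by (metis UNIV_I countableI_type)
  have "\<exists>l. (\<lambda>n. f (r n) x) \<longlonglongrightarrow> l" for x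
  proof -
    obtain l where "(\<lambda>n. f (r n) x / M x) \<longlonglongrightarrow> l" using r(2) by blast
    then have "(\<lambda>n. M x * (f (r n) x / M x)) \<longlonglongrightarrow> M x * l" by (intro tendsto_intros)
    then show ?thesis using M(1)[of x] by auto
  qed
  then show thesis using that r(1) by metis
qed

text \<open>One variable is removed at a time: for fixed values of the others the sum is a
  univariate polynomial with infinitely many roots, so each of its coefficients vanishes. The
  conclusion filters \<open>F\<close> by agreement with \<open>\<beta>\<close> on \<open>J\<close>,
  so that only \<open>\<beta>\<close> itself can survive once \<open>J\<close> is
  everything.\<close>

lemma sum_monomials_zero_imp:
  fixes c :: "nat ^ 'n::finite \<Rightarrow> real" and S :: "'n \<Rightarrow> real set"
  assumes "finite J" "\<And>i. infinite (S i)" "finite F"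
    and "\<And>x. (\<And>i. i \<in> J \<Longrightarrow> x i \<in> S i) \<Longrightarrow> (\<Sum>\<alpha>\<in>F. c \<alpha> * (\<Prod>i\<in>J. x i ^ (\<alpha> $ i))) = 0"
  shows "(\<Sum>\<alpha>\<in>{\<alpha>\<in>F. \<forall>i\<in>J. \<alpha> $ i = \<beta> $ i}. c \<alpha>) = 0"
  using assms(1,3,4)
proof (induction J arbitrary: F rule: finite_induct)
  case empty
  then show ?case by simp
next
  case (insert k J)
  have "(\<Sum>\<alpha>\<in>{\<alpha>\<in>F. \<alpha> $ k = \<beta> $ k}. c \<alpha> * (\<Prod>i\<in>J. x i ^ (\<alpha> $ i))) = 0"
    if x: "\<And>i. i \<in> J \<Longrightarrow> x i \<in> S i" for x
  proof -
    define P where "P = (\<Sum>\<alpha>\<in>F. Polynomial.monom (c \<alpha> * (\<Prod>i\<in>J. x i ^ (\<alpha> $ i))) (\<alpha> $ k))"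
    have "poly P t = 0" if "t \<in> S k" for t
    proof -
      have "poly P t = (\<Sum>\<alpha>\<in>F. c \<alpha> * (\<Prod>i\<in>insert k J. (x(k := t)) i ^ (\<alpha> $ i)))"
        unfolding P_def poly_sum
      proof (intro sum.cong refl)
        fix \<alpha>
        have "(\<Prod>i\<in>J. (x(k := t)) i ^ (\<alpha> $ i)) = (\<Prod>i\<in>J. x i ^ (\<alpha> $ i))"
          using insert.hyps by (intro prod.cong) auto
        then show "poly (Polynomial.monom (c \<alpha> * (\<Prod>i\<in>J. x i ^ (\<alpha> $ i))) (\<alpha> $ k)) t
            = c \<alpha> * (\<Prod>i\<in>insert k J. (x(k := t)) i ^ (\<alpha> $ i))"
          using insert.hyps by (simp add: poly_monom mult_ac)
      qed
      also have "\<dots> = 0" using x that by (intro insert.prems) auto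
      finally show ?thesis .
    qed
    then have "S k \<subseteq> {t. poly P t = 0}" by auto
    then have "P = 0" using poly_roots_finite assms(2) finite_subset by metis
    then have "0 = Polynomial.coeff P (\<beta> $ k)" by simp
    also have "\<dots> = (\<Sum>\<alpha>\<in>F. if \<alpha> $ k = \<beta> $ k then c \<alpha> * (\<Prod>i\<in>J. x i ^ (\<alpha> $ i)) else 0)"
      unfolding P_def coeff_sum by (intro sum.cong) auto
    also have "\<dots> = (\<Sum>\<alpha>\<in>{\<alpha>\<in>F. \<alpha> $ k = \<beta> $ k}. c \<alpha> * (\<Prod>i\<in>J. x i ^ (\<alpha> $ i)))"
      using insert.prems by (simp add: sum.inter_filter)
    finally show ?thesis by simp
  qed
  then have "(\<Sum>\<alpha>\<in>{\<alpha>\<in>{\<alpha>\<in>F. \<alpha> $ k = \<beta> $ k}. \<forall>i\<in>J. \<alpha> $ i = \<beta> $ i}. c \<alpha>) = 0"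
    using insert.prems by (intro insert.IH) auto
  moreover have "{\<alpha>\<in>{\<alpha>\<in>F. \<alpha> $ k = \<beta> $ k}. \<forall>i\<in>J. \<alpha> $ i = \<beta> $ i} = {\<alpha>\<in>F. \<forall>i\<in>insert k J. \<alpha> $ i = \<beta> $ i}"
    by auto
  ultimately show ?case by simp
qed

lemma mpoly_zero_on_open_imp_zero:
  fixes p :: "'n::finite mpoly"
  assumes "open U" "U \<noteq> {}" "\<And>x. x \<in> U \<Longrightarrow> mpoly_eval p x = 0"
  shows "p = 0"
proof (rule poly_mapping_eqI)
  fix \<beta>
  obtain a where "a \<in> U" using assms(2) by blast
  \<comment> \<open>An open set contains a box with open, hence infinite, sides.\<close>
  then obtain A where A: "\<And>i. open (A i) \<and> a $ i \<in> A i" "\<And>y. (\<forall>i. y $ i \<in> A i) \<Longrightarrow> y \<in> U"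
    using assms(1) unfolding open_vec_def by metis
  have inf: "infinite (A i)" for i
    using A(1)[of i] finite_imp_not_open[of "A i"] by auto
  have "(\<Sum>\<alpha>\<in>keys p. lookup p \<alpha> * (\<Prod>i\<in>UNIV. x i ^ (\<alpha> $ i))) = 0"
    if "\<And>i. i \<in> UNIV \<Longrightarrow> x i \<in> A i" for x
    using assms(3)[of "vec_lambda x"] A(2)[of "vec_lambda x"] that
    by (simp add: mpoly_eval_def monom_eval_def)
  then have "(\<Sum>\<alpha>\<in>{\<alpha> \<in> keys p. \<forall>i\<in>UNIV. \<alpha> $ i = \<beta> $ i}. lookup p \<alpha>) = 0"
    using inf by (intro sum_monomials_zero_imp[where S = A]) auto
  moreover have "{\<alpha> \<in> keys p. \<forall>i\<in>UNIV. \<alpha> $ i = \<beta> $ i} = (if \<beta> \<in> keys p then {\<beta>} else {})"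
    by (auto simp: vec_eq_iff[symmetric])
  ultimately show "lookup p \<beta> = lookup 0 \<beta>"
    by (auto split: if_splits simp: in_keys_iff)
qed

text \<open>Over the reals the squares of the parts of degree D + 1 cannot cancel: if the sum has
  degree below 2 D + 2, the sum of these squares is the zero polynomial, so each such part
  vanishes.\<close>

lemma sum_squares_degree_step:
  fixes q :: "'i \<Rightarrow> 'n::finite mpoly"
  assumes "finite I" and q: "\<And>i. i \<in> I \<Longrightarrow> q i \<in> mpolys_le (Suc D)"
    and s: "(\<Sum>i\<in>I. q i * q i) \<in> mpolys_le (2 * D + 1)" and "i \<in> I"
  shows "q i \<in> mpolys_le D"
proof -
  define top where "top p = (\<Sum>\<alpha>\<in>exps_le (Suc D) - exps_le D. Poly_Mapping.single \<alpha> (lookup p \<alpha>))"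
    for p :: "'n mpoly"
  have lookup_top: "lookup (top p) \<alpha> = (if \<alpha> \<in> exps_le (Suc D) - exps_le D then lookup p \<alpha> else 0)"
    for p :: "'n mpoly" and \<alpha>
  proof -
    have "lookup (top p) \<alpha> = (\<Sum>\<beta>\<in>exps_le (Suc D) - exps_le D. if \<beta> = \<alpha> then lookup p \<beta> else 0)"
      unfolding top_def lookup_sum by (intro sum.cong refl) (simp add: lookup_single when_def)
    then show ?thesis by (simp add: sum.delta)
  qed
  have top_le: "top p \<in> mpolys_le (Suc D)" for p :: "'n mpoly"
    by (rule mpolys_leI) (simp add: lookup_top)
  have low: "q j - top (q j) \<in> mpolys_le D" if "j \<in> I" for j
    using q[OF that] by (intro mpolys_leI) (auto simp: lookup_minus lookup_top mpolys_le_lookup)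
  \<comment> \<open>The difference of squares factors, with one factor of degree at most D and the
    other of degree at most D + 1.\<close>
  have "q j * q j - top (q j) * top (q j) \<in> mpolys_le (2 * D + 1)" if "j \<in> I" for j
  proof -
    have "q j * q j - top (q j) * top (q j) = (q j - top (q j)) * (q j + top (q j))"
      by (simp add: algebra_simps)
    also have "\<dots> \<in> mpolys_le (D + Suc D)"
      using q[OF that] by (intro mpolys_le_mult mpolys_le_add low that top_le)
    finally show ?thesis by (simp add: mult_2)
  qed
  then have "(\<Sum>j\<in>I. q j * q j) - (\<Sum>j\<in>I. q j * q j - top (q j) * top (q j)) \<in> mpolys_le (2 * D + 1)"
    by (intro mpolys_le_diff[OF s] mpolys_le_sum)
  then have t: "(\<Sum>j\<in>I. top (q j) * top (q j)) \<in> mpolys_le (2 * D + 1)"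
    by (simp add: sum_subtractf)
  have "(\<Sum>j\<in>I. top (q j) * top (q j)) = 0"
  proof (rule poly_mapping_eqI)
    fix \<alpha>
    show "lookup (\<Sum>j\<in>I. top (q j) * top (q j)) \<alpha> = lookup 0 \<alpha>"
    proof (cases "\<alpha> \<in> exps_le (2 * D + 1)")
      case True
      have "lookup (top (q j) * top (q j)) \<alpha> = 0" for j
      proof (rule ccontr)
        assume "lookup (top (q j) * top (q j)) \<alpha> \<noteq> 0"
        then obtain \<beta> \<gamma> where "\<beta> \<in> keys (top (q j))" "\<gamma> \<in> keys (top (q j))" "\<alpha> = \<beta> + \<gamma>"
          using keys_mult[of "top (q j)" "top (q j)"] by (auto simp: in_keys_iff)
        then have "exp_deg \<beta> = Suc D" "exp_deg \<gamma> = Suc D" "exp_deg \<alpha> = exp_deg \<beta> + exp_deg \<gamma>"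
          by (auto simp: in_keys_iff lookup_top exps_le_def exp_deg_add split: if_splits)
        then show False using True by (simp add: exps_le_def)
      qed
      then show ?thesis by (simp add: lookup_sum)
    next
      case False
      then show ?thesis using t by (simp add: mpolys_le_lookup)
    qed
  qed
  then have z: "(\<Sum>j\<in>I. mpoly_eval (top (q j)) x * mpoly_eval (top (q j)) x) = 0" for x
    by (simp flip: mpoly_eval_mult mpoly_eval_sum)
  have "mpoly_eval (top (q i)) x = 0" for x
    using z[of x] assms(1,4) by (subst (asm) sum_nonneg_eq_0_iff) auto
  then have "top (q i) = 0"
    by (intro mpoly_zero_on_open_imp_zero[of UNIV]) auto
  then show ?thesis using low[OF assms(4)] by simp
qed

text \<open>\<open>SOS\<close> bounds the degree of the sum only; the degrees of the squared
  polynomials follow by descent from the crude common bound k + N.\<close>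

lemma sum_squares_degree:
  fixes q :: "'i \<Rightarrow> 'n::finite mpoly"
  assumes "finite I" "(\<Sum>i\<in>I. q i * q i) \<in> mpolys_le (2 * k)" "i \<in> I"
  shows "q i \<in> mpolys_le k"
proof -
  have descend: "\<forall>i\<in>I. q i \<in> mpolys_le k" if "\<forall>i\<in>I. q i \<in> mpolys_le (k + e)" for e
    using that
  proof (induction e)
    case 0
    then show ?case by simp
  next
    case (Suc e)
    have "(\<Sum>i\<in>I. q i * q i) \<in> mpolys_le (2 * (k + e) + 1)"
      using assms(2) by (rule mpolys_le_mono) simp
    then have "\<forall>i\<in>I. q i \<in> mpolys_le (k + e)"
      using Suc.prems assms(1) by (auto intro: sum_squares_degree_step[of I q "k + e"])
    then show ?case by (rule Suc.IH)
  qed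
  define N where "N = (\<Sum>i\<in>I. mdegree (q i))"
  have "q i \<in> mpolys_le (k + N)" if "i \<in> I" for i
  proof -
    have "mdegree (q i) \<le> N"
      unfolding N_def using assms(1) that by (intro member_le_sum) auto
    then show ?thesis by (simp add: mpolys_le_def)
  qed
  then show ?thesis using descend assms(3) by blast
qed

text \<open>An arbitrary set of allowed exponents, rather than a degree bound, lets the normal form
  below remove single exponents.\<close>

definition sos_over :: "(nat ^ 'n::finite) set \<Rightarrow> 'n mpoly \<Rightarrow> bool" where
  "sos_over J s \<longleftrightarrow> (\<exists>qs. (\<forall>q\<in>set qs. keys q \<subseteq> J) \<and> s = (\<Sum>q\<leftarrow>qs. q * q))"

lemma sos_over_square: "keys q \<subseteq> J \<Longrightarrow> sos_over J (q * q)"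
  unfolding sos_over_def by (rule exI[of _ "[q]"]) simp

lemma sos_over_0: "sos_over J 0"
  unfolding sos_over_def by (rule exI[of _ "[]"]) simp

lemma sos_over_add: "sos_over J s \<Longrightarrow> sos_over J t \<Longrightarrow> sos_over J (s + t)"
  unfolding sos_over_def
  by (elim exE, rule_tac x="qs @ qsa" in exI) auto

lemma sos_over_sum: "(\<And>i. i \<in> I \<Longrightarrow> sos_over J (s i)) \<Longrightarrow> sos_over J (sum s I)"
  by (induction I rule: infinite_finite_induct) (auto intro: sos_over_0 sos_over_add)

lemma const_mult_const: "const a * const b = const (a * b)"
  by (simp add: mult_single)

lemma sum_const: "(\<Sum>i\<in>I. const (c i)) = const (\<Sum>i\<in>I. c i)"
  by (induction I rule: infinite_finite_induct) (auto simp: single_add)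

lemma lagrange_identity:
  fixes e q :: "'i \<Rightarrow> 'a::comm_ring_1"
  shows "(\<Sum>i\<in>I. \<Sum>j\<in>I. (e i * q j - e j * q i) * (e i * q j - e j * q i))
    = 2 * (\<Sum>i\<in>I. e i * e i) * (\<Sum>i\<in>I. q i * q i) - 2 * (\<Sum>i\<in>I. e i * q i) * (\<Sum>i\<in>I. e i * q i)"
proof -
  have "(\<Sum>i\<in>I. \<Sum>j\<in>I. (e i * q j - e j * q i) * (e i * q j - e j * q i))
      = (\<Sum>i\<in>I. \<Sum>j\<in>I. (e i * e i) * (q j * q j)) + (\<Sum>i\<in>I. \<Sum>j\<in>I. (q i * q i) * (e j * e j))
        - 2 * (\<Sum>i\<in>I. \<Sum>j\<in>I. (e i * q i) * (e j * q j))"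
    by (simp add: sum_distrib_left flip: sum.distrib sum_subtractf) (simp add: algebra_simps)
  also have "\<dots> = (\<Sum>i\<in>I. e i * e i) * (\<Sum>i\<in>I. q i * q i) + (\<Sum>i\<in>I. q i * q i) * (\<Sum>i\<in>I. e i * e i)
      - 2 * ((\<Sum>i\<in>I. e i * q i) * (\<Sum>i\<in>I. e i * q i))"
    by (simp only: sum_product)
  also have "\<dots> = 2 * (\<Sum>i\<in>I. e i * e i) * (\<Sum>i\<in>I. q i * q i)
      - 2 * (\<Sum>i\<in>I. e i * q i) * (\<Sum>i\<in>I. e i * q i)"
    by (simp add: mult_ac)
  finally show ?thesis .
qed

text \<open>By Lagrange's identity, \<open>\<Sum> q\<^sub>i\<^sup>2 - (\<Sum> c\<^sub>i q\<^sub>i)\<^sup>2 / \<Sum> c\<^sub>i\<^sup>2\<close> is a sum of squares of the polynomials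
  \<open>c\<^sub>i q\<^sub>j - c\<^sub>j q\<^sub>i\<close>. With \<open>c\<^sub>i\<close> the coefficient of \<open>q\<^sub>i\<close> at an exponent \<open>a\<close>, these have no
  coefficient at \<open>a\<close>, so the exponents can be eliminated one at a time.\<close>

lemma sos_over_normal_form:
  assumes "finite J" "sos_over J s"
  shows "\<exists>r. (\<forall>a\<in>J. keys (r a) \<subseteq> J) \<and> s = (\<Sum>a\<in>J. r a * r a)"
  using assms
proof (induction J arbitrary: s rule: finite_induct)
  case empty
  then obtain qs where "\<forall>q\<in>set qs. q = 0" "s = (\<Sum>q\<leftarrow>qs. q * q)" by (auto simp: sos_over_def)
  then have "s = 0" by (induction qs arbitrary: s) auto
  then show ?case by simp
next
  case (insert a J)
  obtain qs where qs: "\<forall>q\<in>set qs. keys q \<subseteq> insert a J" "s = (\<Sum>q\<leftarrow>qs. q * q)"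
    using insert.prems by (auto simp: sos_over_def)
  define q where "q i = qs ! i" for i
  define I where "I = {..<length qs}"
  have s: "s = (\<Sum>i\<in>I. q i * q i)"
    by (simp add: qs(2) sum_list_sum_nth q_def I_def atLeast0LessThan)
  have kq: "keys (q i) \<subseteq> insert a J" if "i \<in> I" for i
    using qs(1) that by (auto simp: q_def I_def)
  define c where "c i = lookup (q i) a" for i
  define R where "R = (\<Sum>i\<in>I. c i * c i)"
  have "R \<ge> 0" unfolding R_def by (intro sum_nonneg) simp
  show ?case
  proof (cases "R = 0")
    case True
    have "c i = 0" if "i \<in> I" for i
      using True that unfolding R_def I_def by (subst (asm) sum_nonneg_eq_0_iff) auto
    then have "keys (q i) \<subseteq> J" if "i \<in> I" for i
      using kq[OF that] that by (auto simp: c_def in_keys_iff)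
    then have "sos_over J s"
      unfolding s by (intro sos_over_sum sos_over_square)
    then obtain r where r: "\<forall>a\<in>J. keys (r a) \<subseteq> J" "s = (\<Sum>a\<in>J. r a * r a)"
      using insert.IH by blast
    have "(\<Sum>b\<in>J. (r(a := 0)) b * (r(a := 0)) b) = s"
      unfolding r(2) using insert.hyps by (intro sum.cong) auto
    then show ?thesis
      using insert.hyps r(1) by (intro exI[of _ "r(a := 0)"]) auto
  next
    case False
    then have R: "R > 0" using \<open>R \<ge> 0\<close> by simp
    \<comment> \<open>The square of \<open>p\<close> is split off from \<open>s\<close>. The factor
      2 in \<open>t\<close> compensates for the double sum, in which each pair i, j occurs
      twice.\<close>
    define p where "p = const (1 / sqrt R) * (\<Sum>i\<in>I. const (c i) * q i)"
    define t where "t i j = const (1 / sqrt (2 * R)) * (const (c i) * q j - const (c j) * q i)" for i j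
    have kp: "keys p \<subseteq> insert a J"
    proof
      fix \<beta> assume "\<beta> \<in> keys p"
      then have "(\<Sum>i\<in>I. c i * lookup (q i) \<beta>) \<noteq> 0"
        by (auto simp: p_def in_keys_iff lookup_const_mult lookup_sum)
      then obtain i where "i \<in> I" "lookup (q i) \<beta> \<noteq> 0" by (auto elim!: sum.not_neutral_contains_not_neutral)
      then show "\<beta> \<in> insert a J" using kq[of i] by (auto simp: in_keys_iff)
    qed
    have kt: "keys (t i j) \<subseteq> J" if "i \<in> I" "j \<in> I" for i j
    proof
      fix \<beta> assume "\<beta> \<in> keys (t i j)"
      then have *: "c i * lookup (q j) \<beta> - c j * lookup (q i) \<beta> \<noteq> 0"
        by (auto simp: t_def in_keys_iff lookup_const_mult lookup_minus)
      then have "\<beta> \<noteq> a" by (auto simp: c_def)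
      moreover have "\<beta> \<in> keys (q i) \<union> keys (q j)" using * by (auto simp: in_keys_iff)
      ultimately show "\<beta> \<in> J" using kq that by blast
    qed
    have "(\<Sum>i\<in>I. \<Sum>j\<in>I. t i j * t i j) = const (1 / (2 * R)) * (\<Sum>i\<in>I. \<Sum>j\<in>I.
        (const (c i) * q j - const (c j) * q i) * (const (c i) * q j - const (c j) * q i))"
    proof -
      have "t i j * t i j = const (1 / sqrt (2 * R) * (1 / sqrt (2 * R)))
        * ((const (c i) * q j - const (c j) * q i) * (const (c i) * q j - const (c j) * q i))" for i j
        unfolding t_def by (subst const_mult_const[symmetric]) (simp only: mult_ac)
      moreover have "1 / sqrt (2 * R) * (1 / sqrt (2 * R)) = 1 / (2 * R)"
        using R by simp
      ultimately show ?thesis by (simp add: sum_distrib_left)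
    qed
    also have "\<dots> = const (1 / (2 * R)) * (2 * const R * s
        - 2 * (\<Sum>i\<in>I. const (c i) * q i) * (\<Sum>i\<in>I. const (c i) * q i))"
      unfolding lagrange_identity s by (simp add: const_mult_const sum_const R_def)
    also have "\<dots> = s - p * p"
    proof -
      have two: "(2 :: 'a mpoly) = const 2" by simp
      have "const (1 / (2 * R)) * (2 * const R * s) = s"
        unfolding two const_mult_const mult.assoc[symmetric] using R by simp
      moreover have "const (1 / (2 * R)) * (2 * P * P) = (const (1 / sqrt R) * P) * (const (1 / sqrt R) * P)"
        for P :: "'a mpoly"
      proof -
        have "(const (1 / sqrt R) * P) * (const (1 / sqrt R) * P) = const (1 / sqrt R) * const (1 / sqrt R) * (P * P)"
          by (simp only: mult_ac)
        also have "\<dots> = const (1 / (2 * R)) * const 2 * (P * P)"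
          unfolding const_mult_const using R by simp
        finally show ?thesis unfolding two by (simp only: mult_ac)
      qed
      ultimately show ?thesis by (simp add: p_def right_diff_distrib)
    qed
    finally have "s - p * p = (\<Sum>i\<in>I. \<Sum>j\<in>I. t i j * t i j)" by simp
    then have "sos_over J (s - p * p)"
      using kt by (auto intro!: sos_over_sum sos_over_square)
    then obtain r where r: "\<forall>a\<in>J. keys (r a) \<subseteq> J" "s - p * p = (\<Sum>a\<in>J. r a * r a)"
      using insert.IH by blast
    have "(\<Sum>b\<in>J. (r(a := p)) b * (r(a := p)) b) = s - p * p"
      unfolding r(2) using insert.hyps by (intro sum.cong) auto
    then show ?thesis
      using insert.hyps r(1) kp by (intro exI[of _ "r(a := p)"]) auto
  qed
qed

text \<open>One square per exponent of degree at most k: sequences of sums of squares become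
  sequences of tuples of fixed length in a finite-dimensional space.\<close>

lemma SOS_normal_form:
  fixes s :: "'n::finite mpoly"
  assumes "s \<in> SOS k"
  obtains r :: "nat ^ 'n \<Rightarrow> 'n mpoly" where "\<And>a. a \<in> exps_le k \<Longrightarrow> r a \<in> mpolys_le k" "s = (\<Sum>a\<in>exps_le k. r a * r a)"
proof -
  obtain qs where qs: "s = (\<Sum>q\<leftarrow>qs. q ^ 2)" "s \<in> mpolys_le (2 * k)"
    using assms by (auto simp: SOS_def)
  have s: "s = (\<Sum>i\<in>{..<length qs}. qs ! i * qs ! i)"
    by (simp add: qs(1) sum_list_sum_nth atLeast0LessThan power2_eq_square)
  have "qs ! i \<in> mpolys_le k" if "i \<in> {..<length qs}" for i
    by (rule sum_squares_degree[OF _ _ that]) (use qs(2) s in auto)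
  then have "sos_over (exps_le k) s"
    unfolding s by (intro sos_over_sum sos_over_square) (auto simp: mpolys_le_iff)
  from sos_over_normal_form[OF finite_exps_le this]
  obtain r :: "nat ^ 'n \<Rightarrow> 'n mpoly" where r: "(\<forall>a\<in>exps_le k. keys (r a) \<subseteq> exps_le k) \<and> s = (\<Sum>a\<in>exps_le k. r a * r a)"
    by (rule exE) (rule that)
  show thesis
  proof (rule that[of r])
    show "r a \<in> mpolys_le k" if "a \<in> exps_le k" for a
      using conjunct1[OF r] that by (simp add: mpolys_le_iff)
    show "s = (\<Sum>a\<in>exps_le k. r a * r a)" using r by (rule conjunct2)
  qed
qed

lemma sum_squares_in_SOS:
  assumes "finite I" "\<And>i. i \<in> I \<Longrightarrow> r i \<in> mpolys_le k"
  shows "(\<Sum>i\<in>I. r i * r i) \<in> SOS k"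
proof -
  obtain xs where "set xs = I" "distinct xs" using assms(1) finite_distinct_list by blast
  then have "(\<Sum>i\<in>I. r i * r i) = (\<Sum>q\<leftarrow>map r xs. q ^ 2)"
    by (simp add: sum_list_distinct_conv_sum_set power2_eq_square o_def)
  moreover have "(\<Sum>i\<in>I. r i * r i) \<in> mpolys_le (2 * k)"
    using assms(2) by (intro mpolys_le_sum) (simp add: mult_2 mpolys_le_mult)
  ultimately show ?thesis unfolding SOS_def by blast
qed


section \<open>Coefficientwise limits and coercive quadratic forms\<close>

lemma mpolys_le_limit:
  assumes "\<And>n. P n \<in> mpolys_le k" "\<And>\<alpha>. (\<lambda>n. lookup (P n) \<alpha>) \<longlonglongrightarrow> l \<alpha>"
  obtains p where "p \<in> mpolys_le k" "\<And>\<alpha>. (\<lambda>n. lookup (P n) \<alpha>) \<longlonglongrightarrow> lookup p \<alpha>"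
proof -
  have "l \<alpha> = 0" if "\<alpha> \<notin> exps_le k" for \<alpha>
    using assms(2)[of \<alpha>] mpolys_le_lookup[OF assms(1) that] by (simp add: LIMSEQ_const_iff)
  then have "{\<alpha>. l \<alpha> \<noteq> 0} \<subseteq> exps_le k" by auto
  then have "finite {\<alpha>. l \<alpha> \<noteq> 0}" by (rule finite_subset) simp
  then have l: "lookup (Abs_poly_mapping l) = l" by simp
  show thesis
  proof (rule that[of "Abs_poly_mapping l"])
    show "Abs_poly_mapping l \<in> mpolys_le k"
      using \<open>\<And>\<alpha>. \<alpha> \<notin> exps_le k \<Longrightarrow> l \<alpha> = 0\<close> by (intro mpolys_leI) (simp add: l)
  qed (simp add: l assms(2))
qed

lemma tendsto_riesz:
  assumes "\<And>n. P n \<in> mpolys_le k" "p \<in> mpolys_le k" "\<And>\<alpha>. (\<lambda>n. lookup (P n) \<alpha>) \<longlonglongrightarrow> lookup p \<alpha>"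
  shows "(\<lambda>n. riesz z (P n)) \<longlonglongrightarrow> riesz z p"
  unfolding riesz_mpolys_le[OF assms(1)] riesz_mpolys_le[OF assms(2)]
  by (intro tendsto_intros assms(3))

lemma tendsto_lookup_mult:
  assumes "\<And>n. P n \<in> mpolys_le j" "p \<in> mpolys_le j" "\<And>\<alpha>. (\<lambda>n. lookup (P n) \<alpha>) \<longlonglongrightarrow> lookup p \<alpha>"
    and "\<And>n. Q n \<in> mpolys_le k" "q \<in> mpolys_le k" "\<And>\<alpha>. (\<lambda>n. lookup (Q n) \<alpha>) \<longlonglongrightarrow> lookup q \<alpha>"
  shows "(\<lambda>n. lookup (P n * Q n) \<alpha>) \<longlonglongrightarrow> lookup (p * q) \<alpha>"
  unfolding lookup_mult_expand[OF assms(1,4)] lookup_mult_expand[OF assms(2,5)]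
  by (intro tendsto_intros assms(3,6))

definition sqnorm :: "nat \<Rightarrow> 'n::finite mpoly \<Rightarrow> real" where
  "sqnorm k p = (\<Sum>\<alpha>\<in>exps_le k. (lookup p \<alpha>)\<^sup>2)"

lemma sqnorm_nonneg [simp]: "0 \<le> sqnorm k p"
  unfolding sqnorm_def by (intro sum_nonneg) simp

lemma lookup_le_sqnorm: "\<alpha> \<in> exps_le k \<Longrightarrow> (lookup p \<alpha>)\<^sup>2 \<le> sqnorm k p"
  unfolding sqnorm_def by (rule member_le_sum) auto

lemma sqnorm_eq_0_iff: "p \<in> mpolys_le k \<Longrightarrow> sqnorm k p = 0 \<longleftrightarrow> p = 0"
proof -
  assume p: "p \<in> mpolys_le k"
  have "p = 0" if "sqnorm k p = 0"
  proof (rule poly_mapping_eqI)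
    fix \<alpha>
    show "lookup p \<alpha> = lookup 0 \<alpha>"
      using that lookup_le_sqnorm[of \<alpha> k p] mpolys_le_lookup[OF p, of \<alpha>] by (cases "\<alpha> \<in> exps_le k") auto
  qed
  then show ?thesis by (auto simp: sqnorm_def)
qed

lemma sqnorm_const_mult: "sqnorm k (const c * p) = c\<^sup>2 * sqnorm k p"
  by (simp add: sqnorm_def lookup_const_mult power_mult_distrib sum_distrib_left)

text \<open>Compactness of the unit sphere: otherwise normalised polynomials with form values below
  1/(n+1) would have a limit of norm 1 on which the form is not positive.\<close>

lemma positive_form_coercive:
  assumes pos: "\<And>h. h \<in> mpolys_le k \<Longrightarrow> h \<noteq> 0 \<Longrightarrow> 0 < riesz z (h * h * g)"
  shows "\<exists>\<delta>>0. \<forall>h\<in>mpolys_le k. \<delta> * sqnorm k h \<le> riesz z (h * h * g)"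
proof (rule ccontr)
  assume "\<not> ?thesis"
  then have "\<exists>h\<in>mpolys_le k. riesz z (h * h * g) < 1 / real (Suc n) * sqnorm k h" for n
    by (meson not_le of_nat_0_less_iff zero_less_Suc zero_less_divide_1_iff)
  then obtain h where h: "\<And>n. h n \<in> mpolys_le k"
    "\<And>n. riesz z (h n * h n * g) < 1 / real (Suc n) * sqnorm k (h n)" by metis
  have "h n \<noteq> 0" for n using h(2)[of n] by (auto simp: sqnorm_def)
  then have N: "sqnorm k (h n) > 0" for n
    using sqnorm_eq_0_iff[OF h(1)[of n]] sqnorm_nonneg[of k "h n"] by (simp add: less_le)
  define e where "e n = const (1 / sqrt (sqnorm k (h n))) * h n" for n
  have e: "e n \<in> mpolys_le k" "sqnorm k (e n) = 1" for n
    using N[of n] h(1)[of n] by (simp_all add: e_def mpolys_le_const_mult sqnorm_const_mult power_divide)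
  have small: "riesz z (e n * e n * g) < 1 / real (Suc n)" for n
  proof -
    have "e n * e n * g = const (1 / sqrt (sqnorm k (h n))) * (const (1 / sqrt (sqnorm k (h n))) * (h n * h n * g))"
      by (simp add: e_def mult_ac)
    then have "riesz z (e n * e n * g) = riesz z (h n * h n * g) / sqnorm k (h n)"
      using N[of n] by (simp add: riesz_const_mult)
    then show ?thesis using h(2)[of n] N[of n] by (simp add: divide_less_eq)
  qed
  have "\<bar>lookup (e n) \<alpha>\<bar> \<le> 1" for n \<alpha>
    using lookup_le_sqnorm[of \<alpha> k "e n"] e(2)[of n] mpolys_le_lookup[OF e(1)[of n], of \<alpha>]
    by (cases "\<alpha> \<in> exps_le k") (auto simp: abs_square_le_1)
  then have "Bseq (\<lambda>n. lookup (e n) \<alpha>)" for \<alpha>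
    by (intro BseqI[of 1]) auto
  then obtain r l where r: "strict_mono (r :: nat \<Rightarrow> nat)" "\<And>\<alpha>. (\<lambda>n. lookup (e (r n)) \<alpha>) \<longlonglongrightarrow> l \<alpha>"
    using pointwise_convergent_subsequence[of "\<lambda>n. lookup (e n)"] by blast
  obtain p where p: "p \<in> mpolys_le k" "\<And>\<alpha>. (\<lambda>n. lookup (e (r n)) \<alpha>) \<longlonglongrightarrow> lookup p \<alpha>"
    using mpolys_le_limit[of "\<lambda>n. e (r n)" k l] e(1) r(2) by blast
  have "(\<lambda>n. sqnorm k (e (r n))) \<longlonglongrightarrow> sqnorm k p"
    unfolding sqnorm_def by (intro tendsto_intros p(2))
  then have "sqnorm k p = 1" by (simp add: e(2) LIMSEQ_const_iff)
  then have "p \<noteq> 0" by (auto simp: sqnorm_def)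
  have "(\<lambda>n. riesz z (e (r n) * e (r n) * g)) \<longlonglongrightarrow> riesz z (p * p * g)"
    unfolding riesz_square_localizing[OF e(1)] riesz_square_localizing[OF p(1)]
    by (intro tendsto_intros p(2))
  moreover have "(\<lambda>n. 1 / real (Suc (r n))) \<longlonglongrightarrow> 0"
    using LIMSEQ_subseq_LIMSEQ[OF LIMSEQ_inverse_real_of_nat r(1)]
    by (simp add: o_def inverse_eq_divide)
  ultimately have "riesz z (p * p * g) \<le> 0"
    by (rule LIMSEQ_le) (use small less_imp_le in blast)
  then show False using pos[OF p(1) \<open>p \<noteq> 0\<close>] by simp
qed

text \<open>With \<open>J = {0}\<close> and \<open>G = 1\<close> this is \<open>SOS d\<close>, and
  with the constraints as \<open>G\<close> it is the quadratic module, so that closedness and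
  duality are argued once for both cones.\<close>

definition sos_module :: "nat set \<Rightarrow> (nat \<Rightarrow> nat) \<Rightarrow> (nat \<Rightarrow> 'n::finite mpoly) \<Rightarrow> 'n mpoly set" where
  "sos_module J k G = {\<Sum>j\<in>J. \<sigma> j * G j | \<sigma>. \<forall>j\<in>J. \<sigma> j \<in> SOS (k j)}"

lemma SOS_add: "s \<in> SOS k \<Longrightarrow> t \<in> SOS k \<Longrightarrow> s + t \<in> SOS k"
  unfolding SOS_def
proof (safe intro!: mpolys_le_add)
  fix qs rs :: "'a mpoly list"
  show "\<exists>ps. (\<Sum>q\<leftarrow>qs. q\<^sup>2) + (\<Sum>q\<leftarrow>rs. q\<^sup>2) = (\<Sum>q\<leftarrow>ps. q\<^sup>2)"
    by (rule exI[of _ "qs @ rs"]) simp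
qed

lemma SOS_square: "h \<in> mpolys_le k \<Longrightarrow> h * h \<in> SOS k"
  using sum_squares_in_SOS[of "{()}" "\<lambda>_. h" k] by simp

lemma SOS_0 [simp]: "0 \<in> SOS k"
  using SOS_square[of 0 k] by simp

lemma SOS_const_mult:
  fixes s :: "'n::finite mpoly"
  assumes "s \<in> SOS k" "0 \<le> c"
  shows "const c * s \<in> SOS k"
proof -
  obtain r :: "nat ^ 'n \<Rightarrow> 'n mpoly" where r: "\<And>a. a \<in> exps_le k \<Longrightarrow> r a \<in> mpolys_le k" "s = (\<Sum>a\<in>exps_le k. r a * r a)"
    using SOS_normal_form[OF assms(1)] by blast
  have "const c * s = (\<Sum>a\<in>exps_le k. (const (sqrt c) * r a) * (const (sqrt c) * r a))"
  proof -
    have "(const (sqrt c) * p) * (const (sqrt c) * p) = const c * (p * p)" for p :: "'n mpoly"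
    proof -
      have "(const (sqrt c) * p) * (const (sqrt c) * p) = const (sqrt c) * const (sqrt c) * (p * p)"
        by (simp only: mult_ac)
      then show ?thesis using assms(2) by (simp add: const_mult_const)
    qed
    then show ?thesis by (simp add: r(2) sum_distrib_left)
  qed
  also have "\<dots> \<in> SOS k"
    using r(1) by (intro sum_squares_in_SOS mpolys_le_const_mult) simp_all
  finally show ?thesis .
qed

lemma SOS_mpolys_le: "s \<in> SOS k \<Longrightarrow> s \<in> mpolys_le (2 * k)"
  by (simp add: SOS_def)

lemma sos_module_add:
  assumes "p \<in> sos_module J k G" "q \<in> sos_module J k G"
  shows "p + q \<in> sos_module J k G"
proof -
  obtain \<sigma> \<tau> where "\<forall>j\<in>J. \<sigma> j \<in> SOS (k j)" "p = (\<Sum>j\<in>J. \<sigma> j * G j)"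
    "\<forall>j\<in>J. \<tau> j \<in> SOS (k j)" "q = (\<Sum>j\<in>J. \<tau> j * G j)"
    using assms by (auto simp: sos_module_def)
  then show ?thesis
    unfolding sos_module_def
    by (intro CollectI exI[of _ "\<lambda>j. \<sigma> j + \<tau> j"]) (simp add: SOS_add distrib_right sum.distrib)
qed

lemma sos_module_const_mult:
  assumes "p \<in> sos_module J k G" "0 \<le> c"
  shows "const c * p \<in> sos_module J k G"
proof -
  obtain \<sigma> where "\<forall>j\<in>J. \<sigma> j \<in> SOS (k j)" "p = (\<Sum>j\<in>J. \<sigma> j * G j)"
    using assms by (auto simp: sos_module_def)
  then show ?thesis
    unfolding sos_module_def using assms(2)
    by (intro CollectI exI[of _ "\<lambda>j. const c * \<sigma> j"]) (simp add: SOS_const_mult sum_distrib_left mult.assoc)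
qed

lemma sos_module_0 [simp]: "0 \<in> sos_module J k G"
  unfolding sos_module_def by (intro CollectI exI[of _ "\<lambda>_. 0"]) simp

lemma sos_module_generator:
  assumes "finite J" "j \<in> J" "h \<in> mpolys_le (k j)"
  shows "h * h * G j \<in> sos_module J k G"
proof -
  have "(\<Sum>i\<in>J. (if i = j then h * h else 0) * G i) = (\<Sum>i\<in>J. if i = j then h * h * G i else 0)"
    by (intro sum.cong) auto
  also have "\<dots> = h * h * G j"
    using assms by (simp add: sum.delta)
  finally show ?thesis
    unfolding sos_module_def using assms SOS_square
    by (intro CollectI exI[of _ "\<lambda>i. if i = j then h * h else 0"]) auto
qed

lemma riesz_sos_nonneg:
  fixes s :: "'n::finite mpoly"
  assumes "\<And>h. h \<in> mpolys_le k \<Longrightarrow> 0 \<le> riesz z (h * h * g)" "s \<in> SOS k"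
  shows "0 \<le> riesz z (s * g)"
proof -
  obtain r :: "nat ^ 'n \<Rightarrow> 'n mpoly" where r: "\<And>a. a \<in> exps_le k \<Longrightarrow> r a \<in> mpolys_le k" "s = (\<Sum>a\<in>exps_le k. r a * r a)"
    using SOS_normal_form[OF assms(2)] by blast
  then show ?thesis
    by (auto simp: sum_distrib_right riesz_sum intro!: sum_nonneg assms(1))
qed

lemma riesz_sos_module_nonneg:
  assumes "\<And>j h. j \<in> J \<Longrightarrow> h \<in> mpolys_le (k j) \<Longrightarrow> 0 \<le> riesz z (h * h * G j)"
    and "p \<in> sos_module J k G"
  shows "0 \<le> riesz z p"
  using assms(2) unfolding sos_module_def
  by (auto simp: riesz_sum intro!: sum_nonneg riesz_sos_nonneg[OF assms(1)])

lemma sos_module_mpolys_le: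
  assumes "\<And>j. j \<in> J \<Longrightarrow> G j \<in> mpolys_le (K - 2 * k j) \<and> 2 * k j \<le> K" "p \<in> sos_module J k G"
  shows "p \<in> mpolys_le K"
proof -
  obtain \<sigma> where s: "\<forall>j\<in>J. \<sigma> j \<in> SOS (k j)" "p = (\<Sum>j\<in>J. \<sigma> j * G j)"
    using assms by (auto simp: sos_module_def)
  have "\<sigma> j * G j \<in> mpolys_le (2 * k j + (K - 2 * k j))" if "j \<in> J" for j
    using s(1) assms(1) that by (intro mpolys_le_mult SOS_mpolys_le) auto
  then show ?thesis using assms(1) unfolding s(2) by (intro mpolys_le_sum) simp
qed

text \<open>The functional \<open>z\<close> controls the coefficients of all polynomials that are squared in a
  representation of \<open>q n\<close>, whose number is bounded by the normal form.\<close>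

lemma sos_module_compact:
  fixes G :: "nat \<Rightarrow> 'n::finite mpoly"
  assumes "finite J"
    and pos: "\<And>j h. j \<in> J \<Longrightarrow> h \<in> mpolys_le (k j) \<Longrightarrow> h \<noteq> 0 \<Longrightarrow> 0 < riesz z (h * h * G j)"
    and q: "\<And>n. q n \<in> sos_module J k G" "\<And>n. riesz z (q n) \<le> C"
  obtains r p where "strict_mono (r :: nat \<Rightarrow> nat)" "p \<in> sos_module J k G"
    "\<And>\<alpha>. (\<lambda>n. lookup (q (r n)) \<alpha>) \<longlonglongrightarrow> lookup p \<alpha>"
proof -
  define rep where "rep n R \<longleftrightarrow> (\<forall>j\<in>J. \<forall>a\<in>exps_le (k j). R j a \<in> mpolys_le (k j)) \<and>
    q n = (\<Sum>j\<in>J. \<Sum>a\<in>exps_le (k j). R j a * R j a * G j)" for n and R :: "nat \<Rightarrow> nat ^ 'n \<Rightarrow> 'n mpoly"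
  have "\<exists>R. rep n R" for n
  proof -
    obtain \<sigma> where s: "\<forall>j\<in>J. \<sigma> j \<in> SOS (k j)" "q n = (\<Sum>j\<in>J. \<sigma> j * G j)"
      using q(1)[of n] by (auto simp: sos_module_def)
    then have "\<forall>j\<in>J. \<exists>R :: nat ^ 'n \<Rightarrow> 'n mpoly. (\<forall>a\<in>exps_le (k j). R a \<in> mpolys_le (k j)) \<and> \<sigma> j = (\<Sum>a\<in>exps_le (k j). R a * R a)"
      by (metis SOS_normal_form)
    then obtain R :: "nat \<Rightarrow> nat ^ 'n \<Rightarrow> 'n mpoly" where R: "\<forall>j\<in>J. (\<forall>a\<in>exps_le (k j). R j a \<in> mpolys_le (k j)) \<and> \<sigma> j = (\<Sum>a\<in>exps_le (k j). R j a * R j a)"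
      by metis
    then have "q n = (\<Sum>j\<in>J. \<Sum>a\<in>exps_le (k j). R j a * R j a * G j)"
      by (simp add: s(2) sum_distrib_right)
    then have "rep n R" using R by (simp add: rep_def)
    then show ?thesis by blast
  qed
  then obtain R where "\<And>n. rep n (R n)" by metis
  then have R: "\<And>n j a. j \<in> J \<Longrightarrow> a \<in> exps_le (k j) \<Longrightarrow> R n j a \<in> mpolys_le (k j)"
    "\<And>n. q n = (\<Sum>j\<in>J. \<Sum>a\<in>exps_le (k j). R n j a * R n j a * G j)" by (simp_all add: rep_def)
  \<comment> \<open>Padding with 0 gives all index triples bounded coefficients, so that one
    diagonal argument over the countable index type serves them all.\<close>
  define T where "T n j a = (if j \<in> J \<and> a \<in> exps_le (k j) then R n j a else 0)" for n j a
  have T: "T n j a \<in> mpolys_le (k j)" for n j a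
    using R(1) by (simp add: T_def)
  have qT: "q n = (\<Sum>j\<in>J. \<Sum>a\<in>exps_le (k j). T n j a * T n j a * G j)" for n
    unfolding R(2) T_def by (intro sum.cong refl) simp
  have nonneg: "0 \<le> riesz z (h * h * G j)" if "j \<in> J" "h \<in> mpolys_le (k j)" for j h
    using pos[OF that] by (cases "h = 0") auto
  \<comment> \<open>All summands of \<open>riesz z (q n)\<close> are nonnegative, so each is at most
    their total.\<close>
  have le_C: "riesz z (T n j a * T n j a * G j) \<le> C" if "j \<in> J" "a \<in> exps_le (k j)" for n j a
  proof -
    have "riesz z (T n j a * T n j a * G j) \<le> (\<Sum>a\<in>exps_le (k j). riesz z (T n j a * T n j a * G j))"
      using that T by (intro member_le_sum nonneg) auto
    also have "\<dots> \<le> (\<Sum>j\<in>J. \<Sum>a\<in>exps_le (k j). riesz z (T n j a * T n j a * G j))"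
      using that(1) T assms(1) by (intro member_le_sum[of j J] sum_nonneg nonneg) auto
    also have "\<dots> = riesz z (q n)" by (simp add: qT riesz_sum)
    finally show ?thesis using q(2)[of n] by simp
  qed
  have B: "Bseq (\<lambda>n. lookup (T n j a) \<alpha>)" for j a \<alpha>
  proof (cases "j \<in> J \<and> a \<in> exps_le (k j) \<and> \<alpha> \<in> exps_le (k j)")
    case True
    obtain \<delta> where \<delta>: "\<delta> > 0" "\<And>h. h \<in> mpolys_le (k j) \<Longrightarrow> \<delta> * sqnorm (k j) h \<le> riesz z (h * h * G j)"
      using positive_form_coercive[of "k j" z "G j"] pos True by blast
    have "norm (lookup (T n j a) \<alpha>) \<le> sqrt (C / \<delta>)" for n
    proof -
      have "\<delta> * (lookup (T n j a) \<alpha>)\<^sup>2 \<le> \<delta> * sqnorm (k j) (T n j a)"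
        using \<delta>(1) True by (intro mult_left_mono lookup_le_sqnorm) auto
      also have "\<dots> \<le> C" using \<delta>(2)[OF T, of n a] le_C[of j a n] True by simp
      finally have "(lookup (T n j a) \<alpha>)\<^sup>2 \<le> C / \<delta>" using \<delta>(1) by (simp add: field_simps)
      then show ?thesis using real_le_rsqrt[of "\<bar>lookup (T n j a) \<alpha>\<bar>" "C / \<delta>"] by simp
    qed
    then show ?thesis by (rule BseqI')
  next
    case False
    then have "lookup (T n j a) \<alpha> = 0" for n
      using mpolys_le_lookup[OF T[of n j a], of \<alpha>] by (cases "j \<in> J \<and> a \<in> exps_le (k j)") (auto simp: T_def)
    then show ?thesis by simp
  qed
  obtain r l where r: "strict_mono (r :: nat \<Rightarrow> nat)"
    "\<And>x. (\<lambda>n. (\<lambda>(j, a, \<alpha>). lookup (T (r n) j a) \<alpha>) x) \<longlonglongrightarrow> l x"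
    by (rule pointwise_convergent_subsequence[of "\<lambda>n (j, a, \<alpha>). lookup (T n j a) \<alpha>"])
      (auto simp: B split: prod.split)
  have "\<exists>p. p \<in> mpolys_le (k j) \<and> (\<forall>\<alpha>. (\<lambda>n. lookup (T (r n) j a) \<alpha>) \<longlonglongrightarrow> lookup p \<alpha>)" for j a
  proof -
    have "(\<lambda>n. lookup (T (r n) j a) \<alpha>) \<longlonglongrightarrow> l (j, a, \<alpha>)" for \<alpha>
      using r(2)[of "(j, a, \<alpha>)"] by simp
    from mpolys_le_limit[of "\<lambda>n. T (r n) j a", OF T this] show ?thesis by blast
  qed
  then obtain P where P: "\<And>j a. P j a \<in> mpolys_le (k j)"
    "\<And>j a \<alpha>. (\<lambda>n. lookup (T (r n) j a) \<alpha>) \<longlonglongrightarrow> lookup (P j a) \<alpha>" by metis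
  have "(\<lambda>n. lookup (T (r n) j a * T (r n) j a * G j) \<alpha>) \<longlonglongrightarrow> lookup (P j a * P j a * G j) \<alpha>" for j a \<alpha>
    by (rule tendsto_lookup_mult[where j = "k j + k j" and k = "mdegree (G j)"])
      (auto intro!: mpolys_le_mult T P tendsto_lookup_mult simp: mpolys_le_def[of "mdegree (G j)"])
  then have "(\<lambda>n. lookup (q (r n)) \<alpha>)
    \<longlonglongrightarrow> lookup (\<Sum>j\<in>J. \<Sum>a\<in>exps_le (k j). P j a * P j a * G j) \<alpha>" for \<alpha>
    unfolding qT lookup_sum by (intro tendsto_sum)
  moreover have "(\<Sum>j\<in>J. \<Sum>a\<in>exps_le (k j). P j a * P j a * G j) \<in> sos_module J k G"
    unfolding sos_module_def
    by (intro CollectI exI[of _ "\<lambda>j. \<Sum>a\<in>exps_le (k j). P j a * P j a"])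
      (auto simp: sum_distrib_right intro!: sum_squares_in_SOS P(1))
  ultimately show thesis using that[OF r(1)] by blast
qed


section \<open>Conic duality\<close>

lemma sqnorm_add_scaled:
  assumes "w \<in> mpolys_le K"
  shows "sqnorm K (r + const t * w) = sqnorm K r + 2 * t * riesz (lookup r) w + t\<^sup>2 * sqnorm K w"
  unfolding sqnorm_def riesz_mpolys_le[OF assms] lookup_add lookup_const_mult
  by (simp add: power2_sum power_mult_distrib sum.distrib sum_distrib_left mult_ac)

text \<open>First-order condition at a minimum of the squared distance.
  \<open>riesz (lookup r)\<close> is the Euclidean inner product with \<open>r\<close>, so a
  residual acts directly as a linear functional.\<close>

lemma sqnorm_variation:
  assumes w: "w \<in> mpolys_le K"
    and min: "\<And>t. 0 < t \<Longrightarrow> t \<le> 1 \<Longrightarrow> sqnorm K r \<le> sqnorm K (r + const t * w)"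
  shows "0 \<le> riesz (lookup r) w"
proof (rule ccontr)
  define b where "b = - riesz (lookup r) w"
  define N where "N = sqnorm K w"
  assume "\<not> ?thesis"
  then have b: "b > 0" by (simp add: b_def)
  have N: "N \<ge> 0" by (simp add: N_def)
  \<comment> \<open>So small that the quadratic term \<open>t\<^sup>2 * N\<close> is at most half of
    the linear term \<open>2 * t * b\<close>.\<close>
  define t where "t = min 1 (b / (N + 1))"
  have t: "0 < t" "t \<le> 1"
    using b N by (auto simp: t_def)
  have "t \<le> b / (N + 1)" by (simp add: t_def)
  then have tN: "t * (N + 1) \<le> b" using N by (simp add: pos_le_divide_eq)
  have "0 \<le> 2 * t * (- b) + t\<^sup>2 * N"
    using min[OF t(1,2)] unfolding sqnorm_add_scaled[OF w] by (simp add: b_def N_def)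
  also have "\<dots> = t * (t * N - 2 * b)" by (simp add: power2_eq_square algebra_simps)
  finally have "0 \<le> t * N - 2 * b" using t(1) by (simp add: zero_le_mult_iff)
  moreover have "t * N \<le> b" using t tN by (simp add: algebra_simps)
  ultimately show False using b by simp
qed

text \<open>Bounding each coefficient a by 1 + a^2 is crude but avoids square roots; only
  boundedness matters.\<close>

lemma abs_riesz_le_sqnorm:
  assumes "w \<in> mpolys_le K"
  shows "\<bar>riesz z w\<bar> \<le> (1 + sqnorm K w) * (\<Sum>\<alpha>\<in>exps_le K. \<bar>z \<alpha>\<bar>)"
proof -
  have "\<bar>lookup w \<alpha>\<bar> \<le> 1 + sqnorm K w" if "\<alpha> \<in> exps_le K" for \<alpha>
  proof -
    have "0 \<le> (\<bar>lookup w \<alpha>\<bar> - 1)\<^sup>2" by simp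
    then have "2 * \<bar>lookup w \<alpha>\<bar> \<le> 1 + (lookup w \<alpha>)\<^sup>2" by (simp add: power2_diff)
    moreover have "(lookup w \<alpha>)\<^sup>2 \<le> sqnorm K w" by (rule lookup_le_sqnorm[OF that])
    ultimately show ?thesis by (smt (verit) abs_ge_zero)
  qed
  then have "(\<Sum>\<alpha>\<in>exps_le K. \<bar>lookup w \<alpha>\<bar> * \<bar>z \<alpha>\<bar>) \<le> (\<Sum>\<alpha>\<in>exps_le K. (1 + sqnorm K w) * \<bar>z \<alpha>\<bar>)"
    by (intro sum_mono mult_right_mono) auto
  moreover have "\<bar>riesz z w\<bar> \<le> (\<Sum>\<alpha>\<in>exps_le K. \<bar>lookup w \<alpha>\<bar> * \<bar>z \<alpha>\<bar>)"
    unfolding riesz_mpolys_le[OF assms] by (rule order_trans[OF sum_abs]) (simp add: abs_mult)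
  ultimately show ?thesis by (simp add: sum_distrib_left)
qed

text \<open>The abstract problem is to minimise \<open>riesz y p\<close> over \<open>p\<close> in
  the first cone with \<open>p - f\<close> in the second. Strict positivity of one functional on
  each cone takes the part of an interior point: it makes the relevant slices of both cones
  compact.\<close>

locale positive_cones =
  fixes J1 J2 :: "nat set" and k1 k2 :: "nat \<Rightarrow> nat" and G1 G2 :: "nat \<Rightarrow> 'n::finite mpoly"
    and y z :: "nat ^ 'n \<Rightarrow> real" and K :: nat and f :: "'n mpoly"
  assumes fin: "finite J1" "finite J2"
    and pos1: "\<And>j h. j \<in> J1 \<Longrightarrow> h \<in> mpolys_le (k1 j) \<Longrightarrow> h \<noteq> 0 \<Longrightarrow> 0 < riesz y (h * h * G1 j)"
    and pos2: "\<And>j h. j \<in> J2 \<Longrightarrow> h \<in> mpolys_le (k2 j) \<Longrightarrow> h \<noteq> 0 \<Longrightarrow> 0 < riesz z (h * h * G2 j)"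
    and deg1: "sos_module J1 k1 G1 \<subseteq> mpolys_le K"
    and deg2: "sos_module J2 k2 G2 \<subseteq> mpolys_le K"
    and f: "f \<in> mpolys_le K"
begin

abbreviation "K1 \<equiv> sos_module J1 k1 G1"
abbreviation "K2 \<equiv> sos_module J2 k2 G2"

text \<open>The order of the extractions matters. The bound on \<open>riesz y (p n)\<close> makes
  the \<open>p n\<close> compact; only along that subsequence is \<open>riesz z (p n)\<close>
  bounded, which together with the bounded residual bounds \<open>riesz z (q n)\<close> and makes
  the \<open>q n\<close> compact.\<close>

lemma convergent_pair:
  assumes p: "\<And>n. p n \<in> K1" "\<And>n. riesz y (p n) \<le> c" and q: "\<And>n. q n \<in> K2"
    and bounded: "\<And>n. sqnorm K (p n - f - q n) \<le> C"
  obtains r p' q' where "strict_mono (r :: nat \<Rightarrow> nat)" "p' \<in> K1" "riesz y p' \<le> c" "q' \<in> K2"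
    "\<And>\<alpha>. (\<lambda>n. lookup (p (r n)) \<alpha>) \<longlonglongrightarrow> lookup p' \<alpha>"
    "\<And>\<alpha>. (\<lambda>n. lookup (q (r n)) \<alpha>) \<longlonglongrightarrow> lookup q' \<alpha>"
proof -
  have pK: "p n \<in> mpolys_le K" for n using p(1) deg1 by blast
  have qK: "q n \<in> mpolys_le K" for n using q deg2 by blast
  obtain r1 p' where r1: "strict_mono (r1 :: nat \<Rightarrow> nat)" "p' \<in> K1"
    "\<And>\<alpha>. (\<lambda>n. lookup (p (r1 n)) \<alpha>) \<longlonglongrightarrow> lookup p' \<alpha>"
    by (rule sos_module_compact[where q = p and C = c, OF fin(1) pos1 p]; (assumption | (rule that; assumption)))
  have p'K: "p' \<in> mpolys_le K" using r1(2) deg1 by blast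
  have lim: "(\<lambda>n. riesz x (p (r1 n))) \<longlonglongrightarrow> riesz x p'" for x
    by (rule tendsto_riesz[OF pK p'K r1(3)])
  have "riesz y p' \<le> c" using lim[of y] p(2) by (intro LIMSEQ_le_const2[of _ _ c]) auto
  have "Bseq (\<lambda>n. riesz z (p (r1 n)))"
    using lim[of z] by (intro convergent_imp_Bseq) (auto simp: convergent_def)
  then obtain B where B: "\<And>n. \<bar>riesz z (p (r1 n))\<bar> \<le> B" by (auto simp: Bseq_def)
  have qB: "riesz z (q (r1 n)) \<le> B + \<bar>riesz z f\<bar> + (1 + C) * (\<Sum>\<alpha>\<in>exps_le K. \<bar>z \<alpha>\<bar>)" for n
  proof -
    let ?w = "p (r1 n) - f - q (r1 n)"
    have "?w \<in> mpolys_le K" by (intro mpolys_le_diff pK qK f)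
    from abs_riesz_le_sqnorm[OF this, of z]
    have "\<bar>riesz z ?w\<bar> \<le> (1 + sqnorm K ?w) * (\<Sum>\<alpha>\<in>exps_le K. \<bar>z \<alpha>\<bar>)" .
    also have "\<dots> \<le> (1 + C) * (\<Sum>\<alpha>\<in>exps_le K. \<bar>z \<alpha>\<bar>)"
      using bounded[of "r1 n"] by (intro mult_right_mono sum_nonneg) auto
    finally show ?thesis using B[of n] by (simp add: riesz_diff)
  qed
  obtain r2 q' where r2: "strict_mono (r2 :: nat \<Rightarrow> nat)" "q' \<in> K2"
    "\<And>\<alpha>. (\<lambda>n. lookup (q (r1 (r2 n))) \<alpha>) \<longlonglongrightarrow> lookup q' \<alpha>"
    by (rule sos_module_compact[where q = "\<lambda>n. q (r1 n)", OF fin(2) pos2 q qB]; (assumption | (rule that; assumption)))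
  show thesis
  proof (rule that[of "r1 \<circ> r2" p' q'])
    show "(\<lambda>n. lookup (p ((r1 \<circ> r2) n)) \<alpha>) \<longlonglongrightarrow> lookup p' \<alpha>" for \<alpha>
      using LIMSEQ_subseq_LIMSEQ[OF r1(3) r2(1)] by (simp add: o_def)
  qed (use r1 r2 \<open>riesz y p' \<le> c\<close> in \<open>auto simp: o_def strict_mono_def\<close>)
qed

lemma nearest_pair:
  assumes "0 \<le> c"
  obtains p' q' where "p' \<in> K1" "riesz y p' \<le> c" "q' \<in> K2"
    "\<And>p q. p \<in> K1 \<Longrightarrow> riesz y p \<le> c \<Longrightarrow> q \<in> K2 \<Longrightarrow> sqnorm K (p' - f - q') \<le> sqnorm K (p - f - q)"
proof -
  define S where "S = {sqnorm K (p - f - q) | p q. p \<in> K1 \<and> riesz y p \<le> c \<and> q \<in> K2}"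
  have "sqnorm K (0 - f - 0) \<in> S" unfolding S_def using assms by (intro CollectI exI[of _ 0]) auto
  then have ne: "S \<noteq> {}" by blast
  have bdd: "bdd_below S" by (rule bdd_belowI[of _ 0]) (auto simp: S_def)
  have "\<exists>s\<in>S. s < Inf S + 1 / real (Suc n)" for n
    using cInf_lessD[OF ne, of "Inf S + 1 / real (Suc n)"] by simp
  then have "\<exists>p q. p \<in> K1 \<and> riesz y p \<le> c \<and> q \<in> K2 \<and> sqnorm K (p - f - q) < Inf S + 1 / real (Suc n)" for n
    unfolding S_def by blast
  then obtain p q where pq: "\<And>n. p n \<in> K1" "\<And>n. riesz y (p n) \<le> c" "\<And>n. q n \<in> K2"
    "\<And>n. sqnorm K (p n - f - q n) < Inf S + 1 / real (Suc n)" by metis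
  have "sqnorm K (p n - f - q n) \<le> Inf S + 1" for n
  proof -
    have "1 / real (Suc n) \<le> 1" by simp
    then show ?thesis using pq(4)[of n] by linarith
  qed
  then obtain r p' q' where r: "strict_mono (r :: nat \<Rightarrow> nat)" "p' \<in> K1" "riesz y p' \<le> c" "q' \<in> K2"
    "\<And>\<alpha>. (\<lambda>n. lookup (p (r n)) \<alpha>) \<longlonglongrightarrow> lookup p' \<alpha>"
    "\<And>\<alpha>. (\<lambda>n. lookup (q (r n)) \<alpha>) \<longlonglongrightarrow> lookup q' \<alpha>"
    using convergent_pair[where p = p and q = q, OF pq(1-3)] by metis
  have "(\<lambda>n. sqnorm K (p (r n) - f - q (r n))) \<longlonglongrightarrow> sqnorm K (p' - f - q')"
    unfolding sqnorm_def lookup_minus by (intro tendsto_intros r)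
  moreover have "(\<lambda>n. Inf S + 1 / real (Suc (r n))) \<longlonglongrightarrow> Inf S + 0"
    using LIMSEQ_subseq_LIMSEQ[OF LIMSEQ_inverse_real_of_nat r(1)]
    by (intro tendsto_intros) (simp add: o_def inverse_eq_divide)
  ultimately have "sqnorm K (p' - f - q') \<le> Inf S + 0"
    by (rule LIMSEQ_le) (use pq(4) less_imp_le in blast)
  then have "sqnorm K (p' - f - q') \<le> sqnorm K (p - f - q)" if "p \<in> K1" "riesz y p \<le> c" "q \<in> K2" for p q
    using that cInf_lower[OF _ bdd, of "sqnorm K (p - f - q)"] by (force simp: S_def)
  then show thesis by (rule that[OF r(2-4)])
qed

text \<open>If no feasible point has value at most \<open>c\<close>, the residual of a nearest pair, suitably scaled,
  is a functional that separates the two convex sets.\<close>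

lemma conic_alternative:
  assumes c: "0 < c"
  shows "(\<exists>p\<in>K1. riesz y p \<le> c \<and> p - f \<in> K2) \<or>
    (\<exists>u. (\<forall>p\<in>K1. riesz u p \<le> riesz y p) \<and> (\<forall>q\<in>K2. 0 \<le> riesz u q) \<and> c < riesz u f)"
proof -
  obtain p' q' where p': "p' \<in> K1" "riesz y p' \<le> c" and q': "q' \<in> K2"
    and nearest: "\<And>p q. p \<in> K1 \<Longrightarrow> riesz y p \<le> c \<Longrightarrow> q \<in> K2 \<Longrightarrow>
      sqnorm K (p' - f - q') \<le> sqnorm K (p - f - q)"
    using nearest_pair[of c] c by (metis less_imp_le)
  define r where "r = p' - f - q'"
  have K: "p \<in> K1 \<Longrightarrow> p \<in> mpolys_le K" "p \<in> K2 \<Longrightarrow> p \<in> mpolys_le K" for p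
    using deg1 deg2 by blast+
  have rK: "r \<in> mpolys_le K" unfolding r_def by (intro mpolys_le_diff K p' q' f)
  show ?thesis
  proof (cases "r = 0")
    case True
    then have "p' - f = q'" by (simp add: r_def)
    then show ?thesis using p' q' by metis
  next
    case False
    have const_diff: "const (1 - t) = 1 - const t" for t
      by (simp add: single_diff)
    \<comment> \<open>The slice \<open>riesz y p \<le> c\<close> of the cone is convex, so moving
      from \<open>p'\<close> towards \<open>p\<close> is admissible.\<close>
    have on_K1: "riesz (lookup r) p' \<le> riesz (lookup r) p" if p: "p \<in> K1" "riesz y p \<le> c" for p
    proof -
      have "0 \<le> riesz (lookup r) (p - p')"
      proof (rule sqnorm_variation[of _ K])
        fix t :: real assume t: "0 < t" "t \<le> 1"
        let ?p = "const (1 - t) * p' + const t * p"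
        have "?p \<in> K1" using t p p' by (intro sos_module_add sos_module_const_mult) auto
        moreover have "riesz y ?p \<le> c"
        proof -
          have "(1 - t) * riesz y p' + t * riesz y p \<le> (1 - t) * c + t * c"
            using t p p' by (intro add_mono mult_left_mono) auto
          also have "\<dots> = c" by (simp add: algebra_simps)
          finally show ?thesis by (simp only: riesz_add riesz_const_mult)
        qed
        moreover have "?p - f - q' = r + const t * (p - p')"
          unfolding const_diff r_def by (simp add: algebra_simps)
        ultimately show "sqnorm K r \<le> sqnorm K (r + const t * (p - p'))"
          using nearest[OF _ _ q'] unfolding r_def by metis
      qed (intro mpolys_le_diff K p p')
      then show ?thesis by (simp add: riesz_diff)
    qed
    have on_K2: "riesz (lookup r) q \<le> 0" if q: "q \<in> K2" for q
    proof -
      have "0 \<le> riesz (lookup r) (0 - q)"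
      proof (rule sqnorm_variation[of _ K])
        fix t :: real assume t: "0 < t" "t \<le> 1"
        have "q' + const t * q \<in> K2" using t q q' by (intro sos_module_add sos_module_const_mult) auto
        moreover have "p' - f - (q' + const t * q) = r + const t * (0 - q)"
          unfolding r_def by (simp add: algebra_simps)
        ultimately show "sqnorm K r \<le> sqnorm K (r + const t * (0 - q))"
          using nearest[OF p'] unfolding r_def by metis
      qed (intro mpolys_le_diff mpolys_le_0 K q)
      then show ?thesis by (simp only: riesz_diff riesz_0)
    qed
    \<comment> \<open>Shrinking \<open>q'\<close> stays in the cone. This fixes the sign of the last
      term in the expansion of \<open>riesz (lookup r) r\<close> below.\<close>
    have on_q': "0 \<le> riesz (lookup r) q'"
    proof (rule sqnorm_variation[of _ K])
      fix t :: real assume t: "0 < t" "t \<le> 1"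
      have "const (1 - t) * q' \<in> K2" using t q' by (intro sos_module_const_mult) auto
      moreover have "p' - f - const (1 - t) * q' = r + const t * q'"
        unfolding const_diff r_def by (simp add: algebra_simps)
      ultimately show "sqnorm K r \<le> sqnorm K (r + const t * q')"
        using nearest[OF p'] unfolding r_def by metis
    qed (intro K q')
    \<comment> \<open>\<open>b\<close> is the largest value of minus the residual functional on the
      slice of \<open>K1\<close>, attained at \<open>p'\<close>, and \<open>F\<close> is its value
      at \<open>f\<close>. Since \<open>riesz (lookup r) r > 0\<close>, it follows that
      \<open>b < F\<close>; the midpoint \<open>a\<close> is positive even for \<open>b = 0\<close>
      and can be divided by.\<close>
    define b where "b = - riesz (lookup r) p'"
    define F where "F = - riesz (lookup r) f"
    have "riesz (lookup r) r = sqnorm K r"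
      by (simp add: riesz_mpolys_le[OF rK] sqnorm_def power2_eq_square)
    moreover have "sqnorm K r > 0"
      using False sqnorm_eq_0_iff[OF rK] sqnorm_nonneg[of K r] by (simp add: less_le)
    moreover have "riesz (lookup r) r = riesz (lookup r) p' - riesz (lookup r) f - riesz (lookup r) q'"
      by (subst (2) r_def) (simp add: riesz_diff)
    ultimately have bF: "b < F" using on_q' by (simp add: b_def F_def)
    have b: "0 \<le> b" using on_K1[of 0] c by (simp add: b_def)
    define a where "a = (b + F) / 2"
    have a: "b < a" "a < F" "0 < a" using b bF by (auto simp: a_def)
    define u where "u \<alpha> = - (c / a) * lookup r \<alpha>" for \<alpha>
    have u: "riesz u p = - (c / a) * riesz (lookup r) p" for p
      unfolding u_def by (rule riesz_scale_fun)
    have "riesz u p \<le> riesz y p" if p: "p \<in> K1" for p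
    proof -
      have nonneg: "0 \<le> riesz y p"
      proof (rule riesz_sos_module_nonneg[OF _ p])
        show "0 \<le> riesz y (h * h * G1 j)" if "j \<in> J1" "h \<in> mpolys_le (k1 j)" for j h
          using pos1[OF that] by (cases "h = 0") auto
      qed
      have scale: "- riesz (lookup r) p * t \<le> b" if t: "0 \<le> t" "t * riesz y p \<le> c" for t
      proof -
        have "riesz (lookup r) p' \<le> riesz (lookup r) (const t * p)"
          using t p by (intro on_K1 sos_module_const_mult) (auto simp: riesz_const_mult)
        then show ?thesis unfolding riesz_const_mult b_def by (simp add: mult.commute)
      qed
      show ?thesis
      \<comment> \<open>If \<open>riesz y p = 0\<close>, the whole ray through \<open>p\<close> lies
        in the slice, and a positive value of minus the residual functional would exceed
        \<open>b\<close> far out. Otherwise \<open>p\<close> is scaled to the value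
        \<open>c\<close>.\<close>
      proof (cases "riesz y p = 0")
        case True
        have "- riesz (lookup r) p \<le> 0"
        proof (rule ccontr)
          assume "\<not> ?thesis"
          then show False using scale[of "(b + 1) / (- riesz (lookup r) p)"] b True c by (simp add: divide_le_0_iff)
        qed
        then show ?thesis
          using True a c by (simp add: u divide_nonneg_pos)
      next
        case False
        then have yp: "riesz y p > 0" using nonneg by simp
        have "- riesz (lookup r) p * (c / riesz y p) \<le> b"
          using scale[of "c / riesz y p"] yp c by simp
        then have "- riesz (lookup r) p * c \<le> b * riesz y p"
          using yp pos_divide_le_eq[of "riesz y p" "- riesz (lookup r) p * c" b] by simp
        also have "\<dots> \<le> a * riesz y p" using a yp by (intro mult_right_mono) auto
        finally show ?thesis using a by (simp add: u field_simps)
      qed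
    qed
    moreover have "0 \<le> riesz u q" if "q \<in> K2" for q
      using on_K2[OF that] a c by (simp add: u divide_nonpos_pos mult_nonneg_nonpos)
    moreover have "c < riesz u f"
    proof -
      have "c * a < c * F" using a c by simp
      then show ?thesis using a by (simp add: u F_def field_simps)
    qed
    ultimately show ?thesis by blast
  qed
qed

end


section \<open>The primal and dual programs at a fixed order\<close>

lemma mpolys_le_half_deg: "g \<in> mpolys_le (2 * half_deg g)"
proof -
  have "real (mdegree g) / 2 \<le> of_int \<lceil>real (mdegree g) / 2\<rceil>" by (rule le_of_int_ceiling)
  moreover have "real (half_deg g) = of_int \<lceil>real (mdegree g) / 2\<rceil>" by (simp add: half_deg_def)
  ultimately have "real (mdegree g) \<le> real (2 * half_deg g)" by linarith
  then show ?thesis unfolding mpolys_le_def by (simp only: mem_Collect_eq of_nat_le_iff)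
qed

lemma riesz_add_fun:
  assumes "\<And>\<alpha>. \<alpha> \<in> exps_le K \<Longrightarrow> u \<alpha> + v \<alpha> = y \<alpha>" "p \<in> mpolys_le K"
  shows "riesz u p + riesz v p = riesz y p"
  unfolding riesz_mpolys_le[OF assms(2)] sum.distrib[symmetric] distrib_left[symmetric]
  using assms(1) by (intro sum.cong) auto

lemma riesz_cong:
  assumes "\<And>\<alpha>. \<alpha> \<in> exps_le K \<Longrightarrow> u \<alpha> = v \<alpha>" "p \<in> mpolys_le K"
  shows "riesz u p = riesz v p"
  unfolding riesz_mpolys_le[OF assms(2)] using assms(1) by (intro sum.cong) auto

lemma tendsto_riesz_fun:
  assumes "\<And>\<alpha>. (\<lambda>n. u n \<alpha>) \<longlonglongrightarrow> l \<alpha>"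
  shows "(\<lambda>n. riesz (u n) p) \<longlonglongrightarrow> riesz l p"
  unfolding riesz_def by (intro tendsto_intros assms)

text \<open>Polarisation expresses a moment through two squares. The bound does not involve
  \<open>u\<close>, so it serves both for compactness at a fixed order and for bounds uniform in the
  order.\<close>

lemma abs_moment_le:
  fixes u y :: "nat ^ 'n::finite \<Rightarrow> real"
  assumes le: "\<And>h. h \<in> mpolys_le d \<Longrightarrow> 0 \<le> riesz u (h * h) \<and> riesz u (h * h) \<le> riesz y (h * h)"
    and "\<beta> \<in> exps_le d" "\<gamma> \<in> exps_le d"
  defines "s \<equiv> Poly_Mapping.single \<beta> 1 :: 'n mpoly" and "t \<equiv> Poly_Mapping.single \<gamma> 1 :: 'n mpoly"
  shows "\<bar>u (\<beta> + \<gamma>)\<bar> \<le> riesz y ((s + t) * (s + t)) + riesz y ((s - t) * (s - t))"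
proof -
  have st: "s \<in> mpolys_le d" "t \<in> mpolys_le d"
    using assms(2,3) by (auto simp: s_def t_def mpolys_le_single)
  have "4 * u (\<beta> + \<gamma>) = riesz u ((s + t) * (s + t)) - riesz u ((s - t) * (s - t))"
  proof -
    have "(s + t) * (s + t) - (s - t) * (s - t) = const 4 * (s * t)"
      by (simp add: algebra_simps)
    then have "riesz u ((s + t) * (s + t)) - riesz u ((s - t) * (s - t)) = 4 * riesz u (s * t)"
      by (metis riesz_const_mult riesz_diff)
    then show ?thesis by (simp add: s_def t_def mult_single)
  qed
  then show ?thesis
    using le[OF mpolys_le_add[OF st]] le[OF mpolys_le_diff[OF st]] by linarith
qed

text \<open>\<open>z\<close> stands for a strictly feasible sequence, given by its inequalities. A
  zero constraint is exempt from \<open>z_pos_loc\<close>, since its localizing form vanishes;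
  \<open>z_f\<close> keeps the primal value nonnegative, so that the alternative for positive
  \<open>c\<close> applies.\<close>

locale sdp =
  fixes M :: "(real ^ 'n::finite) measure" and m :: nat and g :: "nat \<Rightarrow> 'n mpoly"
    and f :: "'n mpoly" and d :: nat and z :: "nat ^ 'n \<Rightarrow> real"
  assumes order: "\<And>j. j \<in> {1..m} \<Longrightarrow> half_deg (g j) \<le> d" "f \<in> mpolys_le (2 * d)"
    and z_le: "\<And>h. riesz z (h * h) \<le> riesz (moment M) (h * h)"
    and z_pos: "\<And>h. h \<noteq> 0 \<Longrightarrow> 0 < riesz z (h * h)"
    and z_pos_loc: "\<And>j h. j \<in> {1..m} \<Longrightarrow> g j \<noteq> 0 \<Longrightarrow> h \<noteq> 0 \<Longrightarrow> 0 < riesz z (h * h * g j)"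
    and z_f: "0 \<le> riesz z f"
    and objective: "\<And>p. dual_objective M p = riesz (moment M) p"
begin

abbreviation "y \<equiv> moment M"
abbreviation "Q \<equiv> quadratic_module d m g"

text \<open>Index 0 is free, as constraints are numbered from 1, and carries the generator 1. Zero
  constraints are left out: they add nothing to the cone but would spoil strict positivity.\<close>

definition "J = insert 0 {j \<in> {1..m}. g j \<noteq> 0}"
definition "k j = (if j = 0 then d else d - half_deg (g j))"
definition "G j = (if j = 0 then 1 else g j)"

lemma Q_eq: "Q = sos_module J k G"
proof (intro set_eqI iffI)
  fix p assume "p \<in> Q"
  then obtain \<sigma> where s: "p = \<sigma> 0 + (\<Sum>j=1..m. \<sigma> j * g j)" "\<sigma> 0 \<in> SOS d"
    "\<forall>j\<in>{1..m}. \<sigma> j \<in> SOS (d - half_deg (g j))" unfolding quadratic_module_def by blast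
  have "(\<Sum>j\<in>J. \<sigma> j * G j) = \<sigma> 0 * G 0 + (\<Sum>j\<in>{j \<in> {1..m}. g j \<noteq> 0}. \<sigma> j * G j)"
    unfolding J_def by (subst sum.insert) auto
  also have "(\<Sum>j\<in>{j \<in> {1..m}. g j \<noteq> 0}. \<sigma> j * G j) = (\<Sum>j=1..m. \<sigma> j * g j)"
    by (intro sum.mono_neutral_cong_left) (auto simp: G_def)
  finally have "p = (\<Sum>j\<in>J. \<sigma> j * G j)" by (simp add: s(1) G_def)
  then show "p \<in> sos_module J k G"
    unfolding sos_module_def using s(2,3) by (auto simp: J_def k_def intro!: exI[of _ \<sigma>])
next
  fix p assume "p \<in> sos_module J k G"
  then obtain \<sigma> where s: "p = (\<Sum>j\<in>J. \<sigma> j * G j)" "\<forall>j\<in>J. \<sigma> j \<in> SOS (k j)"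
    unfolding sos_module_def by blast
  \<comment> \<open>Multipliers of the omitted zero constraints are set to 0, which lies in every
    \<open>SOS\<close>.\<close>
  define \<tau> where "\<tau> j = (if j \<in> J then \<sigma> j else 0)" for j
  have "p = \<sigma> 0 * G 0 + (\<Sum>j\<in>{j \<in> {1..m}. g j \<noteq> 0}. \<sigma> j * G j)"
    unfolding s(1) J_def by (subst sum.insert) auto
  also have "(\<Sum>j\<in>{j \<in> {1..m}. g j \<noteq> 0}. \<sigma> j * G j) = (\<Sum>j=1..m. \<tau> j * g j)"
    by (intro sum.mono_neutral_cong_left) (auto simp: G_def \<tau>_def J_def)
  finally have "p = \<tau> 0 + (\<Sum>j=1..m. \<tau> j * g j)" by (simp add: \<tau>_def J_def G_def)
  moreover have "\<tau> 0 \<in> SOS d" using s(2) by (auto simp: \<tau>_def J_def k_def)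
  moreover have "\<forall>j\<in>{1..m}. \<tau> j \<in> SOS (d - half_deg (g j))"
    using s(2) by (auto simp: \<tau>_def J_def k_def)
  ultimately show "p \<in> Q" unfolding quadratic_module_def by blast
qed

lemma SOS_eq: "SOS d = sos_module {0} (\<lambda>_. d) (\<lambda>_. 1)"
  unfolding sos_module_def by (auto intro: exI[of _ "\<lambda>_. s" for s])

lemma y_pos: "h \<noteq> 0 \<Longrightarrow> 0 < riesz y (h * h)"
  using z_le[of h] z_pos[of h] by linarith

lemma z_pos_J: "j \<in> J \<Longrightarrow> h \<noteq> 0 \<Longrightarrow> 0 < riesz z (h * h * G j)"
  using z_pos[of h] z_pos_loc[of j h] by (auto simp: J_def G_def)

lemma Q_mpolys_le: "Q \<subseteq> mpolys_le (2 * d)"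
proof
  fix p assume "p \<in> Q"
  then show "p \<in> mpolys_le (2 * d)"
    unfolding Q_eq
  proof (rule sos_module_mpolys_le[rotated])
    fix j assume j: "j \<in> J"
    show "G j \<in> mpolys_le (2 * d - 2 * k j) \<and> 2 * k j \<le> 2 * d"
      using j order(1)[of j] mpolys_le_half_deg[of "g j"] by (auto simp: J_def G_def k_def diff_mult_distrib2)
  qed
qed

text \<open>\<open>K1\<close> becomes \<open>SOS d\<close>, controlled by the moments
  \<open>y\<close>, and \<open>K2\<close> the quadratic module, controlled by
  \<open>z\<close>.\<close>

sublocale positive_cones "{0}" J "\<lambda>_. d" k "\<lambda>_. 1" G y z "2 * d" f
proof
  show "sos_module {0} (\<lambda>_. d) (\<lambda>_. 1) \<subseteq> mpolys_le (2 * d)"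
    unfolding SOS_eq[symmetric] by (auto simp: SOS_def)
  show "sos_module J k G \<subseteq> mpolys_le (2 * d)"
    using Q_mpolys_le by (simp add: Q_eq)
qed (use order(2) y_pos z_pos_J in \<open>auto simp: J_def\<close>)

text \<open>With \<open>v\<close> eliminated as \<open>y - u\<close>, feasibility comes down to
  domination by \<open>y\<close> on \<open>SOS d\<close> and nonnegativity on \<open>Q\<close>, the
  two properties that \<open>conic_alternative\<close> provides.\<close>

lemma primal_feasibleI:
  assumes "\<And>p. p \<in> SOS d \<Longrightarrow> riesz u p \<le> riesz y p" "\<And>q. q \<in> Q \<Longrightarrow> 0 \<le> riesz u q"
  shows "primal_feasible M m g d (u, \<lambda>\<alpha>. y \<alpha> - u \<alpha>)"
proof -
  have "0 \<le> riesz u (h * h * G j)" if "j \<in> J" "h \<in> mpolys_le (k j)" for j h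
    using that assms(2) sos_module_generator[of J j h k G] by (simp add: Q_eq J_def)
  then have u: "0 \<le> riesz u (h * h * g j)" if "j \<in> {1..m}" "h \<in> mpolys_le (d - half_deg (g j))" for j h
    using that by (cases "g j = 0") (force simp: J_def k_def G_def)+
  have "0 \<le> riesz u (h * h)" if "h \<in> mpolys_le d" for h
    using that \<open>\<And>j h. j \<in> J \<Longrightarrow> h \<in> mpolys_le (k j) \<Longrightarrow> 0 \<le> riesz u (h * h * G j)\<close>[of 0 h]
    by (simp add: J_def k_def G_def)
  then show ?thesis
    unfolding primal_feasible_def psd_moment_iff psd_localizing_iff
    using u assms(1) by (auto simp: riesz_diff_fun SOS_square)
qed

lemma primal_feasibleD:
  assumes "primal_feasible M m g d (u, v)"
  shows "\<And>p. p \<in> SOS d \<Longrightarrow> 0 \<le> riesz u p \<and> riesz u p \<le> riesz y p" "\<And>q. q \<in> Q \<Longrightarrow> 0 \<le> riesz u q"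
proof -
  have uv: "\<And>\<alpha>. \<alpha> \<in> exps_le (2 * d) \<Longrightarrow> u \<alpha> + v \<alpha> = y \<alpha>"
    and u: "\<And>h. h \<in> mpolys_le d \<Longrightarrow> 0 \<le> riesz u (h * h)" and v: "\<And>h. h \<in> mpolys_le d \<Longrightarrow> 0 \<le> riesz v (h * h)"
    and uj: "\<And>j h. j \<in> {1..m} \<Longrightarrow> h \<in> mpolys_le (d - half_deg (g j)) \<Longrightarrow> 0 \<le> riesz u (h * h * g j)"
    using assms unfolding primal_feasible_def psd_moment_iff psd_localizing_iff by auto
  show "0 \<le> riesz u p \<and> riesz u p \<le> riesz y p" if p: "p \<in> SOS d" for p
  proof -
    have "riesz u p + riesz v p = riesz y p"
      using uv p by (intro riesz_add_fun[of "2 * d"]) (auto simp: SOS_mpolys_le)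
    moreover have "0 \<le> riesz v p" "0 \<le> riesz u p"
      using riesz_sos_nonneg[of d v 1 p] riesz_sos_nonneg[of d u 1 p] u v p by auto
    ultimately show ?thesis by simp
  qed
  show "0 \<le> riesz u q" if "q \<in> Q" for q
  proof (rule riesz_sos_module_nonneg)
    show "q \<in> sos_module J k G" using that by (simp add: Q_eq)
    show "0 \<le> riesz u (h * h * G j)" if "j \<in> J" "h \<in> mpolys_le (k j)" for j h
      using that u uj by (auto simp: J_def k_def G_def)
  qed
qed

lemma weak_duality:
  assumes "primal_feasible M m g d (u, v)" "dual_feasible m g f d p"
  shows "riesz u f \<le> riesz y p"
proof -
  have p: "p \<in> SOS d" "p - f \<in> Q" using assms(2) by (auto simp: dual_feasible_def)
  then have "0 \<le> riesz u (p - f)" "riesz u p \<le> riesz y p"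
    using primal_feasibleD[OF assms(1)] by blast+
  then show ?thesis by (simp add: riesz_diff)
qed

lemma feasible_z: "primal_feasible M m g d (z, \<lambda>\<alpha>. y \<alpha> - z \<alpha>)"
proof (rule primal_feasibleI)
  show "riesz z p \<le> riesz y p" if "p \<in> SOS d" for p
    using riesz_sos_nonneg[of d "\<lambda>\<alpha>. y \<alpha> - z \<alpha>" 1 p] that z_le by (simp add: riesz_diff_fun)
  show "0 \<le> riesz z q" if "q \<in> Q" for q
  proof (rule riesz_sos_module_nonneg)
    show "q \<in> sos_module J k G" using that by (simp add: Q_eq)
    show "0 \<le> riesz z (h * h * G j)" if "j \<in> J" "h \<in> mpolys_le (k j)" for j h
      using z_pos_J[OF that(1), of h] by (cases "h = 0") auto
  qed
qed

lemma feasible_moment_bound: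
  assumes "\<alpha> \<in> exps_le (2 * d)"
  shows "\<exists>B. \<forall>u v. primal_feasible M m g d (u, v) \<longrightarrow> \<bar>u \<alpha>\<bar> \<le> B"
proof -
  obtain \<beta> \<gamma> where bg: "\<alpha> = \<beta> + \<gamma>" "\<beta> \<in> exps_le d" "\<gamma> \<in> exps_le d"
    using exps_le_double[OF assms] by blast
  have "0 \<le> riesz u (h * h) \<and> riesz u (h * h) \<le> riesz y (h * h)"
    if "primal_feasible M m g d (u, v)" "h \<in> mpolys_le d" for u v h
    using primal_feasibleD(1)[OF that(1)] SOS_square[OF that(2)] by blast
  from abs_moment_le[OF this bg(2,3)] show ?thesis
    unfolding bg(1) by (intro exI allI impI)
qed

lemma primal_attained:
  obtains u where "primal_feasible M m g d (u, \<lambda>\<alpha>. y \<alpha> - u \<alpha>)"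
    "\<And>u' v'. primal_feasible M m g d (u', v') \<Longrightarrow> riesz u' f \<le> riesz u f"
proof -
  obtain B where B: "\<And>\<alpha> u v. \<alpha> \<in> exps_le (2 * d) \<Longrightarrow> primal_feasible M m g d (u, v) \<Longrightarrow> \<bar>u \<alpha>\<bar> \<le> B \<alpha>"
    using feasible_moment_bound by metis
  define S where "S = {riesz u f | u v. primal_feasible M m g d (u, v)}"
  have ne: "S \<noteq> {}" using feasible_z by (auto simp: S_def)
  have "riesz u f \<le> (\<Sum>\<alpha>\<in>exps_le (2 * d). \<bar>lookup f \<alpha>\<bar> * B \<alpha>)"
    if "primal_feasible M m g d (u, v)" for u v
    unfolding riesz_mpolys_le[OF order(2)]
  proof (rule sum_mono)
    fix \<alpha> :: "nat ^ 'n" assume \<alpha>: "\<alpha> \<in> exps_le (2 * d)"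
    have "lookup f \<alpha> * u \<alpha> \<le> \<bar>lookup f \<alpha>\<bar> * \<bar>u \<alpha>\<bar>" by (metis abs_ge_self abs_mult)
    also have "\<dots> \<le> \<bar>lookup f \<alpha>\<bar> * B \<alpha>" using B[OF \<alpha> that] by (intro mult_left_mono) auto
    finally show "lookup f \<alpha> * u \<alpha> \<le> \<bar>lookup f \<alpha>\<bar> * B \<alpha>" .
  qed
  then have bdd: "bdd_above S" by (intro bdd_aboveI) (auto simp: S_def)
  have "\<exists>s\<in>S. Sup S - 1 / real (Suc n) < s" for n
    using less_cSupD[OF ne, of "Sup S - 1 / real (Suc n)"] by simp
  then have "\<exists>u v. primal_feasible M m g d (u, v) \<and> Sup S - 1 / real (Suc n) < riesz u f" for n
    unfolding S_def by blast
  then obtain u v where uv: "\<And>n. primal_feasible M m g d (u n, v n)"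
    "\<And>n. Sup S - 1 / real (Suc n) < riesz (u n) f" by metis
  \<comment> \<open>Values of \<open>u n\<close> outside the truncation are unconstrained; setting
    them to 0 makes all coordinates bounded without affecting polynomials of degree up to
    \<open>2 * d\<close>.\<close>
  define w where "w n \<alpha> = (if \<alpha> \<in> exps_le (2 * d) then u n \<alpha> else 0)" for n \<alpha>
  have w: "riesz (w n) p = riesz (u n) p" if "p \<in> mpolys_le (2 * d)" for n p
    using that by (intro riesz_cong[of "2 * d"]) (auto simp: w_def)
  have "Bseq (\<lambda>n. w n \<alpha>)" for \<alpha>
    using B[OF _ uv(1), of \<alpha>]
    by (cases "\<alpha> \<in> exps_le (2 * d)") (auto simp: w_def intro!: BseqI'[of _ "B \<alpha>"])
  then obtain r l where r: "strict_mono (r :: nat \<Rightarrow> nat)" "\<And>\<alpha>. (\<lambda>n. w (r n) \<alpha>) \<longlonglongrightarrow> l \<alpha>"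
    using pointwise_convergent_subsequence[of w] by blast
  have lim: "(\<lambda>n. riesz (u (r n)) p) \<longlonglongrightarrow> riesz l p" if "p \<in> mpolys_le (2 * d)" for p
    using tendsto_riesz_fun[where u = "\<lambda>n. w (r n)" and p = p, OF r(2)] by (simp add: w[OF that])
  have "primal_feasible M m g d (l, \<lambda>\<alpha>. y \<alpha> - l \<alpha>)"
  proof (rule primal_feasibleI)
    show "riesz l p \<le> riesz y p" if "p \<in> SOS d" for p
      using lim[OF SOS_mpolys_le[OF that]] primal_feasibleD(1)[OF uv(1) that]
      by (intro LIMSEQ_le_const2[of _ _ "riesz y p"]) auto
    show "0 \<le> riesz l q" if "q \<in> Q" for q
    proof (rule LIMSEQ_le_const)
      show "(\<lambda>n. riesz (u (r n)) q) \<longlonglongrightarrow> riesz l q"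
        using Q_mpolys_le that by (intro lim) blast
    qed (use primal_feasibleD(2)[OF uv(1) that] in blast)
  qed
  moreover have "Sup S \<le> riesz l f"
  proof -
    have "(\<lambda>n. Sup S - 1 / real (Suc (r n))) \<longlonglongrightarrow> Sup S - 0"
      using LIMSEQ_subseq_LIMSEQ[OF LIMSEQ_inverse_real_of_nat r(1)]
      by (intro tendsto_intros) (simp add: o_def inverse_eq_divide)
    from LIMSEQ_le[OF this lim[OF order(2)]] show ?thesis
      using uv(2) less_imp_le by auto
  qed
  moreover have "riesz u' f \<le> Sup S" if "primal_feasible M m g d (u', v')" for u' v'
    using that by (intro cSup_upper bdd) (auto simp: S_def)
  ultimately show thesis using that[of l] by (meson order_trans)
qed

text \<open>The alternative is applied slightly above the primal optimum. A separating functional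
  would be a primal feasible point beating the optimum, so there are dual points within 1/(n+1) of
  it, and compactness yields one that attains it.\<close>

lemma strong_duality:
  obtains u p where "primal_feasible M m g d (u, \<lambda>\<alpha>. y \<alpha> - u \<alpha>)" "dual_feasible m g f d p"
    "riesz y p = riesz u f"
    "\<And>u' v'. primal_feasible M m g d (u', v') \<Longrightarrow> riesz u' f \<le> riesz u f"
    "\<And>p'. dual_feasible m g f d p' \<Longrightarrow> riesz y p \<le> riesz y p'"
proof -
  obtain u where u: "primal_feasible M m g d (u, \<lambda>\<alpha>. y \<alpha> - u \<alpha>)"
    "\<And>u' v'. primal_feasible M m g d (u', v') \<Longrightarrow> riesz u' f \<le> riesz u f"
    using primal_attained by metis
  have zf: "riesz z f \<le> riesz u f" using u(2)[OF feasible_z] .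
  have "\<exists>p\<in>SOS d. riesz y p \<le> riesz u f + 1 / real (Suc n) \<and> p - f \<in> Q" for n
  proof -
    have "0 < riesz u f + 1 / real (Suc n)" using zf z_f by (simp add: add_nonneg_pos)
    from conic_alternative[OF this] show ?thesis
    proof
      assume "\<exists>u'. (\<forall>p\<in>K1. riesz u' p \<le> riesz y p) \<and> (\<forall>q\<in>K2. 0 \<le> riesz u' q) \<and>
        riesz u f + 1 / real (Suc n) < riesz u' f"
      then obtain u' where "primal_feasible M m g d (u', \<lambda>\<alpha>. y \<alpha> - u' \<alpha>)"
        "riesz u f + 1 / real (Suc n) < riesz u' f"
        using primal_feasibleI unfolding SOS_eq Q_eq by blast
      moreover have "0 < 1 / real (Suc n)" by simp
      ultimately have False using u(2) by (meson add_increasing2 less_imp_le not_less order_refl)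
      then show ?thesis ..
    qed (simp add: SOS_eq Q_eq)
  qed
  then obtain p where p: "\<And>n. p n \<in> SOS d" "\<And>n. riesz y (p n) \<le> riesz u f + 1 / real (Suc n)"
    "\<And>n. p n - f \<in> Q" by metis
  have "riesz y (p n) \<le> riesz u f + 1" for n
  proof -
    have "1 / real (Suc n) \<le> 1" by simp
    then show ?thesis using p(2)[of n] by linarith
  qed
  \<comment> \<open>Here \<open>q n\<close> is \<open>p n - f\<close> itself, so the residual in
    \<open>convergent_pair\<close> is 0.\<close>
  moreover have "sqnorm (2 * d) (p n - f - (p n - f)) \<le> 0" for n
    by (simp add: sqnorm_def)
  ultimately obtain r p' q' where r: "strict_mono (r :: nat \<Rightarrow> nat)" "p' \<in> SOS d" "q' \<in> Q"
    "\<And>\<alpha>. (\<lambda>n. lookup (p (r n)) \<alpha>) \<longlonglongrightarrow> lookup p' \<alpha>"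
    "\<And>\<alpha>. (\<lambda>n. lookup (p (r n) - f) \<alpha>) \<longlonglongrightarrow> lookup q' \<alpha>"
    using convergent_pair[of p "riesz u f + 1" "\<lambda>n. p n - f" 0] p(1,3)
    unfolding SOS_eq[symmetric] Q_eq[symmetric] by metis
  have "q' = p' - f"
  proof (rule poly_mapping_eqI)
    fix \<alpha>
    have "(\<lambda>n. lookup (p (r n) - f) \<alpha>) \<longlonglongrightarrow> lookup p' \<alpha> - lookup f \<alpha>"
      unfolding lookup_minus by (intro tendsto_intros r(4))
    from LIMSEQ_unique[OF r(5) this] show "lookup q' \<alpha> = lookup (p' - f) \<alpha>"
      by (simp add: lookup_minus)
  qed
  then have feas: "dual_feasible m g f d p'"
    using r(2,3) by (simp add: dual_feasible_def SOS_mpolys_le)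
  have "(\<lambda>n. riesz y (p (r n))) \<longlonglongrightarrow> riesz y p'"
    using p(1) r(2) by (intro tendsto_riesz[of _ "2 * d"] r(4)) (auto simp: SOS_mpolys_le)
  moreover have "(\<lambda>n. riesz u f + 1 / real (Suc (r n))) \<longlonglongrightarrow> riesz u f + 0"
    using LIMSEQ_subseq_LIMSEQ[OF LIMSEQ_inverse_real_of_nat r(1)]
    by (intro tendsto_intros) (simp add: o_def inverse_eq_divide)
  ultimately have "riesz y p' \<le> riesz u f + 0"
    by (rule LIMSEQ_le) (use p(2) in blast)
  then have eq: "riesz y p' = riesz u f" using weak_duality[OF u(1) feas] by simp
  show thesis
  proof (rule that[OF u(1) feas eq u(2)])
    show "riesz y p' \<le> riesz y q" if "dual_feasible m g f d q" for q
      using weak_duality[OF u(1) that] eq by simp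
  qed
qed

theorem sdp_solution:
  obtains u p where "primal_optimal M m g f d (u, \<lambda>\<alpha>. y \<alpha> - u \<alpha>)" "dual_optimal M m g f d p"
    "primal_value M m g f d = ereal (riesz u f)" "dual_value M m g f d = ereal (riesz u f)"
proof -
  obtain u p where *: "primal_feasible M m g d (u, \<lambda>\<alpha>. y \<alpha> - u \<alpha>)" "dual_feasible m g f d p"
    "riesz y p = riesz u f"
    "\<And>u' v'. primal_feasible M m g d (u', v') \<Longrightarrow> riesz u' f \<le> riesz u f"
    "\<And>p'. dual_feasible m g f d p' \<Longrightarrow> riesz y p \<le> riesz y p'"
    by (rule strong_duality; (rule that; assumption))
  show thesis
  proof (rule that[of u p])
    show "primal_optimal M m g f d (u, \<lambda>\<alpha>. y \<alpha> - u \<alpha>)"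
      using *(1,4) by (auto simp: primal_optimal_def is_arg_max_def primal_objective_def not_less)
    show "dual_optimal M m g f d p"
      using *(2,5) by (auto simp: dual_optimal_def is_arg_min_def objective not_less)
    show "primal_value M m g f d = ereal (riesz u f)"
      unfolding primal_value_def
    proof (rule antisym)
      show "(SUP w\<in>Collect (primal_feasible M m g d). ereal (primal_objective f w)) \<le> ereal (riesz u f)"
        using *(4) by (intro SUP_least) (auto simp: primal_objective_def)
      show "ereal (riesz u f) \<le> (SUP w\<in>Collect (primal_feasible M m g d). ereal (primal_objective f w))"
        using *(1) by (intro SUP_upper2[of "(u, \<lambda>\<alpha>. y \<alpha> - u \<alpha>)"]) (auto simp: primal_objective_def)
    qed
    show "dual_value M m g f d = ereal (riesz u f)"
      unfolding dual_value_def
    proof (rule antisym)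
      show "(INF p\<in>Collect (dual_feasible m g f d). ereal (dual_objective M p)) \<le> ereal (riesz u f)"
        using *(2,3) by (intro INF_lower2[of p]) (auto simp: objective)
      show "ereal (riesz u f) \<le> (INF p\<in>Collect (dual_feasible m g f d). ereal (dual_objective M p))"
        using *(3,5) by (intro INF_greatest) (auto simp: objective)
    qed
  qed
qed

end

lemma primal_feasible_antimono:
  assumes "primal_feasible M m g d' w" "d \<le> d'" "\<And>j. j \<in> {1..m} \<Longrightarrow> half_deg (g j) \<le> d"
  shows "primal_feasible M m g d w"
proof -
  have "mpolys_le (d - half_deg (g j)) \<subseteq> (mpolys_le (d' - half_deg (g j)) :: 'a mpoly set)" for j
    using assms(2) by (auto intro: mpolys_le_mono)
  moreover have "exps_le (2 * d) \<subseteq> (exps_le (2 * d') :: (nat ^ 'a) set)"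
    using assms(2) by (intro exps_le_mono) simp
  moreover have "mpolys_le d \<subseteq> (mpolys_le d' :: 'a mpoly set)"
    using assms(2) by (auto intro: mpolys_le_mono)
  ultimately show ?thesis
    using assms(1) unfolding primal_feasible_def psd_moment_iff psd_localizing_iff
    by (cases w) blast
qed


section \<open>Density of polynomials\<close>

lemma mpoly_eval_power: "mpoly_eval (p ^ n) x = mpoly_eval p x ^ n"
  by (induction n) (auto simp: mpoly_eval_mult)

text \<open>The rate \<open>c\<close> is a parameter because density is used for measures weighted
  by |\<phi> g|, where exponential moments are established for small rates.\<close>

locale polynomial_dense =
  fixes N :: "(real ^ 'n::finite) measure" and c :: real
  assumes sets_N [measurable_cong]: "sets N = sets borel"
    and c: "0 < c"
    and finite_moments: "\<And>p. (\<integral>\<^sup>+x. ennreal ((mpoly_eval p x)\<^sup>2 * exp (c * norm x)) \<partial>N) < \<infinity>"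
begin

text \<open>Values in \<open>ennreal\<close> keep integrability conditions out of the approximation
  arguments.\<close>

definition dist2 :: "(real ^ 'n \<Rightarrow> real) \<Rightarrow> (real ^ 'n \<Rightarrow> real) \<Rightarrow> ennreal" where
  "dist2 f h = (\<integral>\<^sup>+x. ennreal ((f x - h x)\<^sup>2) \<partial>N)"

definition approximable :: "(real ^ 'n \<Rightarrow> real) \<Rightarrow> bool" where
  "approximable f \<longleftrightarrow> f \<in> borel_measurable borel \<and> (\<forall>e>0. \<exists>p. dist2 f (mpoly_eval p) < ennreal e)"

text \<open>Multiplication by such a function maps polynomials into their L^2 closure. Boundedness
  lets it act on the whole closure, which makes multipliers closed under products;
  \<open>approximable\<close> alone does not give this.\<close>

definition multiplier :: "(real ^ 'n \<Rightarrow> real) \<Rightarrow> bool" where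
  "multiplier h \<longleftrightarrow> h \<in> borel_measurable borel \<and> (\<exists>C. \<forall>x. \<bar>h x\<bar> \<le> C) \<and>
    (\<forall>p. approximable (\<lambda>x. h x * mpoly_eval p x))"

text \<open>The squared distance satisfies the triangle inequality only up to a factor 2, hence the
  e / 4 in the arguments below.\<close>

lemma dist2_triangle:
  assumes [measurable]: "f \<in> borel_measurable borel" "h \<in> borel_measurable borel" "k \<in> borel_measurable borel"
  shows "dist2 f k \<le> 2 * dist2 f h + 2 * dist2 h k"
proof -
  have "dist2 f k \<le> (\<integral>\<^sup>+x. 2 * ennreal ((f x - h x)\<^sup>2) + 2 * ennreal ((h x - k x)\<^sup>2) \<partial>N)"
    unfolding dist2_def
  proof (rule nn_integral_mono)
    fix x
    have "0 \<le> ((f x - h x) - (h x - k x))\<^sup>2" by simp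
    then have "(f x - k x)\<^sup>2 \<le> 2 * (f x - h x)\<^sup>2 + 2 * (h x - k x)\<^sup>2"
      by (simp add: power2_eq_square algebra_simps)
    then have "ennreal ((f x - k x)\<^sup>2) \<le> ennreal (2 * (f x - h x)\<^sup>2 + 2 * (h x - k x)\<^sup>2)"
      by (rule ennreal_leI)
    then show "ennreal ((f x - k x)\<^sup>2) \<le> 2 * ennreal ((f x - h x)\<^sup>2) + 2 * ennreal ((h x - k x)\<^sup>2)"
      by (simp add: ennreal_plus ennreal_mult)
  qed
  also have "\<dots> = 2 * dist2 f h + 2 * dist2 h k"
    unfolding dist2_def by (simp add: nn_integral_add nn_integral_cmult)
  finally show ?thesis .
qed

lemma approximable_closed:
  assumes f: "f \<in> borel_measurable borel"
    and "\<And>e. e > 0 \<Longrightarrow> \<exists>h. approximable h \<and> dist2 f h < ennreal e"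
  shows "approximable f"
  unfolding approximable_def
proof (intro conjI allI impI f)
  fix e :: real assume e: "e > 0"
  obtain h where h: "approximable h" "dist2 f h < ennreal (e / 4)"
    using assms(2)[of "e / 4"] e by auto
  then obtain p where p: "dist2 h (mpoly_eval p) < ennreal (e / 4)"
    using e by (auto simp: approximable_def dest: spec[of _ "e / 4"])
  have "dist2 f (mpoly_eval p) \<le> 2 * dist2 f h + 2 * dist2 h (mpoly_eval p)"
    using f h(1) by (intro dist2_triangle) (auto simp: approximable_def)
  also have "\<dots> < 2 * ennreal (e / 4) + 2 * ennreal (e / 4)"
    using h(2) p by (intro add_strict_mono ennreal_mult_strict_left_mono) auto
  also have "\<dots> = ennreal (2 * (e / 4) + 2 * (e / 4))"
    using e by (simp only: ennreal_plus ennreal_mult ennreal_numeral divide_nonneg_nonneg less_imp_le zero_le_numeral mult_nonneg_nonneg)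
  finally show "\<exists>p. dist2 f (mpoly_eval p) < ennreal e" by auto
qed

lemma approximable_sequence:
  assumes [measurable]: "f \<in> borel_measurable borel" and h: "\<And>n. approximable (h n)"
    and lim: "(\<lambda>n. dist2 f (h n)) \<longlonglongrightarrow> 0"
  shows "approximable f"
proof (rule approximable_closed[OF assms(1)])
  fix e :: real assume "e > 0"
  then have "eventually (\<lambda>n. dist2 f (h n) < ennreal e) sequentially"
    using lim by (intro order_tendstoD(2)) auto
  then obtain n where "dist2 f (h n) < ennreal e" by (auto simp: eventually_sequentially)
  then show "\<exists>h. approximable h \<and> dist2 f h < ennreal e" using h by blast
qed

lemma approximable_poly: "approximable (mpoly_eval p)"
  unfolding approximable_def by (auto simp: dist2_def intro!: exI[of _ p])

lemma approximable_add:
  assumes "approximable f" "approximable h"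
  shows "approximable (\<lambda>x. f x + h x)"
  unfolding approximable_def
proof (intro conjI allI impI)
  show [measurable]: "(\<lambda>x. f x + h x) \<in> borel_measurable borel"
    using assms by (auto simp: approximable_def)
  have [measurable]: "f \<in> borel_measurable borel" "h \<in> borel_measurable borel"
    using assms by (auto simp: approximable_def)
  fix e :: real assume e: "e > 0"
  obtain p q where p: "dist2 f (mpoly_eval p) < ennreal (e / 4)" and q: "dist2 h (mpoly_eval q) < ennreal (e / 4)"
    using assms e by (meson approximable_def divide_pos_pos zero_less_numeral)
  have "dist2 (\<lambda>x. f x + h x) (mpoly_eval (p + q)) \<le>
      2 * dist2 (\<lambda>x. f x + h x) (\<lambda>x. mpoly_eval p x + h x) + 2 * dist2 (\<lambda>x. mpoly_eval p x + h x) (mpoly_eval (p + q))"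
    by (intro dist2_triangle) measurable
  also have "\<dots> = 2 * dist2 f (mpoly_eval p) + 2 * dist2 h (mpoly_eval q)"
    by (simp add: dist2_def mpoly_eval_add)
  also have "\<dots> < 2 * ennreal (e / 4) + 2 * ennreal (e / 4)"
    using p q by (intro add_strict_mono ennreal_mult_strict_left_mono) auto
  also have "\<dots> = ennreal (2 * (e / 4) + 2 * (e / 4))"
    using e by (simp only: ennreal_plus ennreal_mult ennreal_numeral divide_nonneg_nonneg less_imp_le zero_le_numeral mult_nonneg_nonneg)
  finally show "\<exists>p. dist2 (\<lambda>x. f x + h x) (mpoly_eval p) < ennreal e" by auto
qed

lemma approximable_multiplier:
  assumes h: "multiplier h" and f: "approximable f"
  shows "approximable (\<lambda>x. h x * f x)"
proof -
  have [measurable]: "f \<in> borel_measurable borel" "h \<in> borel_measurable borel"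
    using assms by (auto simp: approximable_def multiplier_def)
  obtain C where C: "\<And>x. \<bar>h x\<bar> \<le> C" using h by (auto simp: multiplier_def)
  show ?thesis
  proof (rule approximable_closed)
    fix e :: real assume e: "e > 0"
    define e' where "e' = e / (C\<^sup>2 + 1)"
    have C1: "C\<^sup>2 + 1 > 0" by (intro add_nonneg_pos) auto
    have e': "e' > 0" using e C1 by (simp add: e'_def)
    then obtain p where p: "dist2 f (mpoly_eval p) < ennreal e'"
      using f unfolding approximable_def by blast
    have "dist2 (\<lambda>x. h x * f x) (\<lambda>x. h x * mpoly_eval p x) \<le> (\<integral>\<^sup>+x. ennreal (C\<^sup>2) * ennreal ((f x - mpoly_eval p x)\<^sup>2) \<partial>N)"
      unfolding dist2_def
    proof (rule nn_integral_mono)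
      fix x
      have "(h x * f x - h x * mpoly_eval p x)\<^sup>2 = \<bar>h x\<bar>\<^sup>2 * (f x - mpoly_eval p x)\<^sup>2"
        by (simp add: power2_eq_square algebra_simps)
      also have "\<dots> \<le> C\<^sup>2 * (f x - mpoly_eval p x)\<^sup>2"
        using C[of x] by (intro mult_right_mono power_mono) auto
      finally show "ennreal ((h x * f x - h x * mpoly_eval p x)\<^sup>2) \<le> ennreal (C\<^sup>2) * ennreal ((f x - mpoly_eval p x)\<^sup>2)"
        by (simp add: ennreal_mult[symmetric] ennreal_leI)
    qed
    also have "\<dots> = ennreal (C\<^sup>2) * dist2 f (mpoly_eval p)"
      unfolding dist2_def by (rule nn_integral_cmult) measurable
    also have "\<dots> \<le> ennreal (C\<^sup>2) * ennreal e'"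
      using p by (intro mult_left_mono) auto
    also have "\<dots> = ennreal (C\<^sup>2 * e')" using e' by (simp add: ennreal_mult)
    also have "\<dots> < ennreal e"
    proof (rule ennreal_lessI[OF e])
      have "C\<^sup>2 * e < e * (C\<^sup>2 + 1)" using e by (simp add: algebra_simps)
      then show "C\<^sup>2 * e' < e" using C1 by (simp add: e'_def divide_less_eq)
    qed
    finally show "\<exists>k. approximable k \<and> dist2 (\<lambda>x. h x * f x) k < ennreal e"
      using h by (auto simp: multiplier_def)
  qed measurable
qed

lemma multiplier_const: "multiplier (\<lambda>_. a)"
proof -
  have "approximable (\<lambda>x. a * mpoly_eval p x)" for p
    using approximable_poly[of "const a * p"] by (simp add: mpoly_eval_mult[abs_def])
  then show ?thesis unfolding multiplier_def by (auto intro: exI[of _ "\<bar>a\<bar>"])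
qed

lemma multiplier_add:
  assumes "multiplier h" "multiplier k"
  shows "multiplier (\<lambda>x. h x + k x)"
proof -
  obtain C D where CD: "\<And>x. \<bar>h x\<bar> \<le> C" "\<And>x. \<bar>k x\<bar> \<le> D" using assms by (auto simp: multiplier_def)
  have "\<bar>h x + k x\<bar> \<le> C + D" for x using CD[of x] by linarith
  then show ?thesis
    using assms unfolding multiplier_def by (auto simp: distrib_right intro!: approximable_add)
qed

lemma multiplier_mult:
  assumes "multiplier h" "multiplier k"
  shows "multiplier (\<lambda>x. h x * k x)"
proof -
  obtain C D where CD: "\<And>x. \<bar>h x\<bar> \<le> C" "\<And>x. \<bar>k x\<bar> \<le> D" using assms by (auto simp: multiplier_def)
  have "0 \<le> C" using CD(1)[of 0] by linarith
  then have "\<bar>h x * k x\<bar> \<le> C * D" for x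
    unfolding abs_mult using CD[of x] by (intro mult_mono) auto
  moreover have "approximable (\<lambda>x. h x * k x * mpoly_eval p x)" for p
    using approximable_multiplier[OF assms(1), of "\<lambda>x. k x * mpoly_eval p x"] assms(2)
    by (simp add: multiplier_def mult.assoc)
  ultimately show ?thesis using assms unfolding multiplier_def by auto
qed

text \<open>Every majorant of this form is integrable by \<open>finite_moments\<close>, so pointwise
  convergence suffices.\<close>

lemma approximable_dominated:
  assumes [measurable]: "f \<in> borel_measurable borel" and h: "\<And>n. approximable (h n)"
    and lim: "\<And>x. (\<lambda>n. h n x) \<longlonglongrightarrow> f x"
    and bound: "\<And>n x. (f x - h n x)\<^sup>2 \<le> D * ((mpoly_eval p x)\<^sup>2 * exp (c * norm x))"
  shows "approximable f"
proof (rule approximable_sequence[OF assms(1) h])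
  have [measurable]: "h n \<in> borel_measurable borel" for n using h by (auto simp: approximable_def)
  have "(\<lambda>n. dist2 f (h n)) \<longlonglongrightarrow> (\<integral>\<^sup>+x. 0 \<partial>N)"
    unfolding dist2_def
  proof (rule nn_integral_dominated_convergence)
    show "(\<integral>\<^sup>+x. ennreal (\<bar>D\<bar> * ((mpoly_eval p x)\<^sup>2 * exp (c * norm x))) \<partial>N) < \<infinity>"
      using finite_moments[of p] by (simp add: ennreal_mult nn_integral_cmult ennreal_mult_less_top)
    show "AE x in N. ennreal ((f x - h n x)\<^sup>2) \<le> ennreal (\<bar>D\<bar> * ((mpoly_eval p x)\<^sup>2 * exp (c * norm x)))" for n
    proof (intro AE_I2 ennreal_leI)
      fix x
      have "D * ((mpoly_eval p x)\<^sup>2 * exp (c * norm x)) \<le> \<bar>D\<bar> * ((mpoly_eval p x)\<^sup>2 * exp (c * norm x))"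
        by (intro mult_right_mono) auto
      then show "(f x - h n x)\<^sup>2 \<le> \<bar>D\<bar> * ((mpoly_eval p x)\<^sup>2 * exp (c * norm x))"
        using bound[of x n] by linarith
    qed
    show "AE x in N. (\<lambda>n. ennreal ((f x - h n x)\<^sup>2)) \<longlonglongrightarrow> 0"
    proof (intro AE_I2)
      fix x
      have "(\<lambda>n. (f x - h n x)\<^sup>2) \<longlonglongrightarrow> (f x - f x)\<^sup>2" by (intro tendsto_intros lim)
      then have "(\<lambda>n. ennreal ((f x - h n x)\<^sup>2)) \<longlonglongrightarrow> ennreal ((f x - f x)\<^sup>2)" by (rule tendsto_ennrealI)
      then show "(\<lambda>n. ennreal ((f x - h n x)\<^sup>2)) \<longlonglongrightarrow> 0" by simp
    qed
  qed measurable
  then show "(\<lambda>n. dist2 f (h n)) \<longlonglongrightarrow> 0" by simp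
qed

lemma multiplier_limit:
  assumes h: "\<And>n. multiplier (h n)" and bound: "\<And>n x. \<bar>h n x\<bar> \<le> C" and lim: "\<And>x. (\<lambda>n. h n x) \<longlonglongrightarrow> f x"
  shows "multiplier f"
proof -
  have m: "h n \<in> borel_measurable borel" for n using h by (auto simp: multiplier_def)
  have f [measurable]: "f \<in> borel_measurable borel"
    by (rule borel_measurable_LIMSEQ_real[OF lim m])
  have fC: "\<bar>f x\<bar> \<le> C" for x
    using tendsto_rabs[OF lim[of x]] bound[of _ x] by (intro LIMSEQ_le_const2[of _ _ C]) auto
  have "approximable (\<lambda>x. f x * mpoly_eval p x)" for p
  proof (rule approximable_dominated[of _ "\<lambda>n x. h n x * mpoly_eval p x"])
    show "approximable (\<lambda>x. h n x * mpoly_eval p x)" for n using h by (auto simp: multiplier_def)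
    show "(\<lambda>n. h n x * mpoly_eval p x) \<longlonglongrightarrow> f x * mpoly_eval p x" for x by (intro tendsto_intros lim)
    show "(f x * mpoly_eval p x - h n x * mpoly_eval p x)\<^sup>2 \<le> (2 * C)\<^sup>2 * ((mpoly_eval p x)\<^sup>2 * exp (c * norm x))" for n x
    proof -
      have "\<bar>f x - h n x\<bar> \<le> 2 * C" using fC[of x] bound[of n x] by linarith
      then have "(f x - h n x)\<^sup>2 \<le> (2 * C)\<^sup>2" using power_mono[of "\<bar>f x - h n x\<bar>" "2 * C" 2] by simp
      moreover have "(mpoly_eval p x)\<^sup>2 \<le> (mpoly_eval p x)\<^sup>2 * exp (c * norm x)"
        using c by (simp add: mult_le_cancel_left1)
      ultimately have "(f x - h n x)\<^sup>2 * (mpoly_eval p x)\<^sup>2 \<le> (2 * C)\<^sup>2 * ((mpoly_eval p x)\<^sup>2 * exp (c * norm x))"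
        by (intro mult_mono) auto
      then show ?thesis by (simp add: power_mult_distrib flip: left_diff_distrib)
    qed
  qed measurable
  then show ?thesis unfolding multiplier_def using fC by auto
qed

text \<open>Partial sums of the sine series are polynomials in x_i bounded by exp |t x_i|. The
  squared error is therefore at most 4 exp(2 |t| |x|) times the squared polynomial factor, which is
  where 2 |t| \<le> c enters: exponential moments let the Taylor series converge in L^2.\<close>

lemma multiplier_sin:
  assumes t: "2 * \<bar>t\<bar> \<le> c"
  shows "multiplier (\<lambda>x. sin (t * x $ i))"
proof -
  define S where "S n = (\<Sum>k<n. const (sin_coeff k * t ^ k) * var i ^ k)" for n
  have S: "mpoly_eval (S n) x = (\<Sum>k<n. sin_coeff k * (t * x $ i) ^ k)" for n x
    by (simp add: S_def mpoly_eval_sum mpoly_eval_mult mpoly_eval_power power_mult_distrib mult_ac)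
  have bound: "\<bar>\<Sum>k<n. sin_coeff k * s ^ k\<bar> \<le> exp \<bar>s\<bar>" for n and s :: real
  proof -
    have "\<bar>\<Sum>k<n. sin_coeff k * s ^ k\<bar> \<le> (\<Sum>k<n. \<bar>s\<bar> ^ k /\<^sub>R fact k)"
    proof (rule order_trans[OF sum_abs], rule sum_mono)
      fix k
      have "\<bar>sin_coeff k\<bar> \<le> inverse (fact k)" by (auto simp: sin_coeff_def inverse_eq_divide)
      then have "\<bar>sin_coeff k\<bar> * \<bar>s\<bar> ^ k \<le> inverse (fact k) * \<bar>s\<bar> ^ k" by (intro mult_right_mono) auto
      then show "\<bar>sin_coeff k * s ^ k\<bar> \<le> \<bar>s\<bar> ^ k /\<^sub>R fact k" by (simp add: abs_mult power_abs)
    qed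
    also have "\<dots> \<le> suminf (\<lambda>k. \<bar>s\<bar> ^ k /\<^sub>R fact k)"
      by (rule sum_le_suminf[OF summable_exp_generic]) auto
    also have "\<dots> = exp \<bar>s\<bar>" by (simp add: exp_def)
    finally show ?thesis .
  qed
  have "approximable (\<lambda>x. sin (t * x $ i) * mpoly_eval p x)" for p
  proof (rule approximable_dominated[of _ "\<lambda>n. mpoly_eval (S n * p)"])
    show "approximable (mpoly_eval (S n * p))" for n by (rule approximable_poly)
    show "(\<lambda>n. mpoly_eval (S n * p) x) \<longlonglongrightarrow> sin (t * x $ i) * mpoly_eval p x" for x
      unfolding mpoly_eval_mult S using sin_converges[of "t * x $ i"]
      by (intro tendsto_intros) (simp add: sums_def)
    show "(sin (t * x $ i) * mpoly_eval p x - mpoly_eval (S n * p) x)\<^sup>2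
        \<le> 4 * ((mpoly_eval p x)\<^sup>2 * exp (c * norm x))" for n x
    proof -
      have "\<bar>t * x $ i\<bar> \<le> \<bar>t\<bar> * norm x"
        unfolding abs_mult by (intro mult_left_mono component_le_norm_cart) auto
      moreover have "2 * \<bar>t\<bar> * norm x \<le> c * norm x" using t by (intro mult_right_mono) auto
      ultimately have e: "exp (2 * \<bar>t * x $ i\<bar>) \<le> exp (c * norm x)" by simp
      have "\<bar>sin (t * x $ i)\<bar> \<le> exp \<bar>t * x $ i\<bar>"
        using abs_sin_le_one[of "t * x $ i"] one_le_exp_iff[of "\<bar>t * x $ i\<bar>"] by linarith
      then have "\<bar>sin (t * x $ i) - mpoly_eval (S n) x\<bar> \<le> 2 * exp \<bar>t * x $ i\<bar>"
        using bound[of "t * x $ i" n] unfolding S by linarith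
      then have "(sin (t * x $ i) - mpoly_eval (S n) x)\<^sup>2 \<le> (2 * exp \<bar>t * x $ i\<bar>)\<^sup>2"
        using power_mono[of "\<bar>sin (t * x $ i) - mpoly_eval (S n) x\<bar>" "2 * exp \<bar>t * x $ i\<bar>" 2] by simp
      also have "\<dots> = 4 * exp (2 * \<bar>t * x $ i\<bar>)"
        by (simp add: power_mult_distrib exp_double)
      also have "\<dots> \<le> 4 * exp (c * norm x)" using e by simp
      finally have "(sin (t * x $ i) - mpoly_eval (S n) x)\<^sup>2 * (mpoly_eval p x)\<^sup>2 \<le> 4 * exp (c * norm x) * (mpoly_eval p x)\<^sup>2"
        by (intro mult_right_mono) auto
      then show ?thesis
        unfolding mpoly_eval_mult left_diff_distrib[symmetric] power_mult_distrib by (simp add: mult_ac)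
    qed
  qed measurable
  then show ?thesis unfolding multiplier_def by (auto intro!: exI[of _ 1])
qed

end


context polynomial_dense
begin

lemma multiplier_polynomial_compose:
  assumes h: "multiplier h" and g: "real_polynomial_function (g :: real \<Rightarrow> real)"
  shows "multiplier (\<lambda>x. g (h x))"
  using g
proof induction
  case (linear g)
  have "g (h x) = g 1 * h x" for x
  proof -
    have "g (h x *\<^sub>R 1) = h x *\<^sub>R g 1" by (rule linear_scale) (rule bounded_linear.linear[OF linear])
    then show ?thesis by (simp add: mult.commute)
  qed
  then show ?case using multiplier_mult[OF multiplier_const h] by simp
qed (auto intro: multiplier_const multiplier_add multiplier_mult)

text \<open>Weierstrass approximation on an interval containing the range of \<open>h\<close>; the
  approximants are uniformly bounded there, so \<open>multiplier_limit\<close> applies.\<close>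

lemma multiplier_continuous_compose:
  assumes h: "multiplier h" and g: "continuous_on UNIV (g :: real \<Rightarrow> real)"
  shows "multiplier (\<lambda>x. g (h x))"
proof -
  obtain C where C: "\<And>x. \<bar>h x\<bar> \<le> C" using h by (auto simp: multiplier_def)
  have "\<exists>p. real_polynomial_function p \<and> (\<forall>s\<in>{-C..C}. \<bar>g s - p s\<bar> < 1 / real (Suc n))" for n
    using Stone_Weierstrass_real_polynomial_function[of "{-C..C}" g "1 / real (Suc n)"]
      continuous_on_subset[OF g subset_UNIV] by (metis compact_Icc of_nat_0_less_iff zero_less_Suc zero_less_divide_1_iff)
  then obtain p where p: "\<And>n. real_polynomial_function (p n)"
    "\<And>n s. s \<in> {-C..C} \<Longrightarrow> \<bar>g s - p n s\<bar> < 1 / real (Suc n)" by metis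
  have hC: "h x \<in> {-C..C}" for x using C[of x] by auto
  have "compact (g ` {-C..C})"
    by (intro compact_continuous_image continuous_on_subset[OF g]) auto
  then obtain D where D: "\<And>s. s \<in> {-C..C} \<Longrightarrow> \<bar>g s\<bar> \<le> D"
    using compact_imp_bounded[of "g ` {-C..C}"] unfolding bounded_iff by force
  show ?thesis
  proof (rule multiplier_limit)
    show "multiplier (\<lambda>x. p n (h x))" for n
      by (rule multiplier_polynomial_compose[OF h p(1)])
    show "\<bar>p n (h x)\<bar> \<le> D + 1" for n x
    proof -
      have "1 / real (Suc n) \<le> 1" by simp
      then show ?thesis using p(2)[OF hC[of x], of n] D[OF hC[of x]] by linarith
    qed
    show "(\<lambda>n. p n (h x)) \<longlonglongrightarrow> g (h x)" for x
    proof (rule Lim_null[THEN iffD2], rule Lim_null_comparison)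
      show "\<forall>\<^sub>F n in sequentially. norm (p n (h x) - g (h x)) \<le> 1 / real (Suc n)"
        using p(2)[OF hC[of x]] by (intro always_eventually allI) (simp add: abs_minus_commute less_imp_le)
      show "(\<lambda>n. 1 / real (Suc n)) \<longlonglongrightarrow> 0"
        using LIMSEQ_inverse_real_of_nat by (simp add: inverse_eq_divide)
    qed
  qed
qed

definition good_sets :: "(real ^ 'n) set set" where
  "good_sets = {A. multiplier (indicator A)}"

lemma good_sets_Compl: "A \<in> good_sets \<Longrightarrow> - A \<in> good_sets"
proof -
  assume "A \<in> good_sets"
  then have "multiplier (\<lambda>x. 1 + (-1) * indicator A x)"
    unfolding good_sets_def by (intro multiplier_add multiplier_mult multiplier_const) simp
  moreover have "(\<lambda>x. 1 + (-1) * indicator A x) = (indicator (- A) :: _ \<Rightarrow> real)"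
    by (auto simp: indicator_def)
  ultimately show ?thesis unfolding good_sets_def by simp
qed

lemma good_sets_Int: "A \<in> good_sets \<Longrightarrow> B \<in> good_sets \<Longrightarrow> A \<inter> B \<in> good_sets"
  unfolding good_sets_def by (simp add: indicator_inter_arith[abs_def] multiplier_mult)

lemma good_sets_empty: "{} \<in> good_sets"
  unfolding good_sets_def using multiplier_const[of 0] by (simp add: indicator_def[abs_def])

lemma good_sets_Un: "A \<in> good_sets \<Longrightarrow> B \<in> good_sets \<Longrightarrow> A \<union> B \<in> good_sets"
  using good_sets_Compl[of "- A \<inter> - B"] good_sets_Int[of "- A" "- B"] good_sets_Compl by simp

lemma good_sets_UN:
  assumes "\<And>i::nat. A i \<in> good_sets"
  shows "(\<Union>i. A i) \<in> good_sets"
proof -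
  have "(\<Union>i<n. A i) \<in> good_sets" for n
    by (induction n) (auto simp: good_sets_empty lessThan_Suc assms good_sets_Un)
  then have "multiplier (indicator (\<Union>i<n. A i))" for n by (simp add: good_sets_def)
  then have "multiplier (indicator (\<Union>i. A i))"
    by (rule multiplier_limit[where C = 1, OF _ _ LIMSEQ_indicator_UN]) (auto simp: indicator_def)
  then show ?thesis by (simp add: good_sets_def)
qed

lemma sigma_algebra_good_sets: "sigma_algebra UNIV good_sets"
  unfolding sigma_algebra_iff2
  using good_sets_empty good_sets_Compl
  by (auto simp: Compl_eq_Diff_UNIV[symmetric] intro!: good_sets_UN)

lemma good_sets_superlevel:
  assumes h: "multiplier h"
  shows "{x. a < h x} \<in> good_sets"
proof -
  \<comment> \<open>Continuous ramps whose pointwise limit is the indicator of the open half-line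
    above \<open>a\<close>.\<close>
  have "multiplier (\<lambda>x. min 1 (max 0 (real n * (h x - a))))" for n
    by (rule multiplier_continuous_compose[OF h, of "\<lambda>s. min 1 (max 0 (real n * (s - a)))"])
      (intro continuous_intros)
  then have "multiplier (indicator {x. a < h x})"
  proof (rule multiplier_limit[where C = 1])
    fix x
    show "(\<lambda>n. min 1 (max 0 (real n * (h x - a)))) \<longlonglongrightarrow> indicator {x. a < h x} x"
    proof (cases "a < h x")
      case True
      obtain m where m: "1 / (h x - a) < real m" using reals_Archimedean2 by blast
      have "min 1 (max 0 (real n * (h x - a))) = 1" if "n \<ge> m" for n
      proof -
        have "1 < real m * (h x - a)" using m True by (simp add: divide_less_eq)
        also have "\<dots> \<le> real n * (h x - a)" using that True by (intro mult_right_mono) auto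
        finally show ?thesis by simp
      qed
      then have "\<forall>\<^sub>F n in sequentially. min 1 (max 0 (real n * (h x - a))) = 1"
        by (auto simp: eventually_sequentially)
      then show ?thesis using True by (simp add: tendsto_eventually)
    next
      case False
      then have "real n * (h x - a) \<le> 0" for n by (intro mult_nonneg_nonpos) auto
      then have "min 1 (max 0 (real n * (h x - a))) = 0" for n
        by (simp add: max_absorb1)
      then show ?thesis using False by simp
    qed
  qed auto
  then show ?thesis by (simp add: good_sets_def)
qed

text \<open>The coordinates are limits of multiples of bounded multipliers \<open>sin (t x\<^sub>i)\<close>, hence measurable
  with respect to the \<open>\<sigma>\<close>-algebra of good sets.\<close>

lemma borel_good_sets: "sets (borel :: (real ^ 'n) measure) \<subseteq> good_sets"
proof -
  define S where "S = sigma (UNIV :: (real ^ 'n) set) good_sets"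
  have sets_S: "sets S = good_sets" and space_S: "space S = UNIV"
    unfolding S_def using sigma_algebra.sets_measure_of_eq[OF sigma_algebra_good_sets]
    by (auto simp: space_measure_of_conv)
  have mult_meas: "h \<in> borel_measurable S" if "multiplier h" for h
    unfolding borel_measurable_iff_greater using good_sets_superlevel[OF that]
    by (simp add: sets_S space_S)
  have coord: "(\<lambda>x. x $ i) \<in> borel_measurable S" for i
  proof (rule borel_measurable_LIMSEQ_real)
    \<comment> \<open>A null sequence within the range 2 |t| \<le> c allowed by
      \<open>multiplier_sin\<close>.\<close>
    define t where "t n = c / (2 * real (Suc n))" for n
    have t: "t n > 0" "2 * \<bar>t n\<bar> \<le> c" for n
      using c by (auto simp: t_def field_simps)
    show "(\<lambda>x. sin (t n * x $ i) / t n) \<in> borel_measurable S" for n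
      using mult_meas[OF multiplier_sin[OF t(2)[of n], of i]] by simp
    fix x :: "real ^ 'n"
    show "(\<lambda>n. sin (t n * x $ i) / t n) \<longlonglongrightarrow> x $ i"
    proof -
      have "((\<lambda>s. sin (s * x $ i)) has_real_derivative x $ i) (at 0)"
        by (auto intro!: derivative_eq_intros)
      then have "((\<lambda>s. (sin (s * x $ i) - sin (0 * x $ i)) / (s - 0)) \<longlongrightarrow> x $ i) (at 0)"
        by (simp add: has_field_derivative_iff)
      moreover have "filterlim t (at 0) sequentially"
      proof (rule filterlim_atI)
        have "(\<lambda>n. c / 2 * inverse (real (Suc n))) \<longlonglongrightarrow> c / 2 * 0"
          by (intro tendsto_intros LIMSEQ_inverse_real_of_nat)
        then show "t \<longlonglongrightarrow> 0" by (simp add: t_def[abs_def] inverse_eq_divide)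
        show "\<forall>\<^sub>F n in sequentially. t n \<noteq> 0" using t(1) by (intro always_eventually) (metis less_irrefl)
      qed
      ultimately have "(\<lambda>n. (sin (t n * x $ i) - sin (0 * x $ i)) / (t n - 0)) \<longlonglongrightarrow> x $ i"
        by (rule filterlim_compose)
      then show ?thesis by simp
    qed
  qed
  \<comment> \<open>Measurability of the identity from \<open>S\<close> to the Borel sets says that
    every Borel set is good.\<close>
  have "(\<lambda>x::real ^ 'n. x) \<in> borel_measurable S"
  proof (rule borel_measurable_euclidean_space[THEN iffD2, OF ballI])
    fix b :: "real ^ 'n" assume "b \<in> Basis"
    then obtain i where "b = axis i 1" by (auto simp: Basis_vec_def)
    then show "(\<lambda>x. x \<bullet> b) \<in> borel_measurable S"
      using coord[of i] by (simp add: inner_axis)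
  qed
  then have "(\<lambda>x. x) -` A \<inter> space S \<in> sets S" if "A \<in> sets borel" for A
    using that by (rule measurable_sets)
  then show ?thesis by (auto simp: sets_S space_S)
qed

theorem indicator_approximable:
  assumes "A \<in> sets borel" "e > 0"
  shows "\<exists>p. (\<integral>\<^sup>+x. ennreal ((indicator A x - mpoly_eval p x)\<^sup>2) \<partial>N) < ennreal e"
proof -
  have "multiplier (indicator A)" using borel_good_sets assms(1) by (auto simp: good_sets_def)
  then have "approximable (\<lambda>x. indicator A x * mpoly_eval 1 x)" unfolding multiplier_def by blast
  then show ?thesis using assms(2) by (simp add: approximable_def dist2_def)
qed

end


section \<open>Measures with exponentially decaying density\<close>

lemma power_le_exp:
  fixes x a :: real
  assumes "0 \<le> x" "0 < a"
  shows "x ^ n \<le> fact n / a ^ n * exp (a * x)"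
proof -
  have "(\<Sum>k\<in>{n}. (a * x) ^ k /\<^sub>R fact k) \<le> suminf (\<lambda>k. (a * x) ^ k /\<^sub>R fact k)"
    using assms by (intro sum_le_suminf summable_exp_generic) auto
  then have "(a * x) ^ n / fact n \<le> exp (a * x)" by (simp add: exp_def divide_inverse mult.commute)
  then show ?thesis using assms by (simp add: power_mult_distrib field_simps)
qed

text \<open>The space is exhausted by cubes \<open>B k\<close> of side 2 (k + 1). Where k \<le> |x|
  \<le> k + 1 the integrand is at most exp(- a k), so the integral is dominated by a series of
  polynomially growing volumes times a decaying exponential.\<close>

lemma nn_integral_exp_norm_finite:
  assumes a: "0 < a"
  shows "(\<integral>\<^sup>+x. ennreal (exp (- a * norm x)) \<partial>(lborel :: 'a::euclidean_space measure)) < \<infinity>"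
proof -
  define B where "B k = cbox (- real (Suc k) *\<^sub>R One) (real (Suc k) *\<^sub>R (One :: 'a))" for k
  define D where "D = DIM('a)"
  have B: "emeasure lborel (B k) = ennreal ((2 * real (Suc k)) ^ D)" for k
    unfolding B_def by (subst emeasure_lborel_cbox) (auto simp: D_def inner_diff_left)
  have "(\<integral>\<^sup>+x. ennreal (exp (- a * norm x)) \<partial>(lborel :: 'a measure))
      \<le> (\<integral>\<^sup>+x. suminf (\<lambda>k. ennreal (exp (- a * real k)) * indicator (B k) x) \<partial>(lborel :: 'a measure))"
  proof (rule nn_integral_mono)
    fix x :: 'a
    define k where "k = nat \<lfloor>norm x\<rfloor>"
    have k: "real k \<le> norm x" "norm x \<le> real (Suc k)"
      unfolding k_def by (simp_all add: of_nat_floor) linarith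
    have "x \<in> B k"
      unfolding B_def mem_box
    proof (intro ballI)
      fix b :: 'a assume b: "b \<in> Basis"
      then have "\<bar>x \<bullet> b\<bar> \<le> real (Suc k)" using Basis_le_norm[OF b, of x] k(2) by linarith
      then show "(- real (Suc k) *\<^sub>R One) \<bullet> b \<le> x \<bullet> b \<and> x \<bullet> b \<le> (real (Suc k) *\<^sub>R One) \<bullet> b"
        using b by (simp only: inner_scaleR_left inner_sum_left_Basis) auto
    qed
    then have "ennreal (exp (- a * norm x)) \<le> ennreal (exp (- a * real k)) * indicator (B k) x"
      using k(1) a by (simp add: ennreal_leI)
    also have "\<dots> \<le> suminf (\<lambda>k. ennreal (exp (- a * real k)) * indicator (B k) x)"
    proof -
      define F where "F k = ennreal (exp (- a * real k)) * indicator (B k) x" for k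
      have "sum F {k} \<le> suminf F" by (rule sum_le_suminf) auto
      then have "F k \<le> suminf F" by simp
      then show ?thesis unfolding F_def[abs_def] .
    qed
    finally show "ennreal (exp (- a * norm x)) \<le> suminf (\<lambda>k. ennreal (exp (- a * real k)) * indicator (B k) x)" .
  qed
  also have "\<dots> = suminf (\<lambda>k. \<integral>\<^sup>+x. ennreal (exp (- a * real k)) * indicator (B k) x \<partial>lborel)"
    by (rule nn_integral_suminf) (simp add: B_def)
  also have "\<dots> = suminf (\<lambda>k. ennreal (exp (- a * real k) * (2 * real (Suc k)) ^ D))"
  proof (rule suminf_cong)
    fix k
    have "(\<integral>\<^sup>+x. ennreal (exp (- a * real k)) * indicator (B k) x \<partial>lborel) = ennreal (exp (- a * real k)) * emeasure lborel (B k)"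
      by (subst nn_integral_cmult_indicator) (auto simp: B_def)
    then show "(\<integral>\<^sup>+x. ennreal (exp (- a * real k)) * indicator (B k) x \<partial>lborel) = ennreal (exp (- a * real k) * (2 * real (Suc k)) ^ D)"
      by (simp add: B ennreal_mult)
  qed
  also have "\<dots> < \<infinity>"
  proof -
    \<comment> \<open>\<open>power_le_exp\<close> at rate a / 4 bounds the volume by a constant
      times exp(a k / 2), leaving the decay exp(- a k / 2).\<close>
    define C where "C = fact D / (a / 4) ^ D * exp (a / 2)"
    have "summable (\<lambda>k. C * exp (- a / 2) ^ k)"
      using a by (intro summable_mult summable_geometric) simp
    moreover have "norm (exp (- a * real k) * (2 * real (Suc k)) ^ D) \<le> C * exp (- a / 2) ^ k" for k
    proof -
      have "(2 * real (Suc k)) ^ D \<le> fact D / (a / 4) ^ D * exp (a / 4 * (2 * real (Suc k)))"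
        using a by (intro power_le_exp) auto
      also have "\<dots> = C * exp (a / 2 * real k)"
        by (simp add: C_def mult.assoc flip: exp_add) (simp add: algebra_simps)
      finally have "exp (- a * real k) * (2 * real (Suc k)) ^ D \<le> exp (- a * real k) * (C * exp (a / 2 * real k))"
        by (intro mult_left_mono) auto
      also have "\<dots> = C * exp (- a * real k + a / 2 * real k)" by (simp only: exp_add mult_ac)
      also have "- a * real k + a / 2 * real k = real k * (- a / 2)" by (simp add: field_simps)
      also have "exp (real k * (- a / 2)) = exp (- a / 2) ^ k" by (rule exp_of_nat_mult)
      finally show ?thesis by simp
    qed
    ultimately have "summable (\<lambda>k. exp (- a * real k) * (2 * real (Suc k)) ^ D)"
      by (rule summable_comparison_test'[where N = 0]) 
    then have "suminf (\<lambda>k. ennreal (exp (- a * real k) * (2 * real (Suc k)) ^ D)) \<noteq> top"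
      by (intro ennreal_suminf_neq_top) auto
    then show ?thesis by (simp add: top.not_eq_extremum)
  qed
  finally show ?thesis .
qed

lemma abs_monom_eval_le: "\<bar>monom_eval \<alpha> x\<bar> \<le> norm x ^ exp_deg \<alpha>"
proof -
  have "\<bar>monom_eval \<alpha> x\<bar> = (\<Prod>i\<in>UNIV. \<bar>x $ i\<bar> ^ (\<alpha> $ i))"
    by (simp add: monom_eval_def abs_prod power_abs)
  also have "\<dots> \<le> (\<Prod>i\<in>UNIV. norm x ^ (\<alpha> $ i))"
    by (intro prod_mono conjI power_mono component_le_norm_cart) auto
  finally show ?thesis by (simp add: exp_deg_def power_sum)
qed

lemma mpoly_eval_le_exp:
  assumes a: "0 < a"
  shows "\<exists>B. \<forall>x. \<bar>mpoly_eval p x\<bar> \<le> B * exp (a * norm x)"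
proof (intro exI allI)
  fix x
  have "\<bar>mpoly_eval p x\<bar> \<le> (\<Sum>\<alpha>\<in>keys p. \<bar>lookup p \<alpha>\<bar> * \<bar>monom_eval \<alpha> x\<bar>)"
    unfolding mpoly_eval_def by (rule order_trans[OF sum_abs]) (simp add: abs_mult)
  also have "\<dots> \<le> (\<Sum>\<alpha>\<in>keys p. \<bar>lookup p \<alpha>\<bar> * (fact (exp_deg \<alpha>) / a ^ exp_deg \<alpha> * exp (a * norm x)))"
    using a by (intro sum_mono mult_left_mono order_trans[OF abs_monom_eval_le] power_le_exp) auto
  finally show "\<bar>mpoly_eval p x\<bar> \<le> (\<Sum>\<alpha>\<in>keys p. \<bar>lookup p \<alpha>\<bar> * (fact (exp_deg \<alpha>) / a ^ exp_deg \<alpha>)) * exp (a * norm x)"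
    by (simp add: sum_distrib_right mult.assoc)
qed

text \<open>The common feature of both measures: integrability and density of polynomials come from
  domination by exp(- |x|), so the two cases are separated only when the locale is
  instantiated.\<close>

locale decaying_density =
  fixes M :: "(real ^ 'n::finite) measure" and w :: "real ^ 'n \<Rightarrow> real" and C :: real
  assumes w_measurable [measurable]: "w \<in> borel_measurable borel"
    and w_nonneg: "\<And>x. 0 \<le> w x"
    and w_le: "\<And>x. w x \<le> C * exp (- norm x)"
    and M_eq: "M = density lborel (\<lambda>x. ennreal (w x))"
begin

lemma sets_M [measurable_cong, simp]: "sets M = sets borel"
  by (simp add: M_eq)

lemma space_M [simp]: "space M = UNIV"
  by (simp add: M_eq)

lemma C_nonneg: "0 \<le> C"
  using w_nonneg[of 0] w_le[of 0] by simp

lemma integrable_exp_bound: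
  assumes [measurable]: "h \<in> borel_measurable borel" and h: "\<And>x. \<bar>h x\<bar> \<le> B * exp (c * norm x)" and c: "c < 1"
  shows "integrable M h"
proof (rule integrableI_bounded)
  show "h \<in> borel_measurable M" by measurable
  have B: "0 \<le> B" using h[of 0] by simp
  have "(\<integral>\<^sup>+x. ennreal (norm (h x)) \<partial>M) = (\<integral>\<^sup>+x. ennreal (w x) * ennreal (norm (h x)) \<partial>lborel)"
    unfolding M_eq by (rule nn_integral_density) measurable
  also have "\<dots> \<le> (\<integral>\<^sup>+x. ennreal (B * C) * ennreal (exp (- (1 - c) * norm x)) \<partial>(lborel :: (real ^ 'n) measure))"
  proof (rule nn_integral_mono)
    fix x
    have "w x * norm (h x) \<le> (C * exp (- norm x)) * (B * exp (c * norm x))"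
      using h[of x] w_nonneg[of x] w_le[of x] C_nonneg by (intro mult_mono) auto
    also have "\<dots> = B * C * exp (- (1 - c) * norm x)"
      by (simp add: algebra_simps flip: exp_add)
    finally show "ennreal (w x) * ennreal (norm (h x)) \<le> ennreal (B * C) * ennreal (exp (- (1 - c) * norm x))"
      using B C_nonneg w_nonneg by (simp add: ennreal_leI flip: ennreal_mult)
  qed
  also have "\<dots> = ennreal (B * C) * (\<integral>\<^sup>+x. ennreal (exp (- (1 - c) * norm x)) \<partial>(lborel :: (real ^ 'n) measure))"
    by (rule nn_integral_cmult) measurable
  also have "\<dots> < \<infinity>"
    using nn_integral_exp_norm_finite[of "1 - c", where 'a = "real ^ 'n"] c
    by (simp add: ennreal_mult_less_top)
  finally show "(\<integral>\<^sup>+x. ennreal (norm (h x)) \<partial>M) < \<infinity>" .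
qed

lemma integrable_poly_exp:
  assumes "c < 1"
  shows "integrable M (\<lambda>x. mpoly_eval p x * exp (c * norm x))"
proof -
  \<comment> \<open>Half of the gap between c and 1 is spent on the polynomial; the resulting rate
    (1 + c) / 2 is still below 1.\<close>
  obtain B where B: "\<And>x. \<bar>mpoly_eval p x\<bar> \<le> B * exp ((1 - c) / 2 * norm x)"
    using mpoly_eval_le_exp[of "(1 - c) / 2" p] assms by auto
  show ?thesis
  proof (rule integrable_exp_bound[where c = "(1 + c) / 2" and B = B])
    fix x
    have "\<bar>mpoly_eval p x * exp (c * norm x)\<bar> \<le> B * exp ((1 - c) / 2 * norm x) * exp (c * norm x)"
      unfolding abs_mult using B[of x] by (intro mult_mono) auto
    also have "\<dots> = B * exp ((1 - c) / 2 * norm x + c * norm x)" by (simp add: exp_add)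
    also have "(1 - c) / 2 * norm x + c * norm x = (1 + c) / 2 * norm x" by (simp add: field_simps)
    finally show "\<bar>mpoly_eval p x * exp (c * norm x)\<bar> \<le> B * exp ((1 + c) / 2 * norm x)" .
  qed (use assms in auto)
qed

lemma integrable_poly [simp]: "integrable M (mpoly_eval p)"
  using integrable_poly_exp[of 0 p] by simp

lemma integrable_poly_square [simp]: "integrable M (\<lambda>x. (mpoly_eval p x)\<^sup>2)"
  using integrable_poly[of "p * p"] by (simp add: mpoly_eval_mult[abs_def] power2_eq_square)

lemma integrable_monom: "integrable M (monom_eval \<alpha>)"
  using integrable_poly[of "Poly_Mapping.single \<alpha> 1"] by (simp add: mpoly_eval_riesz[abs_def])

lemma riesz_integral:
  assumes "\<And>\<alpha>. integrable M (\<lambda>x. \<psi> x * monom_eval \<alpha> x)"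
  shows "riesz (\<lambda>\<alpha>. LINT x|M. \<psi> x * monom_eval \<alpha> x) p = (LINT x|M. \<psi> x * mpoly_eval p x)"
proof -
  have "(LINT x|M. \<psi> x * mpoly_eval p x) = (LINT x|M. (\<Sum>\<alpha>\<in>keys p. lookup p \<alpha> * (\<psi> x * monom_eval \<alpha> x)))"
    by (intro Bochner_Integration.integral_cong refl) (simp add: mpoly_eval_def sum_distrib_left mult_ac)
  also have "\<dots> = (\<Sum>\<alpha>\<in>keys p. lookup p \<alpha> * (LINT x|M. \<psi> x * monom_eval \<alpha> x))"
    using assms by (subst Bochner_Integration.integral_sum) auto
  finally show ?thesis by (simp add: riesz_def)
qed

lemma riesz_moment: "riesz (moment M) p = (LINT x|M. mpoly_eval p x)"
  using riesz_integral[of "\<lambda>_. 1" p] integrable_monom by (simp add: moment_def[abs_def])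

lemma integrable_product:
  fixes a b :: "real ^ 'n \<Rightarrow> real"
  assumes [measurable]: "a \<in> borel_measurable borel" "b \<in> borel_measurable borel"
    and "integrable M (\<lambda>x. (a x)\<^sup>2)" "integrable M (\<lambda>x. (b x)\<^sup>2)"
  shows "integrable M (\<lambda>x. a x * b x)"
proof (rule Bochner_Integration.integrable_bound)
  show "integrable M (\<lambda>x. (a x)\<^sup>2 + (b x)\<^sup>2)" using assms by simp
  show "AE x in M. norm (a x * b x) \<le> norm ((a x)\<^sup>2 + (b x)\<^sup>2)"
  proof (intro AE_I2)
    fix x
    have "0 \<le> (\<bar>a x\<bar> - \<bar>b x\<bar>)\<^sup>2" by simp
    then have "2 * (\<bar>a x\<bar> * \<bar>b x\<bar>) \<le> (a x)\<^sup>2 + (b x)\<^sup>2" by (simp add: power2_diff)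
    moreover have "0 \<le> \<bar>a x\<bar> * \<bar>b x\<bar>" by simp
    ultimately have "\<bar>a x\<bar> * \<bar>b x\<bar> \<le> (a x)\<^sup>2 + (b x)\<^sup>2" by linarith
    then show "norm (a x * b x) \<le> norm ((a x)\<^sup>2 + (b x)\<^sup>2)" by (simp add: abs_mult)
  qed
qed measurable

lemma integrable_square_add:
  fixes a b :: "real ^ 'n \<Rightarrow> real"
  assumes [measurable]: "a \<in> borel_measurable borel" "b \<in> borel_measurable borel"
    and "integrable M (\<lambda>x. (a x)\<^sup>2)" "integrable M (\<lambda>x. (b x)\<^sup>2)"
  shows "integrable M (\<lambda>x. (a x + b x)\<^sup>2)"
  using integrable_product[OF assms] assms(3,4) by (simp add: power2_sum mult.assoc)

text \<open>Approximate the indicator of \<open>{\<phi> g < 0}\<close> in \<open>L\<^sup>2(|\<phi> g| \<mu>)\<close> by polynomials \<open>p\<close> and use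
  \<open>p\<^sup>2 \<ge> 1/2 - (1 - p)\<^sup>2\<close>.\<close>

lemma AE_nonneg_if_tested_nonneg:
  assumes \<phi> [measurable]: "\<phi> \<in> borel_measurable borel" and sq: "integrable M (\<lambda>x. (\<phi> x)\<^sup>2)"
    and tested: "\<And>h. 0 \<le> (LINT x|M. \<phi> x * mpoly_eval (h * h * g) x)"
  shows "AE x in M. 0 \<le> \<phi> x * mpoly_eval g x"
proof -
  define \<psi> where "\<psi> x = \<phi> x * mpoly_eval g x" for x
  have [measurable]: "\<psi> \<in> borel_measurable borel" unfolding \<psi>_def by measurable
  \<comment> \<open>Squaring doubles the rate, so c \<le> 1/4 leaves 2 c \<le> 1/2, within reach of
    \<open>integrable_poly_exp\<close>.\<close>
  have int: "integrable M (\<lambda>x. \<psi> x * (mpoly_eval p x * exp (c * norm x)))" if "c \<le> 1/4" for p c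
  proof -
    have "integrable M (\<lambda>x. \<phi> x * (mpoly_eval (g * p) x * exp (c * norm x)))"
    proof (rule integrable_product[OF \<phi> _ sq])
      have "(\<lambda>x. (mpoly_eval (g * p) x * exp (c * norm x))\<^sup>2) = (\<lambda>x. mpoly_eval ((g * p) * (g * p)) x * exp (2 * c * norm x))"
        by (auto simp: power_mult_distrib mpoly_eval_mult power2_eq_square mult_ac fun_eq_iff simp flip: exp_add)
      then show "integrable M (\<lambda>x. (mpoly_eval (g * p) x * exp (c * norm x))\<^sup>2)"
        using integrable_poly_exp[of "2 * c"] that by simp
    qed measurable
    then show ?thesis by (simp add: \<psi>_def mpoly_eval_mult mult_ac)
  qed
  \<comment> \<open>With this weight the squared L^2(N) error in approximating the indicator of
    \<open>A\<close> is the integral over \<open>M\<close> of |\<psi>| times the squared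
    error.\<close>
  define N where "N = density M (\<lambda>x. ennreal \<bar>\<psi> x\<bar>)"
  have nn_N: "(\<integral>\<^sup>+x. ennreal (h x) \<partial>N) = ennreal (LINT x|M. \<bar>\<psi> x\<bar> * h x)"
    if [measurable]: "h \<in> borel_measurable borel" and "\<And>x. 0 \<le> h x" "integrable M (\<lambda>x. \<bar>\<psi> x\<bar> * h x)" for h
  proof -
    have "(\<integral>\<^sup>+x. ennreal (h x) \<partial>N) = (\<integral>\<^sup>+x. ennreal \<bar>\<psi> x\<bar> * ennreal (h x) \<partial>M)"
      unfolding N_def by (rule nn_integral_density) measurable
    also have "\<dots> = (\<integral>\<^sup>+x. ennreal (\<bar>\<psi> x\<bar> * h x) \<partial>M)" using that(2) by (simp add: ennreal_mult)
    also have "\<dots> = ennreal (LINT x|M. \<bar>\<psi> x\<bar> * h x)"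
      using that by (intro nn_integral_eq_integral) auto
    finally show ?thesis .
  qed
  have int_abs: "integrable M (\<lambda>x. \<bar>\<psi> x\<bar> * ((mpoly_eval p x)\<^sup>2 * exp (c * norm x)))" if "c \<le> 1/4" for p c
    using integrable_abs[OF int[OF that, of "p * p"]]
    by (simp add: abs_mult mpoly_eval_mult power2_eq_square)
  interpret polynomial_dense N "1/4"
  proof
    show "(\<integral>\<^sup>+x. ennreal ((mpoly_eval p x)\<^sup>2 * exp (1/4 * norm x)) \<partial>N) < \<infinity>" for p
      using int_abs[of "1/4" p] by (subst nn_N) auto
  qed (auto simp: N_def)
  define A where "A = {x. \<psi> x < 0}"
  have [measurable]: "A \<in> sets borel" unfolding A_def by measurable
  define I where "I = (LINT x|M. \<bar>\<psi> x\<bar> * indicator A x)"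
  have int\<psi>: "integrable M \<psi>" using int[of 0 1] by simp
  have intI: "integrable M (\<lambda>x. \<bar>\<psi> x\<bar> * indicator A x)"
    by (intro integrable_mult_indicator[where A = A and f = "\<lambda>x. \<bar>\<psi> x\<bar>", simplified mult.commute real_scaleR_def] integrable_abs int\<psi>) auto
  have "I / 2 \<le> e" if e: "e > 0" for e
  proof -
    obtain p where p: "(\<integral>\<^sup>+x. ennreal ((indicator A x - mpoly_eval p x)\<^sup>2) \<partial>N) < ennreal e"
      using indicator_approximable[OF _ e, of A] by auto
    have i1: "integrable M (\<lambda>x. \<bar>\<psi> x\<bar> * (mpoly_eval p x)\<^sup>2)" using int_abs[of 0 p] by simp
    have i2: "integrable M (\<lambda>x. \<bar>\<psi> x\<bar> * (indicator A x - mpoly_eval p x)\<^sup>2)"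
    proof (rule Bochner_Integration.integrable_bound)
      show "integrable M (\<lambda>x. 2 * \<bar>\<psi> x\<bar> + 2 * (\<bar>\<psi> x\<bar> * (mpoly_eval p x)\<^sup>2))"
        using int\<psi> i1 by simp
      show "AE x in M. norm (\<bar>\<psi> x\<bar> * (indicator A x - mpoly_eval p x)\<^sup>2) \<le> norm (2 * \<bar>\<psi> x\<bar> + 2 * (\<bar>\<psi> x\<bar> * (mpoly_eval p x)\<^sup>2))"
      proof (intro AE_I2)
        fix x
        have "0 \<le> (indicator A x + mpoly_eval p x)\<^sup>2" by simp
        then have "(indicator A x - mpoly_eval p x)\<^sup>2 \<le> 2 * (indicator A x)\<^sup>2 + 2 * (mpoly_eval p x)\<^sup>2"
          by (simp add: power2_sum power2_diff)
        also have "\<dots> \<le> 2 + 2 * (mpoly_eval p x)\<^sup>2" by (simp add: indicator_def)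
        finally have "\<bar>\<psi> x\<bar> * (indicator A x - mpoly_eval p x)\<^sup>2 \<le> \<bar>\<psi> x\<bar> * (2 + 2 * (mpoly_eval p x)\<^sup>2)"
          by (intro mult_left_mono) auto
        then show "norm (\<bar>\<psi> x\<bar> * (indicator A x - mpoly_eval p x)\<^sup>2) \<le> norm (2 * \<bar>\<psi> x\<bar> + 2 * (\<bar>\<psi> x\<bar> * (mpoly_eval p x)\<^sup>2))"
          by (simp add: algebra_simps)
      qed
    qed measurable
    have "ennreal (LINT x|M. \<bar>\<psi> x\<bar> * (indicator A x - mpoly_eval p x)\<^sup>2) < ennreal e"
      using p i2 by (subst (asm) nn_N) auto
    then have small: "(LINT x|M. \<bar>\<psi> x\<bar> * (indicator A x - mpoly_eval p x)\<^sup>2) < e"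
      using e by (simp add: ennreal_less_iff integral_nonneg_AE)
    have "0 \<le> (LINT x|M. \<psi> x * (mpoly_eval p x)\<^sup>2)"
      using tested[of p] by (simp add: \<psi>_def mpoly_eval_mult power2_eq_square mult_ac)
    also have "\<dots> \<le> (LINT x|M. - (1/2) * (\<bar>\<psi> x\<bar> * indicator A x) + \<bar>\<psi> x\<bar> * (indicator A x - mpoly_eval p x)\<^sup>2)"
    proof (rule integral_mono)
      show "integrable M (\<lambda>x. \<psi> x * (mpoly_eval p x)\<^sup>2)"
        using int[of 0 "p * p"] by (simp add: mpoly_eval_mult power2_eq_square)
      show "integrable M (\<lambda>x. - (1/2) * (\<bar>\<psi> x\<bar> * indicator A x) + \<bar>\<psi> x\<bar> * (indicator A x - mpoly_eval p x)\<^sup>2)"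
        using intI i2 by (intro Bochner_Integration.integrable_add integrable_mult_right)
      \<comment> \<open>On \<open>A\<close>, \<psi> = - |\<psi>| and the square inequality supplies
        the term with 1/2; off \<open>A\<close>, \<psi> = |\<psi>| and both sides agree.\<close>
      show "\<psi> x * (mpoly_eval p x)\<^sup>2 \<le> - (1/2) * (\<bar>\<psi> x\<bar> * indicator A x) + \<bar>\<psi> x\<bar> * (indicator A x - mpoly_eval p x)\<^sup>2" for x
      proof (cases "x \<in> A")
        case True
        define t where "t = mpoly_eval p x"
        have "0 \<le> 1/2 * (2 * t - 1)\<^sup>2" by simp
        then have "1/2 \<le> t\<^sup>2 + (1 - t)\<^sup>2" by (simp add: power2_eq_square algebra_simps)
        then have "\<bar>\<psi> x\<bar> * (1/2) \<le> \<bar>\<psi> x\<bar> * (t\<^sup>2 + (1 - t)\<^sup>2)" by (intro mult_left_mono) auto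
        moreover have "\<bar>\<psi> x\<bar> = - \<psi> x" using True by (simp add: A_def)
        ultimately show ?thesis using True by (simp add: t_def algebra_simps)
      next
        case False
        then show ?thesis by (simp add: A_def)
      qed
    qed
    also have "\<dots> = - (1/2) * I + (LINT x|M. \<bar>\<psi> x\<bar> * (indicator A x - mpoly_eval p x)\<^sup>2)"
      unfolding I_def using intI i2 by (subst Bochner_Integration.integral_add) auto
    finally show ?thesis using small by linarith
  qed
  then have "I / 2 \<le> 0" by (rule field_le_epsilon[of _ 0, simplified])
  moreover have "0 \<le> I" unfolding I_def by (intro integral_nonneg_AE) auto
  ultimately have "I = 0" by simp
  then have "AE x in M. \<bar>\<psi> x\<bar> * indicator A x = 0"
    unfolding I_def using intI by (subst (asm) integral_nonneg_eq_0_iff_AE) auto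
  then show ?thesis
    by eventually_elim (auto simp: A_def \<psi>_def indicator_def not_less split: if_splits)
qed

end


text \<open>A Young inequality with free scale \<open>s\<close>, in place of Cauchy-Schwarz. Below,
  \<open>s = 2 ^ n\<close> balances an error of order (1/4)^n against a fixed square: both terms
  become of order (1/2)^n.\<close>

lemma abs_le_scaled_squares:
  fixes s a b :: real
  assumes "0 < s"
  shows "\<bar>a * b\<bar> \<le> s * a\<^sup>2 + (1 / s) * b\<^sup>2"
proof -
  have "0 \<le> (1 / s) * (s * \<bar>a\<bar> - \<bar>b\<bar>)\<^sup>2" using assms by simp
  also have "\<dots> = s * a\<^sup>2 + (1 / s) * b\<^sup>2 - 2 * (\<bar>a\<bar> * \<bar>b\<bar>)"
    using assms by (simp add: power2_diff power_mult_distrib field_simps power2_eq_square)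
  finally have "2 * (\<bar>a\<bar> * \<bar>b\<bar>) \<le> s * a\<^sup>2 + (1 / s) * b\<^sup>2" by simp
  moreover have "0 \<le> \<bar>a\<bar> * \<bar>b\<bar>" by simp
  ultimately have "\<bar>a\<bar> * \<bar>b\<bar> \<le> s * a\<^sup>2 + (1 / s) * b\<^sup>2" by linarith
  then show ?thesis by (simp add: abs_mult)
qed

section \<open>L^2 limits and the representation of dominated functionals\<close>

context decaying_density
begin

text \<open>The geometric rate makes successive differences summable in L^1, hence the sequence
  converges almost everywhere, and Fatou's lemma bounds the distance to the limit.\<close>

lemma L2_fast_Cauchy_limit:
  fixes P :: "nat \<Rightarrow> real ^ 'n \<Rightarrow> real"
  assumes [measurable]: "\<And>n. P n \<in> borel_measurable borel"
    and sq: "\<And>n. integrable M (\<lambda>x. (P n x)\<^sup>2)"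
    and cauchy: "\<And>i j n. n \<le> i \<Longrightarrow> n \<le> j \<Longrightarrow> (LINT x|M. (P i x - P j x)\<^sup>2) \<le> 4 * (1/4) ^ n"
  obtains \<phi> where "\<phi> \<in> borel_measurable borel" "\<And>n. integrable M (\<lambda>x. (\<phi> x - P n x)\<^sup>2)"
    "\<And>n. (LINT x|M. (\<phi> x - P n x)\<^sup>2) \<le> 4 * (1/4) ^ n"
proof -
  \<comment> \<open>Where the sequence diverges, \<open>lim\<close> is some unspecified value;
    \<open>conv\<close> below shows that this happens on a null set only.\<close>
  define \<phi> where "\<phi> x = lim (\<lambda>n. P n x)" for x
  have \<phi> [measurable]: "\<phi> \<in> borel_measurable borel"
    unfolding \<phi>_def by (rule borel_measurable_lim_metric) measurable
  have intd: "integrable M (\<lambda>x. (P i x - P j x)\<^sup>2)" for i j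
    using integrable_square_add[of "P i" "\<lambda>x. - P j x"] sq by simp
  have "mpoly_eval 1 = (\<lambda>_::real ^ 'n. 1)" by auto
  then have "integrable M (\<lambda>_. 1 :: real)" using integrable_poly[of 1] by simp
  then have one: "integrable M (\<lambda>_. c)" for c :: real
    using integrable_mult_right[of c M "\<lambda>_. 1"] by simp
  define D where "D n x = P (Suc n) x - P n x" for n x
  have Dm [measurable]: "D n \<in> borel_measurable borel" for n unfolding D_def by measurable
  define K where "K = 4 + (LINT x|M. (1::real))"
  have intD: "integrable M (D n)" for n
    using integrable_product[of "D n" "\<lambda>_. 1"] intd[of "Suc n" n] one by (simp add: D_def[abs_def])
  have D_le: "(LINT x|M. \<bar>D n x\<bar>) \<le> K * (1/2) ^ n" for n
  proof -
    have "(LINT x|M. \<bar>D n x\<bar>) \<le> (LINT x|M. 2 ^ n * (D n x)\<^sup>2 + (1/2) ^ n * 1)"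
    proof (rule integral_mono)
      show "integrable M (\<lambda>x. \<bar>D n x\<bar>)" using intD by simp
      show "integrable M (\<lambda>x. 2 ^ n * (D n x)\<^sup>2 + (1/2) ^ n * 1)"
        using intd[of "Suc n" n] one by (intro Bochner_Integration.integrable_add integrable_mult_right) (auto simp: D_def)
      show "\<bar>D n x\<bar> \<le> 2 ^ n * (D n x)\<^sup>2 + (1/2) ^ n * 1" for x
        using abs_le_scaled_squares[of "2 ^ n" "D n x" 1] by (simp add: power_divide)
    qed
    also have "\<dots> = 2 ^ n * (LINT x|M. (D n x)\<^sup>2) + (1/2) ^ n * (LINT x|M. (1::real))"
      using intd[of "Suc n" n] one by (subst Bochner_Integration.integral_add) (auto simp: D_def)
    also have "\<dots> \<le> 2 ^ n * (4 * (1/4) ^ n) + (1/2) ^ n * (LINT x|M. (1::real))"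
      using cauchy[of n "Suc n" n] by (intro add_mono mult_left_mono) (auto simp: D_def)
    also have "(2::real) ^ n * (4 * (1/4) ^ n) = 4 * (1/2) ^ n"
    proof -
      have "(2::real) ^ n * (1/4) ^ n = (1/2) ^ n" by (simp flip: power_mult_distrib)
      then show ?thesis by simp
    qed
    finally show ?thesis by (simp add: K_def algebra_simps)
  qed
  have K: "0 \<le> K" unfolding K_def by simp
  have "(\<integral>\<^sup>+x. suminf (\<lambda>n. ennreal \<bar>D n x\<bar>) \<partial>M) = suminf (\<lambda>n. \<integral>\<^sup>+x. ennreal \<bar>D n x\<bar> \<partial>M)"
    by (rule nn_integral_suminf) measurable
  also have "\<dots> \<le> suminf (\<lambda>n. ennreal (K * (1/2) ^ n))"
  proof (rule suminf_le)
    fix n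
    have "(\<integral>\<^sup>+x. ennreal \<bar>D n x\<bar> \<partial>M) = ennreal (LINT x|M. \<bar>D n x\<bar>)"
      using intD by (intro nn_integral_eq_integral) auto
    then show "(\<integral>\<^sup>+x. ennreal \<bar>D n x\<bar> \<partial>M) \<le> ennreal (K * (1/2) ^ n)"
      using D_le[of n] by (simp add: ennreal_leI)
  qed auto
  also have "\<dots> < top"
    unfolding less_top[symmetric] using K by (intro ennreal_suminf_neq_top summable_mult summable_geometric) auto
  finally have "(\<integral>\<^sup>+x. suminf (\<lambda>n. ennreal \<bar>D n x\<bar>) \<partial>M) \<noteq> \<infinity>"
    by (simp add: top.not_eq_extremum)
  then have "AE x in M. suminf (\<lambda>n. ennreal \<bar>D n x\<bar>) \<noteq> \<infinity>"
    by (intro nn_integral_noteq_infinite) measurable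
  then have conv: "AE x in M. (\<lambda>n. P n x) \<longlonglongrightarrow> \<phi> x"
  proof eventually_elim
    fix x assume "suminf (\<lambda>n. ennreal \<bar>D n x\<bar>) \<noteq> \<infinity>"
    then have "summable (\<lambda>n. \<bar>D n x\<bar>)" by (intro summable_suminf_not_top) auto
    then have "summable (\<lambda>n. D n x)" by (rule summable_rabs_cancel)
    then have "convergent (\<lambda>n. \<Sum>k<n. D k x)" by (simp add: summable_iff_convergent)
    then have "convergent (\<lambda>n. P 0 x + (\<Sum>k<n. D k x))" by (simp add: convergent_add_const_iff)
    moreover have "P 0 x + (\<Sum>k<n. D k x) = P n x" for n
      unfolding D_def by (simp add: sum_lessThan_telescope[of "\<lambda>k. P k x"])
    ultimately have "convergent (\<lambda>n. P n x)" by simp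
    then show "(\<lambda>n. P n x) \<longlonglongrightarrow> \<phi> x" by (simp add: convergent_LIMSEQ_iff \<phi>_def)
  qed
  have fatou: "(\<integral>\<^sup>+x. ennreal ((\<phi> x - P n x)\<^sup>2) \<partial>M) \<le> ennreal (4 * (1/4) ^ n)" for n
  proof -
    have "(\<integral>\<^sup>+x. ennreal ((\<phi> x - P n x)\<^sup>2) \<partial>M) = (\<integral>\<^sup>+x. liminf (\<lambda>i. ennreal ((P i x - P n x)\<^sup>2)) \<partial>M)"
    proof (rule nn_integral_cong_AE)
      show "AE x in M. ennreal ((\<phi> x - P n x)\<^sup>2) = liminf (\<lambda>i. ennreal ((P i x - P n x)\<^sup>2))"
        using conv
      proof eventually_elim
        fix x assume "(\<lambda>n. P n x) \<longlonglongrightarrow> \<phi> x"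
        then have "(\<lambda>i. ennreal ((P i x - P n x)\<^sup>2)) \<longlonglongrightarrow> ennreal ((\<phi> x - P n x)\<^sup>2)"
          by (intro tendsto_ennrealI tendsto_intros)
        then show "ennreal ((\<phi> x - P n x)\<^sup>2) = liminf (\<lambda>i. ennreal ((P i x - P n x)\<^sup>2))"
          by (intro lim_imp_Liminf[symmetric]) auto
      qed
    qed
    also have "\<dots> \<le> liminf (\<lambda>i. \<integral>\<^sup>+x. ennreal ((P i x - P n x)\<^sup>2) \<partial>M)"
      by (rule nn_integral_liminf) measurable
    also have "\<dots> \<le> limsup (\<lambda>i. \<integral>\<^sup>+x. ennreal ((P i x - P n x)\<^sup>2) \<partial>M)"
      by (rule Liminf_le_Limsup) simp
    also have "\<dots> \<le> ennreal (4 * (1/4) ^ n)"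
    proof (rule Limsup_bounded)
      show "\<forall>\<^sub>F i in sequentially. (\<integral>\<^sup>+x. ennreal ((P i x - P n x)\<^sup>2) \<partial>M) \<le> ennreal (4 * (1/4) ^ n)"
        using eventually_ge_at_top[of n]
      proof eventually_elim
        fix i assume "n \<le> i"
        then show "(\<integral>\<^sup>+x. ennreal ((P i x - P n x)\<^sup>2) \<partial>M) \<le> ennreal (4 * (1/4) ^ n)"
          using intd[of i n] cauchy[of n i n] by (subst nn_integral_eq_integral) (auto intro: ennreal_leI)
      qed
    qed
    finally show ?thesis .
  qed
  have int: "integrable M (\<lambda>x. (\<phi> x - P n x)\<^sup>2)" for n
    using le_less_trans[OF fatou[of n] ennreal_less_top] by (intro integrableI_nonneg) auto
  have "(LINT x|M. (\<phi> x - P n x)\<^sup>2) \<le> 4 * (1/4) ^ n" for n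
    using fatou[of n] int[of n] by (subst (asm) nn_integral_eq_integral) auto
  then show thesis using that[OF \<phi> int] by blast
qed

text \<open>\<open>\<phi>\<close> is the \<open>L\<^sup>2\<close> limit of a minimising sequence of \<open>p \<mapsto> \<integral> p\<^sup>2 d\<mu> - 2 u(p)\<close>.\<close>

lemma riesz_representation:
  assumes nonneg: "\<And>h. 0 \<le> riesz u (h * h)" and le: "\<And>h. riesz u (h * h) \<le> riesz (moment M) (h * h)"
  obtains \<phi> where "\<phi> \<in> borel_measurable borel" "integrable M (\<lambda>x. (\<phi> x)\<^sup>2)"
    "\<And>p. (LINT x|M. \<phi> x * mpoly_eval p x) = riesz u p"
proof -
  define E where "E = riesz (moment M)"
  define F where "F p = E (p * p) - 2 * riesz u p" for p
  have E_scale: "E (const c * p) = c * E p" for c p by (simp add: E_def riesz_const_mult)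
  have E_add: "E (p + q) = E p + E q" for p q by (simp add: E_def riesz_add)
  \<comment> \<open>Nonnegativity of \<open>u\<close> at (p - 1)^2 bounds 2 u(p) by u(p^2) + u(1),
    and u(p^2) is dominated by \<open>E (p * p)\<close>.\<close>
  have "- riesz u 1 \<le> F p" for p
  proof -
    have two: "(2 :: 'n mpoly) = const 2" by simp
    have "(p - 1) * (p - 1) = p * p - const 2 * p + 1"
      unfolding two[symmetric] by (simp add: algebra_simps)
    then have "0 \<le> riesz u (p * p) - 2 * riesz u p + riesz u 1"
      using nonneg[of "p - 1"] by (simp only: riesz_add riesz_diff riesz_const_mult)
    then show ?thesis using le[of p] by (simp add: F_def E_def)
  qed
  then have bdd: "bdd_below (range F)" by (intro bdd_belowI) auto
  define m where "m = Inf (range F)"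
  have m: "m \<le> F p" for p unfolding m_def by (intro cInf_lower bdd) auto
  have "\<exists>p. F p < m + (1/4) ^ n" for n
    using cInf_lessD[of "range F" "m + (1/4) ^ n"] by (auto simp: m_def)
  then obtain p where p: "\<And>n. F (p n) < m + (1/4) ^ n" by metis
  have E_int: "E q = (LINT x|M. mpoly_eval q x)" for q by (simp add: E_def riesz_moment)
  have expand: "F (a + const t * q) = F a + 2 * t * (E (a * q) - riesz u q) + t\<^sup>2 * E (q * q)" for a q t
  proof -
    have "(a + const t * q) * (a + const t * q) = a * a + const (2 * t) * (a * q) + const (t * t) * (q * q)"
      by (simp add: algebra_simps flip: const_mult_const)
    then show ?thesis
      by (simp only: F_def E_add E_scale riesz_add riesz_const_mult) (simp add: algebra_simps power2_eq_square)
  qed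
  have cauchy: "(LINT x|M. (mpoly_eval (p i) x - mpoly_eval (p j) x)\<^sup>2) \<le> 4 * (1/4) ^ n" if "n \<le> i" "n \<le> j" for i j n
  proof -
    have "(LINT x|M. (mpoly_eval (p i) x - mpoly_eval (p j) x)\<^sup>2) = E ((p i - p j) * (p i - p j))"
      by (simp add: E_int mpoly_eval_mult mpoly_eval_diff power2_eq_square)
    \<comment> \<open>Parallelogram law; the linear part of \<open>F\<close> cancels.\<close>
    also have "\<dots> = 2 * F (p i) + 2 * F (p j) - 4 * F (const (1/2) * (p i + p j))"
    proof -
      have "(p i - p j) * (p i - p j) + (p i + p j) * (p i + p j) = const 2 * (p i * p i) + const 2 * (p j * p j)"
        by (simp add: algebra_simps)
      then have "E ((p i - p j) * (p i - p j)) + E ((p i + p j) * (p i + p j)) = 2 * E (p i * p i) + 2 * E (p j * p j)"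
        by (simp only: E_add[symmetric] E_scale[symmetric])
      moreover have "(const (1/2) * s) * (const (1/2) * s) = const (1/4) * (s * s)" for s :: "'n mpoly"
      proof -
        have "(const (1/2) * s) * (const (1/2) * s) = (const (1/2) * const (1/2)) * (s * s)" by (simp only: mult_ac)
        then show ?thesis by (simp add: const_mult_const)
      qed
      then have "F (const (1/2) * (p i + p j)) = 1/4 * E ((p i + p j) * (p i + p j)) - (riesz u (p i) + riesz u (p j))"
        by (simp only: F_def E_scale riesz_const_mult riesz_add) (simp add: field_simps)
      ultimately show ?thesis by (simp add: F_def)
    qed
    also have "\<dots> \<le> 2 * (m + (1/4) ^ i) + 2 * (m + (1/4) ^ j) - 4 * m"
    proof -
      have "2 * x + 2 * y - 4 * z \<le> 2 * (m + a) + 2 * (m + b) - 4 * m"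
        if "x < m + a" "y < m + b" "m \<le> z" for x y z a b
      proof (rule diff_mono)
        show "2 * x + 2 * y \<le> 2 * (m + a) + 2 * (m + b)"
          using that by (intro add_mono mult_left_mono) auto
        show "4 * m \<le> 4 * z" using that by simp
      qed
      from this[OF p[of i] p[of j] m[of "const (1/2) * (p i + p j)"]] show ?thesis .
    qed
    also have "\<dots> \<le> 4 * (1/4) ^ n"
    proof -
      have "2 * (m + (1/4) ^ i) + 2 * (m + (1/4) ^ j) - 4 * m = 2 * (1/4) ^ i + 2 * (1/4) ^ j"
        by (simp add: algebra_simps)
      also have "\<dots> \<le> 2 * (1/4) ^ n + 2 * (1/4) ^ n"
        using that by (intro add_mono mult_left_mono power_decreasing) auto
      finally show ?thesis by simp
    qed
    finally show ?thesis .
  qed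
  obtain \<phi> where \<phi> [measurable]: "\<phi> \<in> borel_measurable borel" and int: "\<And>n. integrable M (\<lambda>x. (\<phi> x - mpoly_eval (p n) x)\<^sup>2)"
    and close: "\<And>n. (LINT x|M. (\<phi> x - mpoly_eval (p n) x)\<^sup>2) \<le> 4 * (1/4) ^ n"
    using L2_fast_Cauchy_limit[of "\<lambda>n. mpoly_eval (p n)", OF _ _ cauchy] by auto
  have sq: "integrable M (\<lambda>x. (\<phi> x)\<^sup>2)"
    using integrable_square_add[of "\<lambda>x. \<phi> x - mpoly_eval (p 0) x" "mpoly_eval (p 0)"] int[of 0] by simp
  have "(LINT x|M. \<phi> x * mpoly_eval q x) = riesz u q" for q
  proof -
    have i\<phi>: "integrable M (\<lambda>x. \<phi> x * mpoly_eval q x)"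
      using integrable_product[OF \<phi> _ sq, of "mpoly_eval q"] by simp
    have ip: "integrable M (\<lambda>x. mpoly_eval (p n) x * mpoly_eval q x)" for n
      using integrable_poly[of "p n * q"] by (simp add: mpoly_eval_mult[abs_def])
    define N where "N = E (q * q)"
    have N: "N = (LINT x|M. (mpoly_eval q x)\<^sup>2)" by (simp add: N_def E_int mpoly_eval_mult power2_eq_square)
    have N0: "0 \<le> N" unfolding N by simp
    have diff: "norm (E (p n * q) - (LINT x|M. \<phi> x * mpoly_eval q x)) \<le> (4 + N) * (1/2) ^ n" for n
    proof -
      have "E (p n * q) - (LINT x|M. \<phi> x * mpoly_eval q x) = - (LINT x|M. (\<phi> x - mpoly_eval (p n) x) * mpoly_eval q x)"
        unfolding E_int mpoly_eval_mult left_diff_distrib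
        by (subst Bochner_Integration.integral_diff[OF i\<phi> ip]) simp
      then have "norm (E (p n * q) - (LINT x|M. \<phi> x * mpoly_eval q x)) \<le> (LINT x|M. \<bar>(\<phi> x - mpoly_eval (p n) x) * mpoly_eval q x\<bar>)"
        using integral_abs_bound[of M "\<lambda>x. (\<phi> x - mpoly_eval (p n) x) * mpoly_eval q x"] by simp
      also have "\<dots> \<le> (LINT x|M. 2 ^ n * (\<phi> x - mpoly_eval (p n) x)\<^sup>2 + (1/2) ^ n * (mpoly_eval q x)\<^sup>2)"
      proof (rule integral_mono)
        show "integrable M (\<lambda>x. \<bar>(\<phi> x - mpoly_eval (p n) x) * mpoly_eval q x\<bar>)"
          unfolding left_diff_distrib using i\<phi> ip[of n] by simp
        show "integrable M (\<lambda>x. 2 ^ n * (\<phi> x - mpoly_eval (p n) x)\<^sup>2 + (1/2) ^ n * (mpoly_eval q x)\<^sup>2)"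
          using int[of n] by (intro Bochner_Integration.integrable_add integrable_mult_right) auto
        show "\<bar>(\<phi> x - mpoly_eval (p n) x) * mpoly_eval q x\<bar> \<le> 2 ^ n * (\<phi> x - mpoly_eval (p n) x)\<^sup>2 + (1/2) ^ n * (mpoly_eval q x)\<^sup>2" for x
          using abs_le_scaled_squares[of "2 ^ n" "\<phi> x - mpoly_eval (p n) x" "mpoly_eval q x"] by (simp add: power_divide)
      qed
      also have "\<dots> = 2 ^ n * (LINT x|M. (\<phi> x - mpoly_eval (p n) x)\<^sup>2) + (1/2) ^ n * N"
        unfolding N using int[of n] by (subst Bochner_Integration.integral_add) auto
      also have "\<dots> \<le> 2 ^ n * (4 * (1/4) ^ n) + (1/2) ^ n * N"
        using close[of n] by (intro add_mono mult_left_mono) auto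
      also have "(2::real) ^ n * (4 * (1/4) ^ n) = 4 * (1/2) ^ n"
      proof -
        have "(2::real) ^ n * (1/4) ^ n = (1/2) ^ n" by (simp flip: power_mult_distrib)
        then show ?thesis by simp
      qed
      finally show ?thesis by (simp add: algebra_simps)
    qed
    have half: "(\<lambda>n. (1/2 :: real) ^ n) \<longlonglongrightarrow> 0" by (rule LIMSEQ_realpow_zero) auto
    have quarter: "(\<lambda>n. (1/4 :: real) ^ n) \<longlonglongrightarrow> 0" by (rule LIMSEQ_realpow_zero) auto
    have lim: "(\<lambda>n. E (p n * q)) \<longlonglongrightarrow> (LINT x|M. \<phi> x * mpoly_eval q x)"
    proof (rule Lim_null[THEN iffD2], rule Lim_null_comparison)
      show "(\<lambda>n. (4 + N) * (1/2) ^ n) \<longlonglongrightarrow> 0" using tendsto_mult_right_zero[OF half] .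
    qed (use diff in auto)
    define e where "e = (LINT x|M. \<phi> x * mpoly_eval q x) - riesz u q"
    \<comment> \<open>Comparing the near-minimal \<open>p n\<close> with the competitor
      \<open>p n + const t * q\<close> gives the first-order condition up to an error
      (1/4)^n.\<close>
    have "0 \<le> 2 * t * e + t\<^sup>2 * N" for t
    proof (rule LIMSEQ_le_const)
      have "(\<lambda>n. (1/4) ^ n + 2 * t * (E (p n * q) - riesz u q) + t\<^sup>2 * N) \<longlonglongrightarrow> 0 + 2 * t * e + t\<^sup>2 * N"
        unfolding e_def by (intro tendsto_intros quarter lim)
      then show "(\<lambda>n. (1/4) ^ n + 2 * t * (E (p n * q) - riesz u q) + t\<^sup>2 * N) \<longlonglongrightarrow> 2 * t * e + t\<^sup>2 * N" by simp
      have "0 \<le> (1/4) ^ n + 2 * t * (E (p n * q) - riesz u q) + t\<^sup>2 * N" for n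
        using m[of "p n + const t * q"] p[of n] unfolding expand N_def by linarith
      then show "\<exists>k. \<forall>n\<ge>k. 0 \<le> (1/4) ^ n + 2 * t * (E (p n * q) - riesz u q) + t\<^sup>2 * N" by blast
    qed
    \<comment> \<open>A \<open>t\<close> opposite in sign to \<open>e\<close>; \<open>N + 1\<close>
      instead of \<open>N\<close> keeps the divisor positive when \<open>q\<close> vanishes in
      L^2.\<close>
    from this[of "- e / (N + 1)"] have "0 \<le> 2 * (- e / (N + 1)) * e + (- e / (N + 1))\<^sup>2 * N" .
    also have "\<dots> = - (e\<^sup>2 * (N + 2)) / (N + 1)\<^sup>2"
      using N0 by (simp add: divide_simps power2_eq_square) (simp add: algebra_simps)
    finally have "e\<^sup>2 * (N + 2) \<le> 0" using N0 by (simp add: divide_le_0_iff zero_le_divide_iff)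
    then have "e = 0" using N0 by (simp add: mult_le_0_iff)
    then show ?thesis by (simp add: e_def)
  qed
  then show thesis using that[OF \<phi> sq] by blast
qed

end


section \<open>Convergence of the relaxations\<close>

text \<open>Compactness of the moment sequences yields convergent subsequences only; a common limit
  for all of them gives convergence of the full sequence.\<close>

lemma LIMSEQ_if_subsubsequence:
  fixes X :: "nat \<Rightarrow> 'a::metric_space"
  assumes "\<And>s. strict_mono (s :: nat \<Rightarrow> nat) \<Longrightarrow> \<exists>r. strict_mono (r :: nat \<Rightarrow> nat) \<and> (\<lambda>n. X (s (r n))) \<longlonglongrightarrow> L"
  shows "X \<longlonglongrightarrow> L"
proof (rule ccontr)
  assume "\<not> X \<longlonglongrightarrow> L"
  then obtain e where e: "e > 0" "\<And>N. \<exists>n\<ge>N. e \<le> dist (X n) L"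
    by (auto simp: lim_sequentially not_less)
  then have inf: "infinite {n. e \<le> dist (X n) L}"
    by (auto simp: infinite_nat_iff_unbounded_le)
  define s where "s = enumerate {n. e \<le> dist (X n) L}"
  have "strict_mono s" unfolding s_def by (rule strict_mono_enumerate[OF inf])
  then obtain r where "(\<lambda>n. X (s (r n))) \<longlonglongrightarrow> L" using assms by blast
  then obtain n where "dist (X (s (r n))) L < e"
    using e(1) by (auto simp: lim_sequentially)
  moreover have "e \<le> dist (X (s (r n))) L"
    using enumerate_in_set[OF inf, of "r n"] by (simp add: s_def)
  ultimately show False by simp
qed

text \<open>\<open>w_pos\<close> says that the density is positive throughout
  \<open>\<Omega>\<close>; for the exponential measure it is secured by the constraints x_i \<ge>
  0.\<close>

locale relaxation = decaying_density M w C
  for M :: "(real ^ 'n::finite) measure" and w and C +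
  fixes m :: nat and g :: "nat \<Rightarrow> 'n mpoly" and f :: "'n mpoly" and \<Omega> :: "(real ^ 'n) set"
  assumes \<Omega>_eq: "\<Omega> = semialg_set m g"
    and w_pos: "\<And>x. x \<in> \<Omega> \<Longrightarrow> 0 < w x"
    and interior_\<Omega>: "interior \<Omega> \<noteq> {}"
    and f_pos: "AE x in lborel. x \<in> \<Omega> \<longrightarrow> 0 < mpoly_eval f x"
begin

lemma \<Omega>_measurable [measurable]: "\<Omega> \<in> sets borel"
proof -
  have "\<Omega> = (\<Inter>j\<in>{1..m}. {x. 0 \<le> mpoly_eval (g j) x})" by (auto simp: \<Omega>_eq semialg_set_def)
  also have "closed \<dots>"
    by (intro closed_INT ballI closed_Collect_le continuous_intros)
  finally show ?thesis by (rule borel_closed)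
qed

lemma \<Omega>_nonneg: "x \<in> \<Omega> \<Longrightarrow> j \<in> {1..m} \<Longrightarrow> 0 \<le> mpoly_eval (g j) x"
  by (auto simp: \<Omega>_eq semialg_set_def)

lemma AE_f_pos: "AE x in M. x \<in> \<Omega> \<longrightarrow> 0 < mpoly_eval f x"
  unfolding M_eq using f_pos by (subst AE_density) auto

definition z :: "nat ^ 'n \<Rightarrow> real" where
  "z \<alpha> = (LINT x|M. indicator \<Omega> x * monom_eval \<alpha> x)"

lemma integrable_on_\<Omega>: "integrable M h \<Longrightarrow> integrable M (\<lambda>x. indicator \<Omega> x * h x)" for h :: "real ^ 'n \<Rightarrow> real"
  using integrable_mult_indicator[of \<Omega> M h] by simp

lemma riesz_z: "riesz z p = (LINT x|M. indicator \<Omega> x * mpoly_eval p x)"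
  unfolding z_def by (rule riesz_integral) (intro integrable_on_\<Omega> integrable_monom)

text \<open>By continuity a nonzero value would persist on an open subset of
  \<open>\<Omega>\<close>, which has positive measure because \<open>w\<close> is positive
  there.\<close>

lemma zero_integral_imp_zero:
  assumes nonneg: "\<And>x. x \<in> \<Omega> \<Longrightarrow> 0 \<le> mpoly_eval q x" and zero: "riesz z q \<le> 0"
    and x: "x \<in> interior \<Omega>"
  shows "mpoly_eval q x = 0"
proof (rule ccontr)
  assume "mpoly_eval q x \<noteq> 0"
  define V where "V = interior \<Omega> \<inter> {x. mpoly_eval q x \<noteq> 0}"
  have V: "open V" "x \<in> V"
    unfolding V_def using x \<open>mpoly_eval q x \<noteq> 0\<close>
    by (auto intro!: open_Int open_Collect_neq continuous_intros)
  have "riesz z q = 0"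
    using zero nonneg unfolding riesz_z
    by (intro antisym integral_nonneg_AE) (auto simp: indicator_def)
  then have "AE x in M. indicator \<Omega> x * mpoly_eval q x = 0"
    unfolding riesz_z using nonneg integrable_on_\<Omega>[OF integrable_poly[of q]]
    by (subst (asm) integral_nonneg_eq_0_iff_AE) (auto simp: indicator_def)
  then have "AE x in M. x \<notin> V"
    by eventually_elim (use interior_subset in \<open>auto simp: V_def indicator_def\<close>)
  then have "V \<in> null_sets M"
    using V(1) by (subst AE_iff_null_sets) auto
  moreover have "0 < emeasure M V"
    unfolding M_eq using V w_pos interior_subset[of \<Omega>]
    by (intro emeasure_density_pos) (auto simp: V_def)
  ultimately show False by (auto simp: null_sets_def)
qed

text \<open>If the value were not positive, \<open>h\<close> would vanish on the part of the
  interior of \<open>\<Omega>\<close> where \<open>k\<close> does not. This part is open, and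
  nonempty since \<open>k\<close> is not the zero polynomial, so \<open>h\<close> would be
  0.\<close>

lemma z_pos_aux:
  assumes nonneg: "\<And>x. x \<in> \<Omega> \<Longrightarrow> 0 \<le> mpoly_eval k x" and k: "k \<noteq> 0" and h: "h \<noteq> 0"
  shows "0 < riesz z (h * h * k)"
proof (rule ccontr)
  assume "\<not> ?thesis"
  then have zero: "mpoly_eval (h * h * k) x = 0" if "x \<in> interior \<Omega>" for x
    using nonneg that by (intro zero_integral_imp_zero) (auto simp: mpoly_eval_mult)
  define V where "V = interior \<Omega> \<inter> {x. mpoly_eval k x \<noteq> 0}"
  have "open V" unfolding V_def by (intro open_Int open_interior open_Collect_neq continuous_intros)
  moreover have "V \<noteq> {}"
  proof
    assume "V = {}"
    then have "mpoly_eval k x = 0" if "x \<in> interior \<Omega>" for x using that by (auto simp: V_def)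
    then have "k = 0"
      using mpoly_zero_on_open_imp_zero[OF open_interior interior_\<Omega>, of k] by blast
    then show False using k by contradiction
  qed
  moreover have "mpoly_eval h x = 0" if "x \<in> V" for x
    using zero[of x] that by (auto simp: V_def mpoly_eval_mult)
  ultimately have "h = 0" by (rule mpoly_zero_on_open_imp_zero)
  then show False using h by contradiction
qed

abbreviation L :: real where
  "L \<equiv> LINT x:\<Omega>|M. mpoly_eval f x"

lemma riesz_z_f: "riesz z f = L"
  by (simp add: riesz_z set_lebesgue_integral_def)

lemma sdp_order:
  assumes d: "d \<in> orders m g f"
  shows "sdp M m g f d z"
proof
  show "half_deg (g j) \<le> d" if "j \<in> {1..m}" for j
    using d that unfolding orders_def by (auto intro: order_trans[OF Max_ge])
  show "f \<in> mpolys_le (2 * d)" using d by (simp add: orders_def mpolys_le_def)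
  show "riesz z (h * h) \<le> riesz (moment M) (h * h)" for h
    unfolding riesz_z riesz_moment
    by (rule integral_mono[OF integrable_on_\<Omega>[OF integrable_poly] integrable_poly])
      (auto simp: mpoly_eval_mult indicator_def)
  show "0 < riesz z (h * h)" if "h \<noteq> 0" for h
    using z_pos_aux[of 1 h] that by simp
  show "0 < riesz z (h * h * g j)" if "j \<in> {1..m}" "g j \<noteq> 0" "h \<noteq> 0" for j h
    using that \<Omega>_nonneg by (intro z_pos_aux) auto
  show "0 \<le> riesz z f"
    unfolding riesz_z using AE_f_pos
    by (intro integral_nonneg_AE) (auto elim!: eventually_mono simp: indicator_def less_imp_le)
  show "dual_objective M p = riesz (moment M) p" for p
    by (simp add: dual_objective_def riesz_moment)
qed

lemma primal_limit:
  fixes s :: "nat \<Rightarrow> nat" and u v :: "nat \<Rightarrow> nat ^ 'n \<Rightarrow> real"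
  assumes s: "strict_mono s" "\<And>n. s n \<in> orders m g f"
    and feas: "\<And>n. primal_feasible M m g (s n) (u n, v n)"
    and ge: "\<And>n. L \<le> riesz (u n) f"
  shows "\<exists>r. strict_mono (r :: nat \<Rightarrow> nat) \<and> (\<lambda>n. u (r n) 0) \<longlonglongrightarrow> measure M \<Omega> \<and>
    (\<lambda>n. riesz (u (r n)) f) \<longlonglongrightarrow> L"
proof -
  let ?y = "moment M"
  have moments: "0 \<le> riesz (u n) (h * h) \<and> riesz (u n) (h * h) \<le> riesz ?y (h * h)" if "h \<in> mpolys_le (s n)" for n h
    using sdp.primal_feasibleD(1)[OF sdp_order[OF s(2)] feas SOS_square[OF that]] .
  have local: "0 \<le> riesz (u n) (h * h * g j)" if "j \<in> {1..m}" "h \<in> mpolys_le (s n - half_deg (g j))" for n j h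
    using feas[of n] that unfolding primal_feasible_def psd_localizing_iff by auto
  have "Bseq (\<lambda>n. u n \<alpha>)" for \<alpha>
  proof -
    define t :: "'n mpoly" where "t = Poly_Mapping.single \<alpha> 1"
    \<comment> \<open>Polarisation with the exponents \<alpha> and 0 gives a bound independent of n
      once \<alpha> is within the truncation; finitely many earlier terms do not affect
      boundedness.\<close>
    have "norm (u n \<alpha>) \<le> riesz ?y ((t + 1) * (t + 1)) + riesz ?y ((t - 1) * (t - 1))" if "exp_deg \<alpha> \<le> n" for n
    proof -
      have "\<alpha> \<in> exps_le (s n)" using that strict_mono_imp_increasing[OF s(1), of n] by (simp add: exps_le_def)
      then show ?thesis
        using abs_moment_le[of "s n" "u n" ?y \<alpha> 0] moments by (simp add: t_def)
    qed
    then show ?thesis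
      by (intro BfunI[of _ "riesz ?y ((t + 1) * (t + 1)) + riesz ?y ((t - 1) * (t - 1))"])
        (auto simp: eventually_sequentially)
  qed
  then obtain r l where r: "strict_mono (r :: nat \<Rightarrow> nat)" "\<And>\<alpha>. (\<lambda>n. u (r n) \<alpha>) \<longlonglongrightarrow> l \<alpha>"
    using pointwise_convergent_subsequence[of u] by blast
  have lim: "(\<lambda>n. riesz (u (r n)) p) \<longlonglongrightarrow> riesz l p" for p
    by (rule tendsto_riesz_fun[where u = "\<lambda>n. u (r n)", OF r(2)])
  have large: "n \<le> s (r n)" for n
    using strict_mono_imp_increasing[OF s(1), of "r n"] strict_mono_imp_increasing[OF r(1), of n] by linarith
  \<comment> \<open>Each fixed test polynomial is admissible from some index on, so its inequality
    passes to the limit.\<close>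
  have deg: "h \<in> mpolys_le (s (r n) - k)" if "mdegree h + k \<le> n" for n h k
    using large[of n] that by (simp add: mpolys_le_def)
  have l_nonneg: "0 \<le> riesz l (h * h)" for h
    using moments deg[of h 0] by (intro LIMSEQ_le_const[OF lim] exI[of _ "mdegree h"]) auto
  have l_le: "riesz l (h * h) \<le> riesz ?y (h * h)" for h
    using moments deg[of h 0] by (intro LIMSEQ_le_const2[OF lim] exI[of _ "mdegree h"]) auto
  have l_local: "0 \<le> riesz l (h * h * g j)" if "j \<in> {1..m}" for h j
    using local[OF that] deg[of h "half_deg (g j)"]
    by (intro LIMSEQ_le_const[OF lim] exI[of _ "mdegree h + half_deg (g j)"]) auto
  have l_f: "L \<le> riesz l f"
    using ge by (intro LIMSEQ_le_const[OF lim]) auto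
  obtain \<phi> where \<phi> [measurable]: "\<phi> \<in> borel_measurable borel" and sq: "integrable M (\<lambda>x. (\<phi> x)\<^sup>2)"
    and rep: "\<And>p. (LINT x|M. \<phi> x * mpoly_eval p x) = riesz l p"
    using riesz_representation[of l, OF l_nonneg l_le] by blast
  have int\<phi>: "integrable M (\<lambda>x. \<phi> x * mpoly_eval p x)" for p
    using integrable_product[OF \<phi> _ sq, of "mpoly_eval p"] by simp
  have nonneg: "AE x in M. 0 \<le> \<phi> x"
    using AE_nonneg_if_tested_nonneg[OF \<phi> sq, of 1] rep l_nonneg by simp
  have le1: "AE x in M. \<phi> x \<le> 1"
  proof -
    \<comment> \<open>Domination by \<open>?y\<close> on squares is nonnegativity of
      \<open>1 - \<phi>\<close> tested against squares.\<close>
    have "AE x in M. 0 \<le> (1 - \<phi> x) * mpoly_eval 1 x"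
    proof (rule AE_nonneg_if_tested_nonneg)
      have "integrable M (\<lambda>x. (1 :: real)\<^sup>2)"
        using integrable_poly_square[of 1] by simp
      then show "integrable M (\<lambda>x. (1 - \<phi> x)\<^sup>2)"
        using integrable_square_add[of "\<lambda>_. 1" "\<lambda>x. - \<phi> x"] sq by simp
      fix h
      have "(LINT x|M. (1 - \<phi> x) * mpoly_eval (h * h * 1) x) = (LINT x|M. mpoly_eval (h * h) x) - (LINT x|M. \<phi> x * mpoly_eval (h * h) x)"
        using int\<phi>[of "h * h"] by (simp add: left_diff_distrib)
      then show "0 \<le> (LINT x|M. (1 - \<phi> x) * mpoly_eval (h * h * 1) x)"
        using l_le[of h] by (simp add: rep riesz_moment)
    qed measurable
    then show ?thesis by simp
  qed
  have "AE x in M. 0 \<le> \<phi> x * mpoly_eval (g j) x" if "j \<in> {1..m}" for j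
    using AE_nonneg_if_tested_nonneg[OF \<phi> sq, of "g j"] rep l_local[OF that] by simp
  then have loc: "AE x in M. \<forall>j\<in>{1..m}. 0 \<le> \<phi> x * mpoly_eval (g j) x"
    by (intro AE_finite_allI) auto
  have outside: "AE x in M. x \<notin> \<Omega> \<longrightarrow> \<phi> x = 0"
    using nonneg loc
  proof eventually_elim
    fix x assume x: "0 \<le> \<phi> x" "\<forall>j\<in>{1..m}. 0 \<le> \<phi> x * mpoly_eval (g j) x"
    show "x \<notin> \<Omega> \<longrightarrow> \<phi> x = 0"
    proof
      assume "x \<notin> \<Omega>"
      then obtain j where "j \<in> {1..m}" "mpoly_eval (g j) x < 0" by (auto simp: \<Omega>_eq semialg_set_def not_le)
      then show "\<phi> x = 0" using x by (auto simp: zero_le_mult_iff dest!: bspec[of _ _ j])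
    qed
  qed
  have int_diff: "integrable M (\<lambda>x. indicator \<Omega> x * mpoly_eval f x - \<phi> x * mpoly_eval f x)"
    by (intro Bochner_Integration.integrable_diff integrable_on_\<Omega> int\<phi>) simp
  \<comment> \<open>On \<open>\<Omega>\<close> the integrand is (1 - \<phi>) f with f > 0 almost
    everywhere; outside, both terms vanish. Its integral gives the inequality opposite to
    \<open>l_f\<close>.\<close>
  have diff_nonneg: "AE x in M. 0 \<le> indicator \<Omega> x * mpoly_eval f x - \<phi> x * mpoly_eval f x"
    using le1 outside AE_f_pos
    by eventually_elim (auto simp: indicator_def mult_le_cancel_right1 split: if_splits)
  have diff_eq: "(LINT x|M. indicator \<Omega> x * mpoly_eval f x - \<phi> x * mpoly_eval f x) = L - riesz l f"
    using int\<phi>[of f] integrable_on_\<Omega>[OF integrable_poly[of f]]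
    by (subst Bochner_Integration.integral_diff) (auto simp: rep set_lebesgue_integral_def)
  moreover have "0 \<le> (LINT x|M. indicator \<Omega> x * mpoly_eval f x - \<phi> x * mpoly_eval f x)"
    using diff_nonneg by (rule integral_nonneg_AE)
  ultimately have lf: "riesz l f = L" using l_f by linarith
  then have "AE x in M. indicator \<Omega> x * mpoly_eval f x - \<phi> x * mpoly_eval f x = 0"
    using diff_eq integral_nonneg_eq_0_iff_AE[OF int_diff diff_nonneg] by simp
  then have "AE x in M. \<phi> x = indicator \<Omega> x"
    using outside AE_f_pos by eventually_elim (auto simp: indicator_def split: if_splits)
  then have "(LINT x|M. \<phi> x * mpoly_eval 1 x) = (LINT x|M. indicator \<Omega> x)"
    by (intro integral_cong_AE) auto
  then have "riesz l 1 = measure M \<Omega>" unfolding rep by simp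
  moreover have "riesz l 1 = l 0" using riesz_single[of l 0 1] by simp
  ultimately have "l 0 = measure M \<Omega>" by simp
  then show ?thesis using r lim[of f] lf by metis
qed

lemma optimal_feasible:
  assumes "d \<in> orders m g f" "primal_optimal M m g f d (u, v)"
  shows "primal_feasible M m g d (u, v)" "L \<le> riesz u f" "primal_value M m g f d = ereal (riesz u f)"
proof -
  interpret S: sdp M m g f d z by (rule sdp_order[OF assms(1)])
  show feas: "primal_feasible M m g d (u, v)"
    using assms(2) by (simp add: primal_optimal_def is_arg_max_def)
  have max: "riesz u' f \<le> riesz u f" if "primal_feasible M m g d (u', v')" for u' v'
    using assms(2) that by (auto simp: primal_optimal_def is_arg_max_def primal_objective_def not_less)
  show "L \<le> riesz u f"
    using max[OF S.feasible_z] by (simp add: riesz_z_f)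
  show "primal_value M m g f d = ereal (riesz u f)"
    unfolding primal_value_def
  proof (rule antisym)
    show "(SUP w\<in>Collect (primal_feasible M m g d). ereal (primal_objective f w)) \<le> ereal (riesz u f)"
      using max by (intro SUP_least) (auto simp: primal_objective_def)
    show "ereal (riesz u f) \<le> (SUP w\<in>Collect (primal_feasible M m g d). ereal (primal_objective f w))"
      using feas by (intro SUP_upper2[of "(u, v)"]) (auto simp: primal_objective_def)
  qed
qed

lemma orders_shift: "\<exists>N. \<forall>d\<ge>N. d \<in> orders m g f"
proof -
  define N where "N = Max ((\<lambda>j. half_deg (g j)) ` {1..m}) + mdegree f"
  have "d \<in> orders m g f" if "d \<ge> N" for d
    using that by (auto simp: N_def orders_def)
  then show ?thesis by blast
qed

lemma optimal_limits:
  assumes opt: "\<forall>d\<in>orders m g f. primal_optimal M m g f d (u d, v d)"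
  shows "(\<lambda>d. u d 0) \<longlonglongrightarrow> measure M \<Omega>" "(\<lambda>d. riesz (u d) f) \<longlonglongrightarrow> L"
proof -
  obtain N where N: "\<And>d. d \<ge> N \<Longrightarrow> d \<in> orders m g f" using orders_shift by blast
  \<comment> \<open>Optimality is assumed only at members of \<open>orders\<close>, hence the shift
    by \<open>N\<close>.\<close>
  have sub: "\<exists>r. strict_mono (r :: nat \<Rightarrow> nat) \<and> (\<lambda>n. u (s (r n) + N) 0) \<longlonglongrightarrow> measure M \<Omega> \<and>
      (\<lambda>n. riesz (u (s (r n) + N)) f) \<longlonglongrightarrow> L" if s: "strict_mono (s :: nat \<Rightarrow> nat)" for s
  proof (rule primal_limit[of "\<lambda>n. s n + N" "\<lambda>n. u (s n + N)" "\<lambda>n. v (s n + N)"])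
    show "strict_mono (\<lambda>n. s n + N)" using s by (simp add: strict_mono_def)
    show "s n + N \<in> orders m g f" for n by (rule N) simp
    then show "primal_feasible M m g (s n + N) (u (s n + N), v (s n + N))" "L \<le> riesz (u (s n + N)) f" for n
      using opt optimal_feasible by blast+
  qed
  have "(\<lambda>d. u (d + N) 0) \<longlonglongrightarrow> measure M \<Omega>"
    by (rule LIMSEQ_if_subsubsequence) (use sub in blast)
  then show "(\<lambda>d. u d 0) \<longlonglongrightarrow> measure M \<Omega>" by (rule LIMSEQ_offset)
  have "(\<lambda>d. riesz (u (d + N)) f) \<longlonglongrightarrow> L"
    by (rule LIMSEQ_if_subsubsequence) (use sub in blast)
  then show "(\<lambda>d. riesz (u d) f) \<longlonglongrightarrow> L" by (rule LIMSEQ_offset)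
qed

lemma sdp_order_solution:
  assumes "d \<in> orders m g f"
  shows "(\<exists>w. primal_optimal M m g f d w) \<and> (\<exists>p. dual_optimal M m g f d p) \<and>
    primal_value M m g f d = dual_value M m g f d"
proof -
  interpret S: sdp M m g f d z by (rule sdp_order[OF assms])
  show ?thesis by (rule S.sdp_solution) auto
qed

lemma primal_value_antimono: "antimono_on (orders m g f) (primal_value M m g f)"
proof (rule monotone_onI)
  fix d d' assume d: "d \<in> orders m g f" "d' \<in> orders m g f" "d \<le> d'"
  interpret S: sdp M m g f d z by (rule sdp_order[OF d(1)])
  have "Collect (primal_feasible M m g d') \<subseteq> Collect (primal_feasible M m g d)"
    using primal_feasible_antimono[OF _ d(3)] S.order(1) by blast
  then show "primal_value M m g f d' \<le> primal_value M m g f d"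
    unfolding primal_value_def by (intro SUP_subset_mono) auto
qed

lemma primal_value_tendsto: "primal_value M m g f \<longlonglongrightarrow> ereal L"
proof -
  have "\<forall>d\<in>orders m g f. \<exists>w. primal_optimal M m g f d w" using sdp_order_solution by blast
  then obtain w where w: "\<forall>d\<in>orders m g f. primal_optimal M m g f d (w d)" by metis
  define u v where "u d = fst (w d)" and "v d = snd (w d)" for d
  have opt: "\<forall>d\<in>orders m g f. primal_optimal M m g f d (u d, v d)" using w by (simp add: u_def v_def)
  have "(\<lambda>d. ereal (riesz (u d) f)) \<longlonglongrightarrow> ereal L"
    using optimal_limits(2)[OF opt] by (rule tendsto_ereal)
  moreover obtain N where N: "\<And>d. d \<ge> N \<Longrightarrow> d \<in> orders m g f" using orders_shift by blast
  have "\<forall>\<^sub>F d in sequentially. ereal (riesz (u d) f) = primal_value M m g f d"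
    using eventually_ge_at_top[of N]
    by eventually_elim (use N opt optimal_feasible(3) in metis)
  ultimately show ?thesis by (rule Lim_transform_eventually)
qed

end

section \<open>The Gaussian and the exponential measure\<close>

lemma gaussian_decaying_density:
  "decaying_density (gaussian_measure :: (real ^ 'n::finite) measure)
    (\<lambda>x. (2 * pi) powr (- real CARD('n) / 2) * exp (- (norm x)\<^sup>2 / 2))
    ((2 * pi) powr (- real CARD('n) / 2) * exp (1 / 2))"
proof
  fix x :: "real ^ 'n"
  \<comment> \<open>The 1/2 left over from this square is the factor exp(1/2) in the
    constant.\<close>
  have "0 \<le> (norm x - 1)\<^sup>2" by simp
  then have "- (norm x)\<^sup>2 / 2 \<le> 1 / 2 - norm x" by (simp add: power2_diff)
  then have "exp (- (norm x)\<^sup>2 / 2) \<le> exp (1 / 2) * exp (- norm x)" by (simp flip: exp_add)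
  then show "(2 * pi) powr (- real CARD('n) / 2) * exp (- (norm x)\<^sup>2 / 2)
      \<le> (2 * pi) powr (- real CARD('n) / 2) * exp (1 / 2) * exp (- norm x)"
    by (simp add: mult.assoc mult_left_mono)
qed (auto simp: gaussian_measure_def)

lemma exponential_decaying_density:
  "decaying_density (exponential_measure :: (real ^ 'n::finite) measure)
    (\<lambda>x. (2 * pi) powr (- real CARD('n) / 2) * exp (- (\<Sum>i\<in>UNIV. x $ i)) * indicator nonneg_orthant x)
    ((2 * pi) powr (- real CARD('n) / 2))"
proof
  have [measurable]: "nonneg_orthant \<in> sets (borel :: (real ^ 'n) measure)"
    using closed_nonneg_orthant by (rule borel_closed)
  show "(\<lambda>x::real ^ 'n. (2 * pi) powr (- real CARD('n) / 2) * exp (- (\<Sum>i\<in>UNIV. x $ i)) * indicator nonneg_orthant x)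
    \<in> borel_measurable borel"
    by (intro borel_measurable_times borel_measurable_indicator borel_measurable_continuous_onI continuous_intros) auto
  fix x :: "real ^ 'n"
  show "(2 * pi) powr (- real CARD('n) / 2) * exp (- (\<Sum>i\<in>UNIV. x $ i)) * indicator nonneg_orthant x
      \<le> (2 * pi) powr (- real CARD('n) / 2) * exp (- norm x)"
  proof (cases "x \<in> nonneg_orthant")
    case True
    \<comment> \<open>On the orthant the coordinate sum is the l1 norm, which dominates the
      Euclidean norm.\<close>
    then have "norm x \<le> (\<Sum>i\<in>UNIV. x $ i)"
      using norm_le_l1_cart[of x] by (simp add: nonneg_orthant_def)
    then show ?thesis using True by (simp add: mult_left_mono)
  qed simp
qed (auto simp: exponential_measure_def)

theorem theorem2p3:
  fixes \<mu> :: "(real ^ 'n::finite) measure"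
    and m :: nat
    and g :: "nat \<Rightarrow> 'n mpoly"
    and f :: "'n mpoly"
    and \<Omega> :: "(real ^ 'n) set"
  assumes \<Omega>: "\<Omega> = semialg_set m g"
    and \<mu>: "\<mu> = gaussian_measure \<or>
            \<mu> = exponential_measure \<and> (\<forall>i. \<exists>j\<in>{1..m}. g j = var i)"
    and int1: "interior \<Omega> \<noteq> {}"
    and int2: "interior (measure_support \<mu> - \<Omega>) \<noteq> {}"
    and f_pos: "AE x in lborel. x \<in> \<Omega> \<longrightarrow> 0 < mpoly_eval f x"
  shows
    "(\<forall>d\<in>orders m g f.
        (\<exists>w. primal_optimal \<mu> m g f d w) \<and>
        (\<exists>p. dual_optimal \<mu> m g f d p) \<and>
        primal_value \<mu> m g f d = dual_value \<mu> m g f d)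
     \<and>
     (antimono_on (orders m g f) (primal_value \<mu> m g f) \<and>
      primal_value \<mu> m g f \<longlonglongrightarrow> ereal (LINT x:\<Omega>|\<mu>. mpoly_eval f x) \<and>
      (\<forall>u v. (\<forall>d\<in>orders m g f. primal_optimal \<mu> m g f d (u d, v d)) \<longrightarrow>
             (\<lambda>d. u d 0) \<longlonglongrightarrow> measure \<mu> \<Omega>))
     \<and>
     (f = 1 \<longrightarrow>
      antimono_on (orders m g f) (primal_value \<mu> m g f) \<and>
      primal_value \<mu> m g f \<longlonglongrightarrow> ereal (measure \<mu> \<Omega>))"
proof -
  obtain w C where dens: "decaying_density \<mu> w C" and pos: "\<And>x. x \<in> \<Omega> \<Longrightarrow> 0 < w x"
  proof (cases "\<mu> = gaussian_measure")
    case True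
    then show thesis using that[OF gaussian_decaying_density[where 'n = 'n, folded True]] by simp
  next
    case False
    then have eq: "\<mu> = exponential_measure" and vars: "\<forall>i. \<exists>j\<in>{1..m}. g j = var i" using \<mu> by auto
    have "x \<in> nonneg_orthant" if "x \<in> \<Omega>" for x
      unfolding nonneg_orthant_def
    proof (intro CollectI allI)
      fix i
      obtain j where j: "j \<in> {1..m}" "g j = var i" using vars by blast
      have "0 \<le> mpoly_eval (g j) x" using that j(1) by (simp add: \<Omega> semialg_set_def)
      then show "0 \<le> x $ i" using j(2) by simp
    qed
    then show thesis using that[OF exponential_decaying_density[where 'n = 'n, folded eq]] by simp
  qed
  interpret relaxation \<mu> w C m g f \<Omega>
    using dens pos \<Omega> int1 f_pos by (intro relaxation.intro relaxation_axioms.intro)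
  \<comment> \<open>For \<open>f = 1\<close> the limit in (b) is the measure of
    \<open>\<Omega>\<close>, so (c) is a case of (b).\<close>
  have "(LINT x:\<Omega>|\<mu>. mpoly_eval 1 x) = measure \<mu> \<Omega>"
    by (simp add: set_lebesgue_integral_def)
  then show ?thesis
    using sdp_order_solution primal_value_antimono primal_value_tendsto optimal_limits(1) by auto
qed

end
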